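(* Let $n\ge 2$. (1) Let $F_n$ denote the free group on $n$ generators $u_1,\dots,u_n$, identified with $\pi_1(\Sigma_B,0)$, where $\Sigma_B=\mathbb{C}\setminus\{1,\dots,n\}$, via $u_i=[\gamma_i]$. Then Artin's representation $\rho_B:\mathcal{B}_n\to\mathrm{Aut}(F_n)$, defined topologically by $\rho_B(\alpha_i)=(\sigma_i)_*$ for $1\le i\le n-1$, where $\sigma_i$ is the braid twist of $\Sigma_B$ exchanging the punctures $i$ and $i+1$, is well-defined and is given algebraically by $$\rho_B(\alpha_i):\quad u_i\mapsto u_{i+1},\qquad u_{i+1}\mapsto u_{i+1}^{-1}u_iu_{i+1},\qquad u_j\mapsto u_j\ \text{ for } j\notin\{i,i+1\}.$$ (2) We have $A(B_n)\cong F_n\rtimes_{\rho_B}\mathcal{B}_n$, where the projection onto the second factor is $\pi_B$ and the section $\mathcal{B}_n\hookrightarrow F_n\rtimes\mathcal{B}_n$ is $s_B$. In particular, $\ker\pi_B$ is a free group of rank $n$.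
   Context: $\mathcal{B}_n$ is the $n$-string braid group with standard generators $\alpha_1,\dots,\alpha_{n-1}$ (relations $\alpha_i\alpha_{i+1}\alpha_i=\alpha_{i+1}\alpha_i\alpha_{i+1}$, and $\alpha_i\alpha_j=\alpha_j\alpha_i$ for $|i-j|\ge2$). $A(B_n)$ is the Artin group of type $B_n$: generators $\beta_1,\dots,\beta_n$ with relations $\beta_1\beta_2\beta_1\beta_2=\beta_2\beta_1\beta_2\beta_1$, $\beta_i\beta_{i+1}\beta_i=\beta_{i+1}\beta_i\beta_{i+1}$ for $2\le i\le n-1$, and $\beta_i\beta_j=\beta_j\beta_i$ for $|i-j|\ge2$. The epimorphism $\pi_B:A(B_n)\to\mathcal{B}_n$ is given by $\pi_B(\beta_1)=1$ and $\pi_B(\beta_i)=\alpha_{i-1}$ for $2\le i\le n$; the homomorphism $s_B:\mathcal{B}_n\to A(B_n)$ is given by $s_B(\alpha_i)=\beta_{i+1}$ for $1\le i\le n-1$, and is a section of $\pi_B$. Topological data: $\Sigma_B=\mathbb{C}\setminus\{1,\dots,n\}$ with basepoint $0$. For $1\le i\le n$, $\gamma_i$ is the loop at $0$ which runs above the punctures $1,\dots,i-1$ to a point near $i$, goes once counterclockwise around $i$, and returns along the same path; the classes $[\gamma_i]$ freely generate $\pi_1(\Sigma_B,0)$ (loops are composed from left to right). For $1\le i\le n-1$, let $c_i$ be a round circle through $i$ and $i+1$ (as antipodal points) bounding a disk which contains no other puncture and not the basepoint. The braid twist $\sigma_i$ on $c_i$ is the homeomorphism of $\Sigma_B$ (up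 to isotopy) which is the identity outside a small neighbourhood of that disk and which exchanges $i$ and $i+1$ by a clockwise half-turn, so that $i$ moves to $i+1$ through the upper half-plane; $(\sigma_i)_*$ is the induced automorphism of $\pi_1(\Sigma_B,0)$. In $F_n\rtimes_{\rho_B}\mathcal{B}_n$, conjugation of $f\in F_n$ by $g\in\mathcal{B}_n$ is $gfg^{-1}=\rho_B(g)(f)$. *)

theory Defs
  imports
    "HOL-Complex_Analysis.Contour_Integration"
    "HOL-Algebra.Bij"
    "HOL-Algebra.Coset"
begin

section \<open>Group presentations\<close>

text \<open>A letter \<open>(x, True)\<close> is the generator \<open>x\<close>, and \<open>(x, False)\<close> is its formal inverse.
  A relation \<open>l = r\<close> is the pair \<open>(l, r)\<close>.\<close>

type_synonym 'a word = "('a \<times> bool) list"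

inductive pres_eq :: "'a set \<Rightarrow> ('a word \<times> 'a word) set \<Rightarrow> 'a word \<Rightarrow> 'a word \<Rightarrow> bool"
  for X R where
  refl: "w \<in> lists (X \<times> UNIV) \<Longrightarrow> pres_eq X R w w"
| sym: "pres_eq X R v w \<Longrightarrow> pres_eq X R w v"
| trans: "pres_eq X R u v \<Longrightarrow> pres_eq X R v w \<Longrightarrow> pres_eq X R u w"
| cong: "pres_eq X R u u' \<Longrightarrow> pres_eq X R v v' \<Longrightarrow> pres_eq X R (u @ v) (u' @ v')"
| cancel: "x \<in> X \<Longrightarrow> pres_eq X R [(x, b), (x, \<not> b)] []"
| relation: "(l, r) \<in> R \<Longrightarrow> l \<in> lists (X \<times> UNIV) \<Longrightarrow> r \<in> lists (X \<times> UNIV) \<Longrightarrow> pres_eq X R l r"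

definition presented_group :: "'a set \<Rightarrow> ('a word \<times> 'a word) set \<Rightarrow> 'a word set monoid" where
  "presented_group X R =
    \<lparr>carrier = lists (X \<times> UNIV) // {(v, w). pres_eq X R v w},
     mult = (\<lambda>V W. \<Union>v\<in>V. \<Union>w\<in>W. {u. pres_eq X R (v @ w) u}),
     one = {u. pres_eq X R [] u}\<rparr>"

definition pres_gen :: "'a set \<Rightarrow> ('a word \<times> 'a word) set \<Rightarrow> 'a \<Rightarrow> 'a word set" where
  "pres_gen X R x = {u. pres_eq X R [(x, True)] u}"

definition word_eval :: "('g, 'b) monoid_scheme \<Rightarrow> ('a \<Rightarrow> 'g) \<Rightarrow> 'a word \<Rightarrow> 'g" where
  "word_eval G \<phi> w =
    foldr (\<lambda>(x, b) g. (if b then \<phi> x else inv\<^bsub>G\<^esub> (\<phi> x)) \<otimes>\<^bsub>G\<^esub> g) w \<one>\<^bsub>G\<^esub>"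

text \<open>The map on a presented group that sends each generator \<open>x\<close> to \<open>\<phi> x\<close>. It is a meaningful
  value only if \<open>\<phi>\<close> respects the relations, so that \<open>word_eval G \<phi>\<close> is constant on classes.\<close>

definition pres_lift :: "('g, 'b) monoid_scheme \<Rightarrow> ('a \<Rightarrow> 'g) \<Rightarrow> 'a word set \<Rightarrow> 'g" where
  "pres_lift G \<phi> W = the_elem (word_eval G \<phi> ` W)"

definition semidirect_product ::
    "('a, 'c) monoid_scheme \<Rightarrow> ('b, 'd) monoid_scheme \<Rightarrow> ('b \<Rightarrow> 'a \<Rightarrow> 'a) \<Rightarrow> ('a \<times> 'b) monoid" where
  "semidirect_product N H \<rho> =
    \<lparr>carrier = carrier N \<times> carrier H,
     mult = (\<lambda>(f, g) (f', g'). (f \<otimes>\<^bsub>N\<^esub> \<rho> g f', g \<otimes>\<^bsub>H\<^esub> g')),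
     one = (\<one>\<^bsub>N\<^esub>, \<one>\<^bsub>H\<^esub>)\<rparr>"


section \<open>Free groups, braid groups and Artin groups of type B\<close>

definition pos_word :: "'a list \<Rightarrow> 'a word" where
  "pos_word xs = map (\<lambda>x. (x, True)) xs"

definition free_group :: "nat \<Rightarrow> nat word set monoid" where
  "free_group n = presented_group {1..n} {}"

definition free_gen :: "nat \<Rightarrow> nat \<Rightarrow> nat word set" where
  "free_gen n = pres_gen {1..n} {}"

definition braid_relations :: "nat \<Rightarrow> (nat word \<times> nat word) set" where
  "braid_relations n =
    {(pos_word [i, i + 1, i], pos_word [i + 1, i, i + 1]) | i. 1 \<le> i \<and> i + 1 \<le> n - 1} \<union>
    {(pos_word [i, j], pos_word [j, i]) | i j.
       i \<in> {1..n - 1} \<and> j \<in> {1..n - 1} \<and> \<bar>int i - int j\<bar> \<ge> 2}"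

definition braid_group :: "nat \<Rightarrow> nat word set monoid" where
  "braid_group n = presented_group {1..n - 1} (braid_relations n)"

definition braid_gen :: "nat \<Rightarrow> nat \<Rightarrow> nat word set" where
  "braid_gen n = pres_gen {1..n - 1} (braid_relations n)"

definition artin_B_relations :: "nat \<Rightarrow> (nat word \<times> nat word) set" where
  "artin_B_relations n =
    {(pos_word [1, 2, 1, 2], pos_word [2, 1, 2, 1])} \<union>
    {(pos_word [i, i + 1, i], pos_word [i + 1, i, i + 1]) | i. 2 \<le> i \<and> i \<le> n - 1} \<union>
    {(pos_word [i, j], pos_word [j, i]) | i j.
       i \<in> {1..n} \<and> j \<in> {1..n} \<and> \<bar>int i - int j\<bar> \<ge> 2}"

definition artin_B :: "nat \<Rightarrow> nat word set monoid" where
  "artin_B n = presented_group {1..n} (artin_B_relations n)"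

definition artin_B_gen :: "nat \<Rightarrow> nat \<Rightarrow> nat word set" where
  "artin_B_gen n = pres_gen {1..n} (artin_B_relations n)"

definition pi_B :: "nat \<Rightarrow> nat word set \<Rightarrow> nat word set" where
  "pi_B n = pres_lift (braid_group n)
     (\<lambda>i. if i = 1 then \<one>\<^bsub>braid_group n\<^esub> else braid_gen n (i - 1))"

definition s_B :: "nat \<Rightarrow> nat word set \<Rightarrow> nat word set" where
  "s_B n = pres_lift (artin_B n) (\<lambda>i. artin_B_gen n (i + 1))"


section \<open>Fundamental groups\<close>

definition loops :: "'a::topological_space set \<Rightarrow> 'a \<Rightarrow> (real \<Rightarrow> 'a) set" where
  "loops S x = {p. path p \<and> path_image p \<subseteq> S \<and> pathstart p = x \<and> pathfinish p = x}"

definition loop_class :: "'a::topological_space set \<Rightarrow> (real \<Rightarrow> 'a) \<Rightarrow> (real \<Rightarrow> 'a) set" where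
  "loop_class S p = {q. homotopic_paths S p q}"

definition pi1 :: "'a::real_normed_vector set \<Rightarrow> 'a \<Rightarrow> (real \<Rightarrow> 'a) set monoid" where
  "pi1 S x =
    \<lparr>carrier = loops S x // {(p, q). homotopic_paths S p q},
     mult = (\<lambda>P Q. \<Union>p\<in>P. \<Union>q\<in>Q. loop_class S (p +++ q)),
     one = loop_class S (linepath x x)\<rparr>"

text \<open>The map induced on classes of loops by a map with codomain \<open>T\<close>.\<close>

definition pi1_map ::
    "'b::topological_space set \<Rightarrow> ('a \<Rightarrow> 'b) \<Rightarrow> (real \<Rightarrow> 'a) set \<Rightarrow> (real \<Rightarrow> 'b) set" where
  "pi1_map T f P = (\<Union>p\<in>P. loop_class T (f \<circ> p))"


section \<open>Braid twists of the punctured plane and Artin's representation\<close>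

definition Sigma_B :: "nat \<Rightarrow> complex set" where
  "Sigma_B n = - (of_nat ` {1..n})"

text \<open>The straight segment from \<open>0\<close> to the top of the circle around the puncture \<open>i\<close> lies, except
  for its initial point, in the upper half-plane, so it runs above the punctures
  \<open>1, \<dots>, i - 1\<close>.\<close>

definition gamma :: "nat \<Rightarrow> real \<Rightarrow> complex" where
  "gamma i =
    (let tail = linepath 0 (of_nat i + \<i> / 2)
     in tail +++ part_circlepath (of_nat i) (1/2) (pi/2) (pi/2 + 2 * pi) +++ reversepath tail)"

text \<open>Clockwise half-turn of the disk with diameter from \<open>i\<close> to \<open>i + 1\<close>. The rotation angle
  goes linearly from \<open>-pi\<close> to \<open>0\<close> on the surrounding annulus of width \<open>\<epsilon>\<close>; for \<open>0 < \<epsilon> < 1\<close>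
  this annulus contains neither \<open>0\<close> nor a puncture other than \<open>i\<close> and \<open>i + 1\<close>.\<close>

definition half_twist :: "nat \<Rightarrow> real \<Rightarrow> complex \<Rightarrow> complex" where
  "half_twist i \<epsilon> z =
    (let c = of_nat i + 1/2
     in c + (z - c) * cis (- pi * max 0 (min 1 ((1/2 + \<epsilon> - cmod (z - c)) / \<epsilon>))))"

text \<open>The representatives of the braid twist, which is a homeomorphism up to isotopy. Isotopies
  fix the basepoint \<open>0\<close>, as is needed for an induced map on the fundamental group.\<close>

definition braid_twist :: "nat \<Rightarrow> nat \<Rightarrow> (complex \<Rightarrow> complex) set" where
  "braid_twist n i =
    {\<sigma>. \<exists>\<epsilon>. 0 < \<epsilon> \<and> \<epsilon> < 1 \<and>
      homotopic_with_canon
        (\<lambda>h. h 0 = 0 \<and> (\<exists>k. homeomorphism (Sigma_B n) (Sigma_B n) h k))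
        (Sigma_B n) (Sigma_B n) (half_twist i \<epsilon>) \<sigma>}"

text \<open>The identification of the free group with the fundamental group, \<open>u\<^sub>i\<close> being sent to the
  class of \<open>gamma i\<close>.\<close>

definition free_to_pi1 :: "nat \<Rightarrow> nat word set \<Rightarrow> (real \<Rightarrow> complex) set" where
  "free_to_pi1 n = pres_lift (pi1 (Sigma_B n) 0) (\<lambda>i. loop_class (Sigma_B n) (gamma i))"

text \<open>The map induced on the fundamental group by a self-map of the punctured plane, read on the
  free group. The restriction makes it an element of \<open>AutoGroup\<close> when it is an automorphism.\<close>

definition induced_on_free ::
    "nat \<Rightarrow> (complex \<Rightarrow> complex) \<Rightarrow> nat word set \<Rightarrow> nat word set" where
  "induced_on_free n \<sigma> =
    (\<lambda>f\<in>carrier (free_group n).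
       inv_into (carrier (free_group n)) (free_to_pi1 n)
         (pi1_map (Sigma_B n) \<sigma> (free_to_pi1 n f)))"

text \<open>The generator \<open>i\<close> is sent to the common value of \<open>induced_on_free n\<close> on the
  representatives of the braid twist. The product in \<open>AutoGroup\<close> is composition of maps, the
  right factor being applied first.\<close>

definition artin_rep :: "nat \<Rightarrow> nat word set \<Rightarrow> nat word set \<Rightarrow> nat word set" where
  "artin_rep n = pres_lift (AutoGroup (free_group n))
     (\<lambda>i. the_elem (induced_on_free n ` braid_twist n i))"

end

theory Submission
  imports Defs
begin

text \<open>For the first part, cut the punctured plane along the vertical rays below the punctures.
  Together with slit strips around the rays this is a cover by simply connected charts, and the
  only nontrivial transitions are the crossings of the rays. Sending a path to the product of the
  generators of the rays that it crosses is parallel transport in a covering with fibre \<open>F\<^sub>n\<close>,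
  hence invariant under homotopy. This shows that the loops \<open>gamma i\<close> are independent, and
  comparing a loop with base paths in the charts, one small piece at a time, shows that they
  generate. The action of a half twist is then read off from the rays crossed by the images of
  box-shaped loops, on which the twist moves a single vertical segment.

  For the second part, put \<open>t\<^sub>1 = \<beta>\<^sub>1\<close> and let \<open>t\<^sub>i\<^sub>+\<^sub>1\<close> be the conjugate of \<open>t\<^sub>i\<close> by
  \<open>\<beta>\<^sub>i\<^sub>+\<^sub>1\<close>. The relations of type \<open>B\<close> imply that \<open>s_B\<close> acts on the \<open>t\<^sub>i\<close> by Artin's formulas, so
  that \<open>u\<^sub>i \<mapsto> t\<^sub>i\<close> and \<open>s_B\<close> combine to a homomorphism from the semidirect product; its inverse
  sends \<open>\<beta>\<^sub>1\<close> to \<open>u\<^sub>1\<close> and \<open>\<beta>\<^sub>i\<close> to \<open>\<alpha>\<^sub>i\<^sub>-\<^sub>1\<close>.\<close>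

section \<open>Presented groups\<close>

text \<open>Loops compose from left to right, so the first path of a join is transported first and
  the fibre must be acted on by right multiplication. Transport of the unit around a loop is then
  inverse to the identification of u_i with the class of \<open>gamma i\<close>. So two loops can be
  compared by the rays that they cross, and box loops take the place of \<open>gamma i\<close>
  without an explicit homotopy. The obstacle is the image of a loop under a half twist, a curve
  whose crossings with the rays are awkward to count directly. With support of radius 1 the twist
  moves only one vertical segment of the boxes, the one through its centre. The image of each half
  of that segment lies in a strip cut along a slanted ray; the strip is simply connected, so box
  edges can replace the image. Well-definedness has two sides: isotopies that fix the basepoint make
  the automorphism independent of the representative, and the braid relations are checked on the
  free generators from the computed formulas. On the Artin side, the relation of length four between
  t_i and \<beta>_(i+1) is Artin's second formula in another form.\<close>

declare in_lists_conv_set [simp del] in_listsD [rule del] in_listsI [rule del]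

definition pres_class :: "'a set \<Rightarrow> ('a word \<times> 'a word) set \<Rightarrow> 'a word \<Rightarrow> 'a word set" where
  "pres_class X R w = {u. pres_eq X R w u}"

definition word_inv :: "'a word \<Rightarrow> 'a word" where
  "word_inv w = rev (map (\<lambda>(x, b). (x, \<not> b)) w)"

lemma pres_eq_words:
  "pres_eq X R v w \<Longrightarrow> v \<in> lists (X \<times> UNIV) \<and> w \<in> lists (X \<times> UNIV)"
  by (induction rule: pres_eq.induct) auto

text \<open>The hypothesis puts \<open>v\<close> into its own class. Words with letters outside
  \<open>X\<close> are related to nothing, so all of them have the empty class.\<close>

lemma pres_class_eq_iff:
  assumes "v \<in> lists (X \<times> UNIV)"
  shows "pres_class X R v = pres_class X R w \<longleftrightarrow> pres_eq X R v w"
proof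
  assume "pres_class X R v = pres_class X R w"
  then have "v \<in> pres_class X R w"
    using assms by (auto simp: pres_class_def intro: pres_eq.refl)
  then show "pres_eq X R v w"
    by (auto simp: pres_class_def intro: pres_eq.sym)
next
  assume "pres_eq X R v w"
  then show "pres_class X R v = pres_class X R w"
    by (auto simp: pres_class_def intro: pres_eq.sym pres_eq.trans)
qed

lemma carrier_presented_group:
  "carrier (presented_group X R) = pres_class X R ` lists (X \<times> UNIV)"
  by (auto simp: presented_group_def quotient_def pres_class_def)

lemma one_presented_group: "\<one>\<^bsub>presented_group X R\<^esub> = pres_class X R []"
  by (simp add: presented_group_def pres_class_def)

lemma mult_presented_group:
  assumes "v \<in> lists (X \<times> UNIV)" "w \<in> lists (X \<times> UNIV)"
  shows "pres_class X R v \<otimes>\<^bsub>presented_group X R\<^esub> pres_class X R w = pres_class X R (v @ w)"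
proof -
  have "pres_eq X R (v @ w) u \<longleftrightarrow>
      (\<exists>v' w'. pres_eq X R v v' \<and> pres_eq X R w w' \<and> pres_eq X R (v' @ w') u)" for u
  proof
    show "\<exists>v' w'. pres_eq X R v v' \<and> pres_eq X R w w' \<and> pres_eq X R (v' @ w') u"
      if "pres_eq X R (v @ w) u"
      using that assms by (blast intro: pres_eq.refl)
  next
    assume "\<exists>v' w'. pres_eq X R v v' \<and> pres_eq X R w w' \<and> pres_eq X R (v' @ w') u"
    then show "pres_eq X R (v @ w) u"
      by (meson pres_eq.cong pres_eq.trans)
  qed
  then show ?thesis
    unfolding presented_group_def pres_class_def by auto
qed

lemma word_inv_lists: "w \<in> lists (X \<times> UNIV) \<Longrightarrow> word_inv w \<in> lists (X \<times> UNIV)"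
  unfolding word_inv_def by (induction w) auto

lemma pres_eq_word_inv:
  assumes "w \<in> lists (X \<times> UNIV)"
  shows "pres_eq X R (word_inv w @ w) []"
  using assms
proof (induction w)
  case Nil
  then show ?case by (simp add: word_inv_def pres_eq.refl)
next
  case (Cons a w)
  obtain x b where a: "a = (x, b)" by (cases a)
  then have x: "x \<in> X" using Cons by auto
  have l: "word_inv (a # w) @ (a # w) = word_inv w @ [(x, \<not> b), (x, \<not> \<not> b)] @ w"
    by (simp add: word_inv_def a)
  have wl: "w \<in> lists (X \<times> UNIV)"
    using Cons by auto
  then have "pres_eq X R w w" "pres_eq X R (word_inv w) (word_inv w)"
    by (auto intro!: pres_eq.refl word_inv_lists)
  then have "pres_eq X R (word_inv w @ [(x, \<not> b), (x, \<not> \<not> b)] @ w) (word_inv w @ [] @ w)"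
    by (intro pres_eq.cong pres_eq.cancel x)
  then have "pres_eq X R (word_inv (a # w) @ (a # w)) (word_inv w @ w)"
    unfolding l by simp
  then show ?case using Cons.IH by (rule pres_eq.trans)
qed

lemma group_presented_group: "group (presented_group X R)"
proof (rule groupI)
  fix x y assume "x \<in> carrier (presented_group X R)" "y \<in> carrier (presented_group X R)"
  then show "x \<otimes>\<^bsub>presented_group X R\<^esub> y \<in> carrier (presented_group X R)"
    by (auto simp: carrier_presented_group mult_presented_group)
next
  show "\<one>\<^bsub>presented_group X R\<^esub> \<in> carrier (presented_group X R)"
    by (auto simp: carrier_presented_group one_presented_group)
next
  fix x y z
  assume "x \<in> carrier (presented_group X R)" "y \<in> carrier (presented_group X R)"
    "z \<in> carrier (presented_group X R)"
  then show "x \<otimes>\<^bsub>presented_group X R\<^esub> y \<otimes>\<^bsub>presented_group X R\<^esub> z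
      = x \<otimes>\<^bsub>presented_group X R\<^esub> (y \<otimes>\<^bsub>presented_group X R\<^esub> z)"
    by (auto simp: carrier_presented_group mult_presented_group)
next
  fix x assume "x \<in> carrier (presented_group X R)"
  then obtain w where w: "w \<in> lists (X \<times> UNIV)" "x = pres_class X R w"
    by (auto simp: carrier_presented_group)
  then show "\<one>\<^bsub>presented_group X R\<^esub> \<otimes>\<^bsub>presented_group X R\<^esub> x = x"
    by (simp add: one_presented_group mult_presented_group)
  have "pres_class X R (word_inv w) \<otimes>\<^bsub>presented_group X R\<^esub> x = \<one>\<^bsub>presented_group X R\<^esub>"
    using w word_inv_lists[OF w(1)] pres_eq_word_inv[OF w(1)]
    by (simp add: one_presented_group mult_presented_group pres_class_eq_iff)
  then show "\<exists>y\<in>carrier (presented_group X R).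
      y \<otimes>\<^bsub>presented_group X R\<^esub> x = \<one>\<^bsub>presented_group X R\<^esub>"
    using word_inv_lists[OF w(1)] by (auto simp: carrier_presented_group)
qed

lemma pres_gen_eq: "pres_gen X R x = pres_class X R [(x, True)]"
  by (simp add: pres_gen_def pres_class_def)

lemma pres_gen_closed: "x \<in> X \<Longrightarrow> pres_gen X R x \<in> carrier (presented_group X R)"
  by (auto simp: pres_gen_eq carrier_presented_group)

lemma inv_pres_gen:
  assumes "x \<in> X"
  shows "inv\<^bsub>presented_group X R\<^esub> (pres_gen X R x) = pres_class X R [(x, False)]"
proof (rule group.inv_equality[OF group_presented_group])
  show "pres_class X R [(x, False)] \<otimes>\<^bsub>presented_group X R\<^esub> pres_gen X R x
      = \<one>\<^bsub>presented_group X R\<^esub>"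
    using assms pres_eq.cancel[OF assms, of R False]
    by (auto simp: pres_gen_eq mult_presented_group one_presented_group pres_class_eq_iff)
qed (use assms in \<open>auto simp: pres_gen_eq carrier_presented_group\<close>)

text \<open>Induction along a word for the element, with letters taken off the front; hence the
  multiplications from the left.\<close>

lemma presented_group_induct [consumes 1, case_names one gen inv_gen]:
  assumes "g \<in> carrier (presented_group X R)"
    and "P \<one>\<^bsub>presented_group X R\<^esub>"
    and gen: "\<And>x g. x \<in> X \<Longrightarrow> g \<in> carrier (presented_group X R) \<Longrightarrow> P g \<Longrightarrow>
      P (pres_gen X R x \<otimes>\<^bsub>presented_group X R\<^esub> g)"
    and inv_gen: "\<And>x g. x \<in> X \<Longrightarrow> g \<in> carrier (presented_group X R) \<Longrightarrow> P g \<Longrightarrow>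
      P (inv\<^bsub>presented_group X R\<^esub> (pres_gen X R x) \<otimes>\<^bsub>presented_group X R\<^esub> g)"
  shows "P g"
proof -
  have "P (pres_class X R w)" if "w \<in> lists (X \<times> UNIV)" for w
    using that
  proof (induction w)
    case Nil
    then show ?case using assms(2) by (simp add: one_presented_group)
  next
    case (Cons a w)
    obtain x b where a: "a = (x, b)" by (cases a)
    then have x: "x \<in> X" and w: "w \<in> lists (X \<times> UNIV)" using Cons by auto
    have c: "pres_class X R w \<in> carrier (presented_group X R)"
      using w by (auto simp: carrier_presented_group)
    have "pres_class X R (a # w) = pres_class X R [a] \<otimes>\<^bsub>presented_group X R\<^esub> pres_class X R w"
      using Cons by (subst mult_presented_group) auto
    then show ?case
      using gen[OF x c] inv_gen[OF x c] Cons.IH inv_pres_gen[OF x, of R]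
      by (cases b) (simp_all add: a pres_gen_eq)
  qed
  then show ?thesis using assms(1) by (auto simp: carrier_presented_group)
qed

lemma word_eval_simps [simp]:
  "word_eval G \<phi> [] = \<one>\<^bsub>G\<^esub>"
  "word_eval G \<phi> ((x, b) # w) = (if b then \<phi> x else inv\<^bsub>G\<^esub> (\<phi> x)) \<otimes>\<^bsub>G\<^esub> word_eval G \<phi> w"
  by (simp_all add: word_eval_def)

text \<open>The data for the universal property of a presentation. Relations matter only between
  words over \<open>X\<close>, because \<open>pres_eq\<close> uses no others.\<close>

locale pres_hom = group G for G (structure) +
  fixes X :: "'x set" and R and \<phi>
  assumes gen_closed: "\<And>x. x \<in> X \<Longrightarrow> \<phi> x \<in> carrier G"
    and relations: "\<And>l r. (l, r) \<in> R \<Longrightarrow> l \<in> lists (X \<times> UNIV) \<Longrightarrow> r \<in> lists (X \<times> UNIV) \<Longrightarrow>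
      word_eval G \<phi> l = word_eval G \<phi> r"
begin

lemma word_eval_closed: "w \<in> lists (X \<times> UNIV) \<Longrightarrow> word_eval G \<phi> w \<in> carrier G"
  by (induction w) (auto simp: gen_closed)

lemma word_eval_append:
  "v \<in> lists (X \<times> UNIV) \<Longrightarrow> w \<in> lists (X \<times> UNIV) \<Longrightarrow>
    word_eval G \<phi> (v @ w) = word_eval G \<phi> v \<otimes> word_eval G \<phi> w"
proof (induction v)
  case Nil
  then show ?case by (simp add: word_eval_closed)
next
  case (Cons a v)
  then show ?case
    by (cases a) (auto simp: m_assoc word_eval_closed gen_closed)
qed

lemma word_eval_cong: "pres_eq X R v w \<Longrightarrow> word_eval G \<phi> v = word_eval G \<phi> w"
proof (induction rule: pres_eq.induct)
  case (cong u u' v v')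
  then show ?case using word_eval_append pres_eq_words by metis
next
  case (cancel x b)
  then show ?case by (auto simp: gen_closed)
qed (simp_all add: relations)

lemma pres_lift_class:
  assumes "w \<in> lists (X \<times> UNIV)"
  shows "pres_lift G \<phi> (pres_class X R w) = word_eval G \<phi> w"
proof -
  have "word_eval G \<phi> ` pres_class X R w = {word_eval G \<phi> w}"
  proof
    show "word_eval G \<phi> ` pres_class X R w \<subseteq> {word_eval G \<phi> w}"
      using word_eval_cong by (fastforce simp: pres_class_def)
    show "{word_eval G \<phi> w} \<subseteq> word_eval G \<phi> ` pres_class X R w"
      using pres_eq.refl[OF assms, of R] by (simp add: pres_class_def)
  qed
  then show ?thesis by (simp add: pres_lift_def)
qed

lemma pres_lift_hom: "pres_lift G \<phi> \<in> hom (presented_group X R) G"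
  by (rule homI)
    (auto simp: carrier_presented_group mult_presented_group pres_lift_class word_eval_closed
      word_eval_append)

lemma pres_lift_gen: "x \<in> X \<Longrightarrow> pres_lift G \<phi> (pres_gen X R x) = \<phi> x"
  by (simp add: pres_gen_eq pres_lift_class gen_closed)

end

text \<open>The uniqueness half of the universal property: identities between homomorphisms on the
  free, braid and Artin groups are reduced to generators by it.\<close>

lemma hom_presented_group_eqI:
  assumes "group H" "h \<in> hom (presented_group X R) H" "k \<in> hom (presented_group X R) H"
    and gen: "\<And>x. x \<in> X \<Longrightarrow> h (pres_gen X R x) = k (pres_gen X R x)"
    and "g \<in> carrier (presented_group X R)"
  shows "h g = k g"
proof -
  interpret h: group_hom "presented_group X R" H h
    using assms group_presented_group by (simp add: group_hom_def group_hom_axioms_def)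
  interpret k: group_hom "presented_group X R" H k
    using assms group_presented_group by (simp add: group_hom_def group_hom_axioms_def)
  show ?thesis
    using assms(5)
  proof (induction rule: presented_group_induct)
    case one
    then show ?case by simp
  next
    case (gen x g)
    then show ?case using assms(4) by (simp add: pres_gen_closed)
  next
    case (inv_gen x g)
    then show ?case using assms(4) by (simp add: pres_gen_closed)
  qed
qed

section \<open>Semidirect products\<close>

lemma hom_AutoGroupD:
  assumes "\<rho> \<in> hom H (AutoGroup N)" "h \<in> carrier H"
  shows "\<rho> h \<in> auto N" "\<rho> h \<in> hom N N" "bij_betw (\<rho> h) (carrier N) (carrier N)"
    "\<rho> h \<in> extensional (carrier N)"
  using assms by (auto simp: AutoGroup_def hom_def auto_def Bij_def)

lemma mult_AutoGroup:
  assumes "a \<in> auto N" "b \<in> auto N"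
  shows "a \<otimes>\<^bsub>AutoGroup N\<^esub> b = compose (carrier N) a b"
  using assms by (auto simp: AutoGroup_def BijGroup_def auto_def)

lemma one_AutoGroup: "\<one>\<^bsub>AutoGroup N\<^esub> = (\<lambda>x\<in>carrier N. x)"
  by (simp add: AutoGroup_def BijGroup_def)

lemma carrier_AutoGroup: "carrier (AutoGroup N) = auto N"
  by (simp add: AutoGroup_def)

locale aut_action = N: group N + H: group H for N :: "('a, 'c) monoid_scheme" and H :: "('b, 'd) monoid_scheme" +
  fixes \<rho>
  assumes action_hom: "\<rho> \<in> hom H (AutoGroup N)"
begin

abbreviation SD where "SD \<equiv> semidirect_product N H \<rho>"

lemma act_closed [simp]: "h \<in> carrier H \<Longrightarrow> f \<in> carrier N \<Longrightarrow> \<rho> h f \<in> carrier N"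
  using hom_AutoGroupD(2)[OF action_hom] by (auto simp: hom_def)

lemma act_mult:
  "h \<in> carrier H \<Longrightarrow> f \<in> carrier N \<Longrightarrow> f' \<in> carrier N \<Longrightarrow>
    \<rho> h (f \<otimes>\<^bsub>N\<^esub> f') = \<rho> h f \<otimes>\<^bsub>N\<^esub> \<rho> h f'"
  using hom_AutoGroupD(2)[OF action_hom] by (auto simp: hom_def)

lemma act_one_right [simp]: "h \<in> carrier H \<Longrightarrow> \<rho> h \<one>\<^bsub>N\<^esub> = \<one>\<^bsub>N\<^esub>"
  using hom_AutoGroupD(2)[OF action_hom] N.is_group by (blast intro: hom_one)

lemma act_comp:
  "h \<in> carrier H \<Longrightarrow> h' \<in> carrier H \<Longrightarrow> f \<in> carrier N \<Longrightarrow>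
    \<rho> (h \<otimes>\<^bsub>H\<^esub> h') f = \<rho> h (\<rho> h' f)"
  using hom_mult[OF action_hom, of h h'] hom_AutoGroupD(1)[OF action_hom, of h]
    hom_AutoGroupD(1)[OF action_hom, of h']
  by (simp add: mult_AutoGroup compose_def)

lemma act_one [simp]: "f \<in> carrier N \<Longrightarrow> \<rho> \<one>\<^bsub>H\<^esub> f = f"
  using hom_one[OF action_hom H.is_group N.AutoGroup] by (simp add: one_AutoGroup)

lemma act_inv [simp]:
  "h \<in> carrier H \<Longrightarrow> f \<in> carrier N \<Longrightarrow> \<rho> h (\<rho> (inv\<^bsub>H\<^esub> h) f) = f"
  "h \<in> carrier H \<Longrightarrow> f \<in> carrier N \<Longrightarrow> \<rho> (inv\<^bsub>H\<^esub> h) (\<rho> h f) = f"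
  by (simp_all flip: act_comp)

lemma SD_simps:
  "carrier SD = carrier N \<times> carrier H"
  "(f, g) \<otimes>\<^bsub>SD\<^esub> (f', g') = (f \<otimes>\<^bsub>N\<^esub> \<rho> g f', g \<otimes>\<^bsub>H\<^esub> g')"
  "\<one>\<^bsub>SD\<^esub> = (\<one>\<^bsub>N\<^esub>, \<one>\<^bsub>H\<^esub>)"
  by (simp_all add: semidirect_product_def)

lemma group_SD: "group SD"
proof (rule groupI)
  fix x assume "x \<in> carrier SD"
  then obtain f g where x: "x = (f, g)" "f \<in> carrier N" "g \<in> carrier H"
    by (auto simp: SD_simps)
  then have "(\<rho> (inv\<^bsub>H\<^esub> g) (inv\<^bsub>N\<^esub> f), inv\<^bsub>H\<^esub> g) \<otimes>\<^bsub>SD\<^esub> x = \<one>\<^bsub>SD\<^esub>"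
    by (simp add: SD_simps flip: act_mult)
  then show "\<exists>y\<in>carrier SD. y \<otimes>\<^bsub>SD\<^esub> x = \<one>\<^bsub>SD\<^esub>"
    using x by (intro bexI[of _ "(\<rho> (inv\<^bsub>H\<^esub> g) (inv\<^bsub>N\<^esub> f), inv\<^bsub>H\<^esub> g)"]) (auto simp: SD_simps)
qed (auto simp: SD_simps act_mult act_comp N.m_assoc H.m_assoc)

lemma incl_N_hom: "(\<lambda>f. (f, \<one>\<^bsub>H\<^esub>)) \<in> hom N SD"
  by (rule homI) (auto simp: SD_simps)

lemma incl_H_hom: "(\<lambda>g. (\<one>\<^bsub>N\<^esub>, g)) \<in> hom H SD"
  by (rule homI) (auto simp: SD_simps)

end


section \<open>The free factor of the Artin group of type B\<close>

definition (in group) cj where "cj g x = g \<otimes> x \<otimes> inv g"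

context group
begin

lemma cj_closed [simp]: "g \<in> carrier G \<Longrightarrow> x \<in> carrier G \<Longrightarrow> cj g x \<in> carrier G"
  by (simp add: cj_def)

lemma inv_mult_cancel [simp]:
  "g \<in> carrier G \<Longrightarrow> y \<in> carrier G \<Longrightarrow> inv g \<otimes> (g \<otimes> y) = y"
  "g \<in> carrier G \<Longrightarrow> y \<in> carrier G \<Longrightarrow> g \<otimes> (inv g \<otimes> y) = y"
  by (simp_all flip: m_assoc)

lemma cj_mult:
  "g \<in> carrier G \<Longrightarrow> x \<in> carrier G \<Longrightarrow> y \<in> carrier G \<Longrightarrow> cj g (x \<otimes> y) = cj g x \<otimes> cj g y"
  by (simp add: cj_def m_assoc)

lemma cj_cj:
  "g \<in> carrier G \<Longrightarrow> h \<in> carrier G \<Longrightarrow> x \<in> carrier G \<Longrightarrow> cj g (cj h x) = cj (g \<otimes> h) x"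
  by (simp add: cj_def m_assoc inv_mult_group)

lemma cj_eq_iff:
  assumes "g \<in> carrier G" "x \<in> carrier G" "y \<in> carrier G"
  shows "cj g x = y \<longleftrightarrow> g \<otimes> x = y \<otimes> g"
proof
  assume "cj g x = y"
  then have "y \<otimes> g = g \<otimes> x \<otimes> inv g \<otimes> g" by (simp add: cj_def)
  then show "g \<otimes> x = y \<otimes> g" using assms by (simp add: m_assoc)
next
  assume "g \<otimes> x = y \<otimes> g"
  then show "cj g x = y" using assms by (simp add: cj_def m_assoc)
qed

lemma cj_one [simp]: "g \<in> carrier G \<Longrightarrow> cj g \<one> = \<one>" "x \<in> carrier G \<Longrightarrow> cj \<one> x = x"
  by (simp_all add: cj_def)

lemma cj_hom: "g \<in> carrier G \<Longrightarrow> cj g \<in> hom G G"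
  by (rule homI) (simp_all add: cj_mult)

end

text \<open>This is b_i ... b_2 b_1 b_2^-1 ... b_i^-1, the element t_i of the overview. The value at
  0 is a dummy, since indices begin at 1.\<close>

primrec (in group) conj_chain :: "(nat \<Rightarrow> 'a) \<Rightarrow> nat \<Rightarrow> 'a" where
  "conj_chain b 0 = \<one>"
| "conj_chain b (Suc i) = (if i = 0 then b 1 else cj (b (Suc i)) (conj_chain b i))"

text \<open>The relations of type B as a property of a family in any group. It is instantiated by
  the generators of \<open>artin_B n\<close>, by their intended images in the braid group, and by
  their intended images in the semidirect product.\<close>

locale artin_B_family = group G for G (structure) +
  fixes n :: nat and b :: "nat \<Rightarrow> 'a"
  assumes b_closed: "i \<in> {1..n} \<Longrightarrow> b i \<in> carrier G"
    and b_four: "n \<ge> 2 \<Longrightarrow> b 1 \<otimes> (b 2 \<otimes> (b 1 \<otimes> b 2)) = b 2 \<otimes> (b 1 \<otimes> (b 2 \<otimes> b 1))"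
    and b_braid: "2 \<le> i \<Longrightarrow> Suc i \<le> n \<Longrightarrow>
      b i \<otimes> (b (Suc i) \<otimes> b i) = b (Suc i) \<otimes> (b i \<otimes> b (Suc i))"
    and b_comm: "i \<in> {1..n} \<Longrightarrow> j \<in> {1..n} \<Longrightarrow> Suc i < j \<Longrightarrow> b i \<otimes> b j = b j \<otimes> b i"
begin

abbreviation t where "t \<equiv> conj_chain b"

lemma t_closed: "i \<in> {1..n} \<Longrightarrow> t i \<in> carrier G"
proof (induction i)
  case (Suc i)
  then show ?case by (cases "i = 0") (auto simp: b_closed)
qed auto

text \<open>\<open>t i\<close> is a product of b_1, ..., b_i and their inverses, all of which
  commute with \<open>b j\<close>.\<close>

lemma cj_t_above:
  assumes "i \<in> {1..n}" "Suc i < j" "j \<le> n"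
  shows "cj (b j) (t i) = t i"
  using assms
proof (induction i)
  case (Suc i)
  have b: "b j \<in> carrier G" "b (Suc i) \<in> carrier G" and c: "b j \<otimes> b (Suc i) = b (Suc i) \<otimes> b j"
    using Suc.prems b_comm[of "Suc i" j] by (auto simp: b_closed)
  show ?case
  proof (cases "i = 0")
    case True
    then show ?thesis using b c by (simp add: cj_eq_iff)
  next
    case False
    then have ti: "t i \<in> carrier G" "cj (b j) (t i) = t i"
      using Suc by (auto simp: t_closed)
    have "cj (b j) (t (Suc i)) = cj (b (Suc i)) (cj (b j) (t i))"
      using False b c ti(1) by (simp add: cj_cj)
    then show ?thesis using False ti(2) by simp
  qed
qed auto

text \<open>Write b and c for the elements with indices i+1 and i+2. Conjugation by bcb = cbc takes
  t_i to b t_{i+2} b^-1 and also, as c fixes t_i, to t_{i+2}. Each further step of the chain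
  conjugates by an element that commutes with b.\<close>

lemma cj_t_below:
  assumes "i \<ge> 1" "Suc i < j" "j \<le> n"
  shows "cj (b (Suc i)) (t j) = t j"
proof -
  have "Suc (Suc i) \<le> j" using assms by simp
  then show ?thesis using \<open>j \<le> n\<close>
  proof (induction j rule: dec_induct)
    case base
    let ?b = "b (Suc i)" and ?c = "b (Suc (Suc i))"
    have bc: "?b \<in> carrier G" "?c \<in> carrier G" "t i \<in> carrier G"
      and braid: "?b \<otimes> (?c \<otimes> ?b) = ?c \<otimes> (?b \<otimes> ?c)"
      using assms base by (auto intro: b_closed t_closed b_braid)
    have comm: "cj ?c (t i) = t i"
      using assms base by (intro cj_t_above) auto
    have "cj ?b (t (Suc (Suc i))) = cj (?b \<otimes> (?c \<otimes> ?b)) (t i)"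
      using assms(1) bc by (simp add: cj_cj)
    also have "\<dots> = cj ?c (cj ?b (cj ?c (t i)))"
      using bc by (simp add: cj_cj braid)
    also have "\<dots> = t (Suc (Suc i))"
      unfolding comm using assms(1) by simp
    finally show ?case .
  next
    case (step j)
    have c: "b (Suc i) \<in> carrier G" "b (Suc j) \<in> carrier G" "t j \<in> carrier G"
      using assms step by (auto intro: b_closed t_closed)
    have comm: "b (Suc i) \<otimes> b (Suc j) = b (Suc j) \<otimes> b (Suc i)"
      using assms step by (intro b_comm) auto
    have j: "j \<noteq> 0" using step by simp
    have "cj (b (Suc i)) (t (Suc j)) = cj (b (Suc j)) (cj (b (Suc i)) (t j))"
      using c comm j by (simp add: cj_cj)
    also have "\<dots> = t (Suc j)"
      using step j by simp
    finally show ?case .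
  qed
qed

text \<open>The relation of length four travels along the chain: conjugation by b_{i+1} b_{i+2}
  takes b_{i+1} to b_{i+2} by the braid relation, and t_i to t_{i+1} because b_{i+2} fixes
  t_i.\<close>

lemma b_t_four:
  assumes "i \<ge> 1" "Suc i \<le> n"
  shows "b (Suc i) \<otimes> (t i \<otimes> (b (Suc i) \<otimes> t i)) = t i \<otimes> (b (Suc i) \<otimes> (t i \<otimes> b (Suc i)))"
  using assms
proof (induction i rule: nat_induct_at_least)
  case base
  then show ?case using b_four by (simp add: numeral_2_eq_2)
next
  case (Suc i)
  let ?b = "b (Suc i)" and ?c = "b (Suc (Suc i))"
  have bc: "?b \<in> carrier G" "?c \<in> carrier G" "t i \<in> carrier G"
    and braid: "?b \<otimes> (?c \<otimes> ?b) = ?c \<otimes> (?b \<otimes> ?c)"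
    using Suc by (auto intro: b_closed t_closed b_braid)
  have cb: "cj (?b \<otimes> ?c) ?b = ?c"
    using bc braid by (simp add: cj_eq_iff m_assoc)
  have "cj ?c (t i) = t i"
    using Suc by (intro cj_t_above) auto
  then have ct: "cj (?b \<otimes> ?c) (t i) = t (Suc i)"
    using bc Suc.hyps by (simp flip: cj_cj)
  have "cj (?b \<otimes> ?c) (?b \<otimes> (t i \<otimes> (?b \<otimes> t i))) = cj (?b \<otimes> ?c) (t i \<otimes> (?b \<otimes> (t i \<otimes> ?b)))"
    using Suc by simp
  then show ?case
    using bc by (simp only: cj_mult m_closed cb ct)
qed

text \<open>With b = b_{i+1}, \<open>b_t_four\<close> turns t_i t_{i+1} = (t_i b t_i b) b^-2 into (b
  t_i b t_i) b^-2, which is t_{i+1} times the conjugate of t_{i+1} by b.\<close>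

lemma cj_t_next:
  assumes "i \<ge> 1" "Suc i \<le> n"
  shows "cj (b (Suc i)) (t (Suc i)) = inv (t (Suc i)) \<otimes> t i \<otimes> t (Suc i)"
proof -
  let ?b = "b (Suc i)"
  have bc: "?b \<in> carrier G" "t i \<in> carrier G" "t (Suc i) \<in> carrier G"
    using assms by (auto intro: b_closed t_closed simp del: conj_chain.simps)
  have e: "t (Suc i) = ?b \<otimes> t i \<otimes> inv ?b"
    using assms by (simp add: cj_def)
  have "t i \<otimes> t (Suc i) = t i \<otimes> (?b \<otimes> (t i \<otimes> ?b)) \<otimes> inv ?b \<otimes> inv ?b"
    unfolding e using bc by (simp add: m_assoc)
  also have "\<dots> = ?b \<otimes> (t i \<otimes> (?b \<otimes> t i)) \<otimes> inv ?b \<otimes> inv ?b"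
    using assms by (simp only: b_t_four)
  also have "\<dots> = t (Suc i) \<otimes> cj ?b (t (Suc i))"
    unfolding e cj_def using bc by (simp add: m_assoc)
  finally show ?thesis
    using bc by (simp add: m_assoc del: conj_chain.simps)
qed

end

section \<open>Relations and universal properties of the free, braid and Artin groups\<close>

lemma pos_word_in_lists [simp]: "pos_word xs \<in> lists (X \<times> UNIV) \<longleftrightarrow> set xs \<subseteq> X"
  by (induction xs) (auto simp: pos_word_def)

lemma word_eval_pos_word: "word_eval G \<phi> (pos_word xs) = foldr (\<lambda>x g. \<phi> x \<otimes>\<^bsub>G\<^esub> g) xs \<one>\<^bsub>G\<^esub>"
  by (induction xs) (auto simp: pos_word_def)

lemma braid_relationsE:
  assumes "(l, r) \<in> braid_relations n"
  obtains (braid) i where "l = pos_word [i, i + 1, i]" "r = pos_word [i + 1, i, i + 1]"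
      "1 \<le> i" "i + 1 \<le> n - 1"
    | (comm) i j where "l = pos_word [i, j]" "r = pos_word [j, i]" "i \<in> {1..n - 1}" "j \<in> {1..n - 1}"
      "\<bar>int i - int j\<bar> \<ge> 2"
  using assms unfolding braid_relations_def by blast

lemma artin_B_relationsE:
  assumes "(l, r) \<in> artin_B_relations n"
  obtains (four) "l = pos_word [1, 2, 1, 2]" "r = pos_word [2, 1, 2, 1]"
    | (braid) i where "l = pos_word [i, i + 1, i]" "r = pos_word [i + 1, i, i + 1]"
      "2 \<le> i" "i \<le> n - 1"
    | (comm) i j where "l = pos_word [i, j]" "r = pos_word [j, i]" "i \<in> {1..n}" "j \<in> {1..n}"
      "\<bar>int i - int j\<bar> \<ge> 2"
  using assms unfolding artin_B_relations_def by blast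

text \<open>The iterated products are unfolded by simplification, for a concrete list, to the
  right-nested products that appear in \<open>artin_B_family\<close>.\<close>

lemma pres_gen_relation:
  assumes "(pos_word xs, pos_word ys) \<in> R" "set xs \<subseteq> X" "set ys \<subseteq> X"
  shows "foldr (\<lambda>x g. pres_gen X R x \<otimes>\<^bsub>presented_group X R\<^esub> g) xs \<one>\<^bsub>presented_group X R\<^esub>
    = foldr (\<lambda>x g. pres_gen X R x \<otimes>\<^bsub>presented_group X R\<^esub> g) ys \<one>\<^bsub>presented_group X R\<^esub>"
proof -
  have *: "foldr (\<lambda>x g. pres_gen X R x \<otimes>\<^bsub>presented_group X R\<^esub> g) xs \<one>\<^bsub>presented_group X R\<^esub>
      = pres_class X R (pos_word xs)" if "set xs \<subseteq> X" for xs
    using that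
  proof (induction xs)
    case Nil
    then show ?case by (simp add: one_presented_group pos_word_def)
  next
    case (Cons x xs)
    then show ?case
      by (simp add: pres_gen_eq mult_presented_group) (simp add: pos_word_def)
  qed
  show ?thesis
    using assms by (simp add: * pres_class_eq_iff pres_eq.relation)
qed

lemmas group_free = group_presented_group[of "{1..n}" "{}" for n :: nat, folded free_group_def]
lemmas group_braid = group_presented_group[of "{1..n - 1}" "braid_relations n" for n, folded braid_group_def]
lemmas group_artin_B = group_presented_group[of "{1..n}" "artin_B_relations n" for n, folded artin_B_def]

lemma free_gen_closed: "i \<in> {1..n} \<Longrightarrow> free_gen n i \<in> carrier (free_group n)"
  unfolding free_gen_def free_group_def by (rule pres_gen_closed)

lemma braid_gen_closed: "i \<in> {1..n - 1} \<Longrightarrow> braid_gen n i \<in> carrier (braid_group n)"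
  unfolding braid_gen_def braid_group_def by (rule pres_gen_closed)

lemma braid_gen_pred_closed: "2 \<le> i \<Longrightarrow> i \<le> n \<Longrightarrow> braid_gen n (i - 1) \<in> carrier (braid_group n)"
  by (rule braid_gen_closed) auto

lemmas braid_group_induct [consumes 1, case_names one gen inv_gen] =
  presented_group_induct[of _ "{1..n - 1}" "braid_relations n" for n, folded braid_group_def braid_gen_def]

lemma artin_B_gen_closed: "i \<in> {1..n} \<Longrightarrow> artin_B_gen n i \<in> carrier (artin_B n)"
  unfolding artin_B_gen_def artin_B_def by (rule pres_gen_closed)

lemmas hom_free_eqI =
  hom_presented_group_eqI[of _ _ "{1..n}" "{}" for n :: nat, folded free_group_def free_gen_def]
lemmas hom_braid_eqI =
  hom_presented_group_eqI[of _ _ "{1..n - 1}" "braid_relations n" for n, folded braid_group_def braid_gen_def]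
lemmas hom_artin_B_eqI =
  hom_presented_group_eqI[of _ _ "{1..n}" "artin_B_relations n" for n, folded artin_B_def artin_B_gen_def]

lemma pres_hom_free:
  "group G \<Longrightarrow> (\<And>i. i \<in> {1..n} \<Longrightarrow> \<phi> i \<in> carrier G) \<Longrightarrow> pres_hom G {1..n} {} \<phi>"
  by (simp add: pres_hom_def pres_hom_axioms_def)

lemma braid_family_relations:
  assumes "1 \<le> i" "j < n"
  shows "Suc i = j \<Longrightarrow> braid_gen n i \<otimes>\<^bsub>braid_group n\<^esub> (braid_gen n j \<otimes>\<^bsub>braid_group n\<^esub> braid_gen n i)
      = braid_gen n j \<otimes>\<^bsub>braid_group n\<^esub> (braid_gen n i \<otimes>\<^bsub>braid_group n\<^esub> braid_gen n j)"
    and "Suc i < j \<Longrightarrow> braid_gen n i \<otimes>\<^bsub>braid_group n\<^esub> braid_gen n j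
      = braid_gen n j \<otimes>\<^bsub>braid_group n\<^esub> braid_gen n i"
proof -
  interpret group "braid_group n" by (rule group_braid)
  note rel = pres_gen_relation[of _ _ "braid_relations n" "{1..n - 1}", folded braid_group_def braid_gen_def]
  have ij: "i \<in> {1..n - 1}" "j \<in> {1..n - 1}" if "i < j"
    using that assms by auto
  note cl = ij[THEN braid_gen_closed]
  show "braid_gen n i \<otimes>\<^bsub>braid_group n\<^esub> (braid_gen n j \<otimes>\<^bsub>braid_group n\<^esub> braid_gen n i)
      = braid_gen n j \<otimes>\<^bsub>braid_group n\<^esub> (braid_gen n i \<otimes>\<^bsub>braid_group n\<^esub> braid_gen n j)"
    if "Suc i = j"
  proof -
    have "(pos_word [i, j, i], pos_word [j, i, j]) \<in> braid_relations n"
      using that assms unfolding braid_relations_def by (intro UnI1) auto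
    from rel[OF this] show ?thesis using ij cl that by simp
  qed
  show "braid_gen n i \<otimes>\<^bsub>braid_group n\<^esub> braid_gen n j
      = braid_gen n j \<otimes>\<^bsub>braid_group n\<^esub> braid_gen n i"
    if "Suc i < j"
  proof -
    have "(pos_word [i, j], pos_word [j, i]) \<in> braid_relations n"
      using that assms unfolding braid_relations_def by (intro UnI2) force
    from rel[OF this] show ?thesis using ij cl that by simp
  qed
qed

lemma artin_B_family_gens: "artin_B_family (artin_B n) n (artin_B_gen n)"
proof -
  interpret group "artin_B n" by (rule group_artin_B)
  note rel = pres_gen_relation[of _ _ "artin_B_relations n" "{1..n}", folded artin_B_def artin_B_gen_def]
  note cl = artin_B_gen_closed[of _ n]
  show ?thesis
  proof
    show "artin_B_gen n i \<in> carrier (artin_B n)" if "i \<in> {1..n}" for i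
      using that by (rule cl)
  next
    assume "2 \<le> n"
    have "(pos_word [1, 2, 1, 2], pos_word [2, 1, 2, 1]) \<in> artin_B_relations n"
      unfolding artin_B_relations_def by blast
    from rel[OF this] \<open>2 \<le> n\<close> cl[of 1] cl[of 2]
    show "artin_B_gen n 1 \<otimes>\<^bsub>artin_B n\<^esub> (artin_B_gen n 2 \<otimes>\<^bsub>artin_B n\<^esub> (artin_B_gen n 1 \<otimes>\<^bsub>artin_B n\<^esub> artin_B_gen n 2))
      = artin_B_gen n 2 \<otimes>\<^bsub>artin_B n\<^esub> (artin_B_gen n 1 \<otimes>\<^bsub>artin_B n\<^esub> (artin_B_gen n 2 \<otimes>\<^bsub>artin_B n\<^esub> artin_B_gen n 1))"
      by simp
  next
    fix i assume "2 \<le> i" "Suc i \<le> n"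
    then have "(pos_word [i, Suc i, i], pos_word [Suc i, i, Suc i]) \<in> artin_B_relations n"
      unfolding artin_B_relations_def by (intro UnI1 UnI2) auto
    from rel[OF this] \<open>2 \<le> i\<close> \<open>Suc i \<le> n\<close> cl[of i] cl[of "Suc i"]
    show "artin_B_gen n i \<otimes>\<^bsub>artin_B n\<^esub> (artin_B_gen n (Suc i) \<otimes>\<^bsub>artin_B n\<^esub> artin_B_gen n i)
      = artin_B_gen n (Suc i) \<otimes>\<^bsub>artin_B n\<^esub> (artin_B_gen n i \<otimes>\<^bsub>artin_B n\<^esub> artin_B_gen n (Suc i))"
      by simp
  next
    fix i j assume ij: "i \<in> {1..n}" "j \<in> {1..n}" "Suc i < j"
    then have "(pos_word [i, j], pos_word [j, i]) \<in> artin_B_relations n"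
      unfolding artin_B_relations_def by (intro UnI2) force
    from rel[OF this] ij cl[of i] cl[of j]
    show "artin_B_gen n i \<otimes>\<^bsub>artin_B n\<^esub> artin_B_gen n j
      = artin_B_gen n j \<otimes>\<^bsub>artin_B n\<^esub> artin_B_gen n i"
      by simp
  qed
qed

lemma pres_hom_braidI:
  assumes "group G" and cl: "\<And>i. i \<in> {1..n - 1} \<Longrightarrow> a i \<in> carrier G"
    and braid: "\<And>i. 1 \<le> i \<Longrightarrow> Suc i < n \<Longrightarrow>
      a i \<otimes>\<^bsub>G\<^esub> (a (Suc i) \<otimes>\<^bsub>G\<^esub> a i) = a (Suc i) \<otimes>\<^bsub>G\<^esub> (a i \<otimes>\<^bsub>G\<^esub> a (Suc i))"
    and comm: "\<And>i j. 1 \<le> i \<Longrightarrow> Suc i < j \<Longrightarrow> j < n \<Longrightarrow> a i \<otimes>\<^bsub>G\<^esub> a j = a j \<otimes>\<^bsub>G\<^esub> a i"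
  shows "pres_hom G {1..n - 1} (braid_relations n) a"
proof -
  interpret group G by fact
  show ?thesis
  proof
    show "a i \<in> carrier G" if "i \<in> {1..n - 1}" for i
      using that by (rule cl)
  next
    fix l r assume "(l, r) \<in> braid_relations n"
    then show "word_eval G a l = word_eval G a r"
    proof (cases rule: braid_relationsE)
      case (braid i)
      then show ?thesis using assms(3)[of i] cl[of i] cl[of "Suc i"] by (simp add: word_eval_pos_word)
    next
      case (comm i j)
      then have "Suc i < j \<or> Suc j < i" by auto
      with comm show ?thesis
        using assms(4)[of i j] assms(4)[of j i] cl[of i] cl[of j] by (auto simp: word_eval_pos_word)
    qed
  qed
qed

lemma (in artin_B_family) pres_hom_artin_B: "pres_hom G {1..n} (artin_B_relations n) b"
  if "n \<ge> 2"
proof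
  show "b i \<in> carrier G" if "i \<in> {1..n}" for i
    using that by (rule b_closed)
next
  fix l r assume "(l, r) \<in> artin_B_relations n"
  then show "word_eval G b l = word_eval G b r"
  proof (cases rule: artin_B_relationsE)
    case four
    then show ?thesis using b_four b_closed[of 1] b_closed[of 2] that by (simp add: word_eval_pos_word)
  next
    case (braid i)
    then show ?thesis using b_braid[of i] b_closed[of i] b_closed[of "Suc i"] that
      by (simp add: word_eval_pos_word)
  next
    case (comm i j)
    then have "Suc i < j \<or> Suc j < i" by auto
    with comm show ?thesis
      using b_comm[of i j] b_comm[of j i] b_closed[of i] b_closed[of j]
      by (auto simp: word_eval_pos_word)
  qed
qed

section \<open>The Artin group of type B as a semidirect product, for any action with Artin's
  formulas\<close>

locale artin_action = aut_action "free_group n" "braid_group n" \<rho> for n \<rho> +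
  assumes n2: "n \<ge> 2"
    and act_next: "i \<in> {1..n - 1} \<Longrightarrow> \<rho> (braid_gen n i) (free_gen n i) = free_gen n (Suc i)"
    and act_conj: "i \<in> {1..n - 1} \<Longrightarrow> \<rho> (braid_gen n i) (free_gen n (Suc i))
      = inv\<^bsub>free_group n\<^esub> (free_gen n (Suc i)) \<otimes>\<^bsub>free_group n\<^esub> free_gen n i
          \<otimes>\<^bsub>free_group n\<^esub> free_gen n (Suc i)"
    and act_other: "i \<in> {1..n - 1} \<Longrightarrow> j \<in> {1..n} \<Longrightarrow> j \<noteq> i \<Longrightarrow> j \<noteq> Suc i \<Longrightarrow>
      \<rho> (braid_gen n i) (free_gen n j) = free_gen n j"
begin

sublocale A: artin_B_family "artin_B n" n "artin_B_gen n"
  by (rule artin_B_family_gens)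

abbreviation \<theta> where "\<theta> \<equiv> pres_lift (artin_B n) A.t"

lemma pres_hom_theta: "pres_hom (artin_B n) {1..n} {} A.t"
  by (intro pres_hom_free group_artin_B A.t_closed)

lemmas theta_hom = pres_hom.pres_lift_hom[OF pres_hom_theta, folded free_group_def]
lemmas theta_gen = pres_hom.pres_lift_gen[OF pres_hom_theta, folded free_gen_def]

lemma pres_hom_s_B: "pres_hom (artin_B n) {1..n - 1} (braid_relations n) (\<lambda>i. artin_B_gen n (i + 1))"
proof (rule pres_hom_braidI[OF group_artin_B])
  show "artin_B_gen n (i + 1) \<in> carrier (artin_B n)" if "i \<in> {1..n - 1}" for i
    using that by (intro artin_B_gen_closed) auto
  show "artin_B_gen n (i + 1) \<otimes>\<^bsub>artin_B n\<^esub> artin_B_gen n (j + 1)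
      = artin_B_gen n (j + 1) \<otimes>\<^bsub>artin_B n\<^esub> artin_B_gen n (i + 1)"
    if "1 \<le> i" "Suc i < j" "j < n" for i j
    using that A.b_comm[of "i + 1" "j + 1"] by simp
qed (use A.b_braid in simp_all)

lemmas s_B_hom = pres_hom.pres_lift_hom[OF pres_hom_s_B, folded braid_group_def s_B_def]
lemmas s_B_gen = pres_hom.pres_lift_gen[OF pres_hom_s_B, folded braid_gen_def s_B_def]

lemma pres_hom_pi_B: "pres_hom (braid_group n) {1..n} (artin_B_relations n)
     (\<lambda>i. if i = 1 then \<one>\<^bsub>braid_group n\<^esub> else braid_gen n (i - 1))"
proof (rule artin_B_family.pres_hom_artin_B[OF _ n2], unfold_locales)
  let ?b = "\<lambda>i. if i = 1 then \<one>\<^bsub>braid_group n\<^esub> else braid_gen n (i - 1)"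
  show cl: "?b i \<in> carrier (braid_group n)" if "i \<in> {1..n}" for i
    using that braid_gen_pred_closed[of i n] by auto
  show "?b 1 \<otimes>\<^bsub>braid_group n\<^esub> (?b 2 \<otimes>\<^bsub>braid_group n\<^esub> (?b 1 \<otimes>\<^bsub>braid_group n\<^esub> ?b 2)) =
      ?b 2 \<otimes>\<^bsub>braid_group n\<^esub> (?b 1 \<otimes>\<^bsub>braid_group n\<^esub> (?b 2 \<otimes>\<^bsub>braid_group n\<^esub> ?b 1))" if "2 \<le> n"
    using that braid_gen_closed[of 1 n] by simp
  fix i j
  show "?b i \<otimes>\<^bsub>braid_group n\<^esub> (?b (Suc i) \<otimes>\<^bsub>braid_group n\<^esub> ?b i) =
      ?b (Suc i) \<otimes>\<^bsub>braid_group n\<^esub> (?b i \<otimes>\<^bsub>braid_group n\<^esub> ?b (Suc i))" if "2 \<le> i" "Suc i \<le> n"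
  proof -
    obtain k where "i = Suc k" "1 \<le> k" using \<open>2 \<le> i\<close> by (cases i) auto
    then show ?thesis
      using braid_family_relations(1)[of k "Suc k" n] that(2) by simp
  qed
  show "?b i \<otimes>\<^bsub>braid_group n\<^esub> ?b j = ?b j \<otimes>\<^bsub>braid_group n\<^esub> ?b i"
    if "i \<in> {1..n}" "j \<in> {1..n}" "Suc i < j"
  proof -
    obtain k l where "i = Suc k" "j = Suc l"
      using \<open>i \<in> {1..n}\<close> \<open>j \<in> {1..n}\<close> by (cases i; cases j) auto
    then show ?thesis
      using that braid_family_relations(2)[of k l n] braid_gen_closed[of l n] by auto
  qed
qed

lemmas pi_B_hom = pres_hom.pres_lift_hom[OF pres_hom_pi_B, folded artin_B_def pi_B_def]
lemmas pi_B_gen = pres_hom.pres_lift_gen[OF pres_hom_pi_B, folded artin_B_gen_def pi_B_def]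

lemma theta_closed [simp]: "f \<in> carrier (free_group n) \<Longrightarrow> \<theta> f \<in> carrier (artin_B n)"
  using theta_hom by (auto simp: hom_def)

lemma s_B_closed [simp]: "g \<in> carrier (braid_group n) \<Longrightarrow> s_B n g \<in> carrier (artin_B n)"
  using s_B_hom by (auto simp: hom_def)

text \<open>Both sides are homomorphisms in \<open>f\<close>, so generators suffice: index
  \<open>i\<close> is the recursion of \<open>conj_chain\<close>, index \<open>Suc i\<close> is
  \<open>cj_t_next\<close>, and the other generators are fixed by \<open>cj_t_above\<close> and
  \<open>cj_t_below\<close>.\<close>

lemma theta_act_gen:
  assumes i: "i \<in> {1..n - 1}" and f: "f \<in> carrier (free_group n)"
  shows "A.cj (s_B n (braid_gen n i)) (\<theta> f) = \<theta> (\<rho> (braid_gen n i) f)"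
proof (rule hom_free_eqI[OF group_artin_B _ _ _ f])
  have a: "braid_gen n i \<in> carrier (braid_group n)"
    using i by (rule braid_gen_closed)
  show "(\<lambda>f. A.cj (s_B n (braid_gen n i)) (\<theta> f)) \<in> hom (free_group n) (artin_B n)"
    using hom_compose[OF theta_hom A.cj_hom[OF s_B_closed[OF a]]] by (simp add: comp_def)
  show "(\<lambda>f. \<theta> (\<rho> (braid_gen n i) f)) \<in> hom (free_group n) (artin_B n)"
    using hom_compose[OF hom_AutoGroupD(2)[OF action_hom a] theta_hom] by (simp add: comp_def)
  interpret \<theta>: group_hom "free_group n" "artin_B n" \<theta>
    using theta_hom group_free group_artin_B by (simp add: group_hom_def group_hom_axioms_def)
  fix j assume j: "j \<in> {1..n}"
  consider "j = i" | "j = Suc i" | "j \<noteq> i" "j \<noteq> Suc i" by auto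
  then show "A.cj (s_B n (braid_gen n i)) (\<theta> (free_gen n j)) = \<theta> (\<rho> (braid_gen n i) (free_gen n j))"
  proof cases
    case 1
    then show ?thesis using i j by (auto simp: act_next theta_gen s_B_gen)
  next
    case 2
    have "free_gen n i \<in> carrier (free_group n)" "free_gen n (Suc i) \<in> carrier (free_group n)"
      using i by (auto intro: free_gen_closed)
    then show ?thesis
      using 2 i j A.cj_t_next[of i]
      by (simp add: act_conj theta_gen s_B_gen del: A.conj_chain.simps)
  next
    case 3
    have "A.cj (artin_B_gen n (Suc i)) (A.t j) = A.t j"
      using 3 i j A.cj_t_above[of j "Suc i"] A.cj_t_below[of i j]
      by (cases "j < i") auto
    then show ?thesis
      using 3 i j by (simp add: act_other theta_gen s_B_gen)
  qed
qed

lemma theta_act: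
  assumes "g \<in> carrier (braid_group n)" "f \<in> carrier (free_group n)"
  shows "A.cj (s_B n g) (\<theta> f) = \<theta> (\<rho> g f)"
proof -
  interpret s: group_hom "braid_group n" "artin_B n" "s_B n"
    using s_B_hom group_braid group_artin_B by (simp add: group_hom_def group_hom_axioms_def)
  show ?thesis
    using assms
  proof (induction arbitrary: f rule: braid_group_induct)
    case one
    then show ?case by simp
  next
    case (gen i g)
    note [simp] = gen.hyps gen.prems braid_gen_closed[OF gen.hyps(1)]
    show ?case
      by (simp add: A.cj_cj[symmetric] act_comp theta_act_gen[OF gen.hyps(1)] gen.IH)
  next
    case (inv_gen i g)
    let ?a = "braid_gen n i"
    note [simp] = inv_gen.hyps inv_gen.prems braid_gen_closed[OF inv_gen.hyps(1)]
    \<comment> \<open>The case of an inverse is the case of the generator at the preimage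
      \<open>?f\<close>, conjugated back.\<close>
    let ?f = "\<rho> (inv\<^bsub>braid_group n\<^esub> ?a) (\<rho> g f)"
    have "A.cj (inv\<^bsub>artin_B n\<^esub> (s_B n ?a)) (A.cj (s_B n ?a) (\<theta> ?f)) = \<theta> ?f"
      by (simp add: A.cj_cj)
    moreover have "A.cj (s_B n ?a) (\<theta> ?f) = \<theta> (\<rho> g f)"
      by (simp add: theta_act_gen[OF inv_gen.hyps(1)])
    ultimately show ?case
      by (simp add: A.cj_cj[symmetric] act_comp inv_gen.IH)
  qed
qed

definition \<Phi> where "\<Phi> = (\<lambda>(f, g). \<theta> f \<otimes>\<^bsub>artin_B n\<^esub> s_B n g)"

text \<open>By \<open>theta_act\<close>, moving \<open>s_B n g\<close> past
  \<open>\<theta> f'\<close> replaces \<open>f'\<close> by \<open>\<rho> g f'\<close>, which is the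
  multiplication rule of the semidirect product.\<close>

lemma Phi_hom: "\<Phi> \<in> hom SD (artin_B n)"
proof (rule homI)
  show "\<Phi> x \<in> carrier (artin_B n)" if "x \<in> carrier SD" for x
    using that by (auto simp: \<Phi>_def SD_simps)
next
  fix x y assume "x \<in> carrier SD" "y \<in> carrier SD"
  then obtain f g f' g' where xy: "x = (f, g)" "y = (f', g')"
    and [simp]: "f \<in> carrier (free_group n)" "g \<in> carrier (braid_group n)"
      "f' \<in> carrier (free_group n)" "g' \<in> carrier (braid_group n)"
    by (auto simp: SD_simps)
  have "\<theta> (f \<otimes>\<^bsub>free_group n\<^esub> \<rho> g f') = \<theta> f \<otimes>\<^bsub>artin_B n\<^esub> A.cj (s_B n g) (\<theta> f')"
    using hom_mult[OF theta_hom] by (simp add: theta_act)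
  moreover have "s_B n (g \<otimes>\<^bsub>braid_group n\<^esub> g') = s_B n g \<otimes>\<^bsub>artin_B n\<^esub> s_B n g'"
    using hom_mult[OF s_B_hom] by simp
  ultimately show "\<Phi> (x \<otimes>\<^bsub>SD\<^esub> y) = \<Phi> x \<otimes>\<^bsub>artin_B n\<^esub> \<Phi> y"
    by (simp add: xy \<Phi>_def SD_simps A.cj_def A.m_assoc)
qed

definition sd_gen where
  "sd_gen i = (if i = 1 then (free_gen n 1, \<one>\<^bsub>braid_group n\<^esub>)
     else (\<one>\<^bsub>free_group n\<^esub>, braid_gen n (i - 1)))"

lemma artin_B_family_SD: "artin_B_family SD n sd_gen"
proof -
  interpret SD: group SD by (rule group_SD)
  show ?thesis
  proof
    have [simp]: "free_gen n 1 \<in> carrier (free_group n)" "free_gen n (Suc 0) \<in> carrier (free_group n)"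
      using n2 free_gen_closed[of 1 n] by auto
    show "sd_gen i \<in> carrier SD" if "i \<in> {1..n}" for i
      using that braid_gen_pred_closed[of i n] by (auto simp: SD_simps sd_gen_def)
    \<comment> \<open>In the semidirect product both sides are u_1 u_2 times the square of
      \<alpha>_1: the left one by \<open>act_next\<close>, the right one because
      \<open>act_conj\<close> gives u_2 (u_2^-1 u_1 u_2) = u_1 u_2.\<close>
    show "sd_gen 1 \<otimes>\<^bsub>SD\<^esub> (sd_gen 2 \<otimes>\<^bsub>SD\<^esub> (sd_gen 1 \<otimes>\<^bsub>SD\<^esub> sd_gen 2)) =
      sd_gen 2 \<otimes>\<^bsub>SD\<^esub> (sd_gen 1 \<otimes>\<^bsub>SD\<^esub> (sd_gen 2 \<otimes>\<^bsub>SD\<^esub> sd_gen 1))"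
    proof -
      have [simp]: "braid_gen n (Suc 0) \<in> carrier (braid_group n)"
        "free_gen n (Suc (Suc 0)) \<in> carrier (free_group n)"
        using n2 by (auto intro: braid_gen_closed free_gen_closed)
      have 1: "Suc 0 \<in> {1..n - 1}" using n2 by simp
      show ?thesis
        using act_next[OF 1] act_conj[OF 1]
        by (simp add: sd_gen_def SD_simps act_comp N.m_assoc act_mult)
    qed
    fix i j
    show "sd_gen i \<otimes>\<^bsub>SD\<^esub> (sd_gen (Suc i) \<otimes>\<^bsub>SD\<^esub> sd_gen i) =
      sd_gen (Suc i) \<otimes>\<^bsub>SD\<^esub> (sd_gen i \<otimes>\<^bsub>SD\<^esub> sd_gen (Suc i))" if "2 \<le> i" "Suc i \<le> n"
    proof -
      obtain k where "i = Suc k" "1 \<le> k" using \<open>2 \<le> i\<close> by (cases i) auto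
      moreover from this that have "braid_gen n i \<in> carrier (braid_group n)"
        "braid_gen n k \<in> carrier (braid_group n)"
        by (auto intro!: braid_gen_closed)
      ultimately show ?thesis
        using braid_family_relations(1)[of k "Suc k" n] that(2) by (simp add: sd_gen_def SD_simps)
    qed
    show "sd_gen i \<otimes>\<^bsub>SD\<^esub> sd_gen j = sd_gen j \<otimes>\<^bsub>SD\<^esub> sd_gen i"
      if "i \<in> {1..n}" "j \<in> {1..n}" "Suc i < j"
    proof -
      obtain k l where kl: "i = Suc k" "j = Suc l"
        using \<open>i \<in> {1..n}\<close> \<open>j \<in> {1..n}\<close> by (cases i; cases j) auto
      have l: "l \<in> {1..n - 1}" and "braid_gen n l \<in> carrier (braid_group n)"
        using that kl by (auto intro!: braid_gen_closed)
      moreover have "braid_gen n k \<in> carrier (braid_group n)" if "k \<noteq> 0"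
        using that \<open>j \<in> {1..n}\<close> \<open>Suc i < j\<close> kl by (intro braid_gen_closed) auto
      \<comment> \<open>For \<open>k = 0\<close> the left generator is u_1, which \<alpha>_l fixes
        because \<open>l\<close> is at least 2.\<close>
      ultimately show ?thesis
        using that kl braid_family_relations(2)[of k l n] act_other[OF l, of 1]
        by (cases "k = 0") (auto simp: sd_gen_def SD_simps)
    qed
  qed
qed

lemma sd_gen_simps:
  "sd_gen (Suc 0) = (free_gen n 1, \<one>\<^bsub>braid_group n\<^esub>)"
  "i \<noteq> 0 \<Longrightarrow> sd_gen (Suc i) = (\<one>\<^bsub>free_group n\<^esub>, braid_gen n i)"
  by (simp_all add: sd_gen_def)

abbreviation \<Psi> where "\<Psi> \<equiv> pres_lift SD sd_gen"

lemmas pres_hom_Psi = artin_B_family.pres_hom_artin_B[OF artin_B_family_SD n2]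
lemmas Psi_hom = pres_hom.pres_lift_hom[OF pres_hom_Psi, folded artin_B_def]
lemmas Psi_gen = pres_hom.pres_lift_gen[OF pres_hom_Psi, folded artin_B_gen_def]

text \<open>In t_{i+1} \<beta>_{i+1} = \<beta>_{i+1} t_i the image of \<beta>_{i+1} can be cancelled
  on the right, which determines the image of t_{i+1} without a formula for inverses in the
  semidirect product.\<close>

lemma Psi_t:
  assumes "i \<in> {1..n}"
  shows "\<Psi> (A.t i) = (free_gen n i, \<one>\<^bsub>braid_group n\<^esub>)"
proof -
  interpret SD: group SD by (rule group_SD)
  interpret \<Psi>: group_hom "artin_B n" SD \<Psi>
    using Psi_hom group_SD group_artin_B by (simp add: group_hom_def group_hom_axioms_def)
  show ?thesis
    using assms
  proof (induction i)
    case (Suc i)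
    show ?case
    proof (cases "i = 0")
      case True
      then show ?thesis using Suc.prems Psi_gen[of 1] by (simp add: sd_gen_simps)
    next
      case False
      then have i: "i \<in> {1..n - 1}" "i \<in> {1..n}" using Suc.prems by auto
      have [simp]: "braid_gen n i \<in> carrier (braid_group n)" "free_gen n i \<in> carrier (free_group n)"
        "free_gen n (Suc i) \<in> carrier (free_group n)"
        using i Suc.prems by (auto intro: braid_gen_closed free_gen_closed)
      have "A.t (Suc i) \<otimes>\<^bsub>artin_B n\<^esub> artin_B_gen n (Suc i) = artin_B_gen n (Suc i) \<otimes>\<^bsub>artin_B n\<^esub> A.t i"
        using False Suc.prems A.t_closed[OF i(2)] A.b_closed[of "Suc i"] by (simp add: A.cj_def A.m_assoc)
      then have "\<Psi> (A.t (Suc i)) \<otimes>\<^bsub>SD\<^esub> \<Psi> (artin_B_gen n (Suc i))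
          = \<Psi> (artin_B_gen n (Suc i)) \<otimes>\<^bsub>SD\<^esub> \<Psi> (A.t i)"
        using Suc.prems A.t_closed[OF i(2)] A.t_closed[OF Suc.prems] A.b_closed[of "Suc i"]
        by (simp flip: \<Psi>.hom_mult del: A.conj_chain.simps)
      also have "\<dots> = (free_gen n (Suc i), \<one>\<^bsub>braid_group n\<^esub>) \<otimes>\<^bsub>SD\<^esub> \<Psi> (artin_B_gen n (Suc i))"
        using Suc i False by (simp add: Psi_gen sd_gen_simps SD_simps act_next)
      finally show ?thesis
        using SD.right_cancel[OF \<Psi>.hom_closed[OF A.b_closed[OF Suc.prems]] \<Psi>.hom_closed[OF A.t_closed[OF Suc.prems]]]
        by (simp add: SD_simps(1) del: A.conj_chain.simps)
    qed
  qed auto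
qed

text \<open>Since (f, g) is the product of (f, 1) and (1, g), homomorphisms are compared on the free
  group and on the braid group separately.\<close>

lemma Psi_Phi: "x \<in> carrier SD \<Longrightarrow> \<Psi> (\<Phi> x) = x"
proof -
  interpret SD: group SD by (rule group_SD)
  interpret \<Psi>: group_hom "artin_B n" SD \<Psi>
    using Psi_hom group_SD group_artin_B by (simp add: group_hom_def group_hom_axioms_def)
  assume "x \<in> carrier SD"
  then obtain f g where x: "x = (f, g)" and [simp]: "f \<in> carrier (free_group n)" "g \<in> carrier (braid_group n)"
    by (auto simp: SD_simps)
  have "\<Psi> (\<theta> f) = (f, \<one>\<^bsub>braid_group n\<^esub>)"
    using hom_free_eqI[OF group_SD hom_compose[OF theta_hom Psi_hom] incl_N_hom, of f]
    by (simp add: theta_gen Psi_t)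
  moreover have "\<Psi> (s_B n g) = (\<one>\<^bsub>free_group n\<^esub>, g)"
  proof -
    have "\<Psi> (s_B n (braid_gen n i)) = (\<one>\<^bsub>free_group n\<^esub>, braid_gen n i)" if "i \<in> {1..n - 1}" for i
    proof -
      have "Suc i \<in> {1..n}" using that by auto
      from Psi_gen[OF this] show ?thesis using that by (simp add: s_B_gen sd_gen_simps)
    qed
    then show ?thesis
      using hom_braid_eqI[OF group_SD hom_compose[OF s_B_hom Psi_hom] incl_H_hom, of g] by simp
  qed
  ultimately show ?thesis
    by (simp add: x \<Phi>_def SD_simps)
qed

lemma Phi_Psi: "a \<in> carrier (artin_B n) \<Longrightarrow> \<Phi> (\<Psi> a) = a"
proof -
  assume a: "a \<in> carrier (artin_B n)"
  have th1: "\<theta> \<one>\<^bsub>free_group n\<^esub> = \<one>\<^bsub>artin_B n\<^esub>" and s1: "s_B n \<one>\<^bsub>braid_group n\<^esub> = \<one>\<^bsub>artin_B n\<^esub>"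
    using hom_one[OF theta_hom group_free group_artin_B] hom_one[OF s_B_hom group_braid group_artin_B]
    by auto
  have "(\<Phi> \<circ> \<Psi>) a = id a"
  proof (rule hom_artin_B_eqI[OF group_artin_B hom_compose[OF Psi_hom Phi_hom] _ _ a])
    show "id \<in> hom (artin_B n) (artin_B n)" by (simp add: hom_def)
    show "(\<Phi> \<circ> \<Psi>) (artin_B_gen n i) = id (artin_B_gen n i)" if "i \<in> {1..n}" for i
    proof (cases "i = 1")
      case True
      then show ?thesis
        using that A.b_closed[of 1] by (simp add: Psi_gen sd_gen_simps \<Phi>_def theta_gen s1)
    next
      case False
      then obtain k where k: "i = Suc k" "k \<in> {1..n - 1}" using \<open>i \<in> {1..n}\<close> False by (cases i) auto
      then show ?thesis
        using A.b_closed[OF that] Psi_gen[OF that] by (simp add: sd_gen_simps \<Phi>_def s_B_gen th1)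
    qed
  qed
  then show ?thesis by simp
qed

lemma Phi_iso: "\<Phi> \<in> iso SD (artin_B n)"
proof -
  have "bij_betw \<Phi> (carrier SD) (carrier (artin_B n))"
    using Psi_Phi Phi_Psi Phi_hom Psi_hom by (intro bij_betw_byWitness[of _ \<Psi>]) (auto simp: hom_def)
  then show ?thesis using Phi_hom by (simp add: iso_def)
qed

text \<open>Each \<open>A.t i\<close> is a conjugate of \<beta>_1, which \<open>pi_B n\<close> sends
  to the unit.\<close>

lemma pi_B_theta: "f \<in> carrier (free_group n) \<Longrightarrow> pi_B n (\<theta> f) = \<one>\<^bsub>braid_group n\<^esub>"
proof -
  interpret \<pi>: group_hom "artin_B n" "braid_group n" "pi_B n"
    using pi_B_hom group_braid group_artin_B by (simp add: group_hom_def group_hom_axioms_def)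
  have t: "pi_B n (A.t i) = \<one>\<^bsub>braid_group n\<^esub>" if "i \<in> {1..n}" for i
    using that
  proof (induction i)
    case (Suc i)
    then show ?case
      using pi_B_gen[of 1] A.t_closed[of i] A.b_closed[of "Suc i"]
      by (cases "i = 0") (auto simp: A.cj_def)
  qed auto
  assume f: "f \<in> carrier (free_group n)"
  show ?thesis
    using hom_free_eqI[OF group_braid hom_compose[OF theta_hom pi_B_hom] _ _ f, of "\<lambda>_. \<one>\<^bsub>braid_group n\<^esub>"]
    by (simp add: theta_gen t hom_def)
qed

lemma pi_B_s_B: "g \<in> carrier (braid_group n) \<Longrightarrow> pi_B n (s_B n g) = g"
proof -
  assume g: "g \<in> carrier (braid_group n)"
  have "pi_B n (s_B n (braid_gen n i)) = braid_gen n i" if "i \<in> {1..n - 1}" for i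
  proof -
    have "Suc i \<in> {1..n}" using that by auto
    from pi_B_gen[OF this] show ?thesis using that by (simp add: s_B_gen)
  qed
  then show ?thesis
    using hom_braid_eqI[OF group_braid hom_compose[OF s_B_hom pi_B_hom] _ _ g, of id]
    by (simp add: hom_def)
qed

lemma pi_B_Phi:
  "f \<in> carrier (free_group n) \<Longrightarrow> g \<in> carrier (braid_group n) \<Longrightarrow> pi_B n (\<Phi> (f, g)) = g"
  using hom_mult[OF pi_B_hom, of "\<theta> f" "s_B n g"] by (simp add: \<Phi>_def pi_B_theta pi_B_s_B)

lemma Phi_section: "g \<in> carrier (braid_group n) \<Longrightarrow> \<Phi> (\<one>\<^bsub>free_group n\<^esub>, g) = s_B n g"
  using hom_one[OF theta_hom group_free group_artin_B] by (simp add: \<Phi>_def)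

text \<open>By \<open>pi_B_Phi\<close> the kernel corresponds under \<Phi> to the pairs with second
  component 1, and on these \<Phi> is \<theta>.\<close>

lemma kernel_pi_B_iso:
  "(artin_B n)\<lparr>carrier := kernel (artin_B n) (braid_group n) (pi_B n)\<rparr> \<cong> free_group n"
proof -
  have s1: "s_B n \<one>\<^bsub>braid_group n\<^esub> = \<one>\<^bsub>artin_B n\<^esub>"
    using hom_one[OF s_B_hom group_braid group_artin_B] by auto
  then have th: "\<theta> f = \<Phi> (f, \<one>\<^bsub>braid_group n\<^esub>)" if "f \<in> carrier (free_group n)" for f
    using that by (simp add: \<Phi>_def)
  let ?K = "(artin_B n)\<lparr>carrier := kernel (artin_B n) (braid_group n) (pi_B n)\<rparr>"
  have "\<theta> \<in> iso (free_group n) ?K"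
    unfolding iso_def
  proof (intro CollectI conjI)
    show "\<theta> \<in> hom (free_group n) ?K"
      using theta_hom pi_B_theta by (auto simp: hom_def kernel_def)
    show "bij_betw \<theta> (carrier (free_group n)) (carrier ?K)"
      unfolding bij_betw_def
    proof
      show "inj_on \<theta> (carrier (free_group n))"
      proof (rule inj_onI)
        fix x y assume xy: "x \<in> carrier (free_group n)" "y \<in> carrier (free_group n)" "\<theta> x = \<theta> y"
        have "(x, \<one>\<^bsub>braid_group n\<^esub>) = \<Psi> (\<Phi> (x, \<one>\<^bsub>braid_group n\<^esub>))"
          using xy(1) by (simp add: Psi_Phi SD_simps(1))
        also have "\<dots> = \<Psi> (\<Phi> (y, \<one>\<^bsub>braid_group n\<^esub>))"
          using th[OF xy(1)] th[OF xy(2)] xy(3) by argo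
        also have "\<dots> = (y, \<one>\<^bsub>braid_group n\<^esub>)"
          using xy(2) by (simp add: Psi_Phi SD_simps(1))
        finally show "x = y" by simp
      qed
      show "\<theta> ` carrier (free_group n) = carrier ?K"
      proof
        show "\<theta> ` carrier (free_group n) \<subseteq> carrier ?K"
          by (auto simp: kernel_def pi_B_theta)
        show "carrier ?K \<subseteq> \<theta> ` carrier (free_group n)"
        proof
          fix a assume "a \<in> carrier ?K"
          then have a: "a \<in> carrier (artin_B n)" "pi_B n a = \<one>\<^bsub>braid_group n\<^esub>"
            by (auto simp: kernel_def)
          obtain f g where fg: "\<Psi> a = (f, g)" by (cases "\<Psi> a")
          then have "f \<in> carrier (free_group n)" "g \<in> carrier (braid_group n)"
            using hom_in_carrier[OF Psi_hom a(1)] by (auto simp: SD_simps)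
          moreover from this have "g = \<one>\<^bsub>braid_group n\<^esub>"
            using pi_B_Phi[of f g] Phi_Psi[OF a(1)] fg a(2) by simp
          ultimately show "a \<in> \<theta> ` carrier (free_group n)"
            using Phi_Psi[OF a(1)] fg th[of f] by force
        qed
      qed
    qed
  qed
  then have "free_group n \<cong> ?K" by (auto simp: is_iso_def)
  then show ?thesis by (rule group.iso_sym[OF group_free])
qed

end

section \<open>The braid relations for Artin's automorphisms\<close>

text \<open>Elements of \<open>auto\<close> are extensional, so agreement on the generators gives
  equality of functions and not only equality on the carrier.\<close>

lemma auto_free_eqI:
  assumes "a \<in> auto (free_group n)" "b \<in> auto (free_group n)"
    and "\<And>j. j \<in> {1..n} \<Longrightarrow> a (free_gen n j) = b (free_gen n j)"
  shows "a = b"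
proof (rule extensionalityI[of _ "carrier (free_group n)"])
  show "a f = b f" if "f \<in> carrier (free_group n)" for f
    by (rule hom_free_eqI[OF group_free _ _ _ that]) (use assms in \<open>auto simp: auto_def\<close>)
qed (use assms(1,2) in \<open>auto simp: auto_def Bij_def\<close>)

lemma (in group) auto_apply:
  assumes "a \<in> auto G"
  shows "x \<in> carrier G \<Longrightarrow> a x \<in> carrier G"
    and "x \<in> carrier G \<Longrightarrow> y \<in> carrier G \<Longrightarrow> a (x \<otimes> y) = a x \<otimes> a y"
    and "x \<in> carrier G \<Longrightarrow> a (inv x) = inv (a x)"
proof -
  interpret a: group_hom G G a
    using assms is_group by (simp add: group_hom_def group_hom_axioms_def auto_def)
  show "x \<in> carrier G \<Longrightarrow> a x \<in> carrier G"
    "x \<in> carrier G \<Longrightarrow> y \<in> carrier G \<Longrightarrow> a (x \<otimes> y) = a x \<otimes> a y"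
    "x \<in> carrier G \<Longrightarrow> a (inv x) = inv (a x)"
    by auto
qed

text \<open>Each relation is checked on the free generators. In the braid relation both sides send
  u_i to u_{i+2}, and generators with index outside i, i+1, i+2 are fixed by all factors; the
  remaining values are cancellations.\<close>

lemma pres_hom_artin_automorphisms:
  fixes a :: "nat \<Rightarrow> nat word set \<Rightarrow> nat word set" and n :: nat
  defines "u \<equiv> free_gen n"
  assumes auto: "\<And>i. 1 \<le> i \<Longrightarrow> i < n \<Longrightarrow> a i \<in> auto (free_group n)"
    and nxt: "\<And>i. 1 \<le> i \<Longrightarrow> i < n \<Longrightarrow> a i (u i) = u (Suc i)"
    and conj: "\<And>i. 1 \<le> i \<Longrightarrow> i < n \<Longrightarrow> a i (u (Suc i))
      = inv\<^bsub>free_group n\<^esub> (u (Suc i)) \<otimes>\<^bsub>free_group n\<^esub> u i \<otimes>\<^bsub>free_group n\<^esub> u (Suc i)"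
    and other: "\<And>i j. 1 \<le> i \<Longrightarrow> i < n \<Longrightarrow> 1 \<le> j \<Longrightarrow> j \<le> n \<Longrightarrow> j \<noteq> i \<Longrightarrow> j \<noteq> Suc i \<Longrightarrow>
      a i (u j) = u j"
  shows "pres_hom (AutoGroup (free_group n)) {1..n - 1} (braid_relations n) a"
proof -
  interpret F: group "free_group n" by (rule group_free)
  interpret Aut: group "AutoGroup (free_group n)" by (rule F.AutoGroup)
  have comp: "x \<otimes>\<^bsub>AutoGroup (free_group n)\<^esub> y \<in> auto (free_group n)"
    "f \<in> carrier (free_group n) \<Longrightarrow> (x \<otimes>\<^bsub>AutoGroup (free_group n)\<^esub> y) f = x (y f)"
    if "x \<in> auto (free_group n)" "y \<in> auto (free_group n)" for x y f
    using that Aut.m_closed[of x y] by (simp_all add: carrier_AutoGroup) (simp add: mult_AutoGroup compose_def)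
  have ucl [simp]: "u j \<in> carrier (free_group n)" if "1 \<le> j" "j \<le> n" for j
    unfolding u_def using that by (auto intro: free_gen_closed)
  show ?thesis
  proof (rule pres_hom_braidI[OF Aut.is_group])
    show "a i \<in> carrier (AutoGroup (free_group n))" if "i \<in> {1..n - 1}" for i
      using that auto[of i] by (auto simp: carrier_AutoGroup)
  next
    fix i assume i: "1 \<le> i" "Suc i < n"
    note [simp] = auto[of i] auto[of "Suc i"] F.auto_apply[OF auto[of i]] F.auto_apply[OF auto[of "Suc i"]]
      comp F.m_assoc F.inv_mult_group nxt conj other
    show "a i \<otimes>\<^bsub>AutoGroup (free_group n)\<^esub> (a (Suc i) \<otimes>\<^bsub>AutoGroup (free_group n)\<^esub> a i)
        = a (Suc i) \<otimes>\<^bsub>AutoGroup (free_group n)\<^esub> (a i \<otimes>\<^bsub>AutoGroup (free_group n)\<^esub> a (Suc i))"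
    proof (rule auto_free_eqI[where n = n], fold u_def)
      fix j assume j: "j \<in> {1..n}"
      consider "j = i" | "j = Suc i" | "j = Suc (Suc i)" | "j \<notin> {i, Suc i, Suc (Suc i)}" by auto
      then show "(a i \<otimes>\<^bsub>AutoGroup (free_group n)\<^esub> (a (Suc i) \<otimes>\<^bsub>AutoGroup (free_group n)\<^esub> a i)) (u j)
        = (a (Suc i) \<otimes>\<^bsub>AutoGroup (free_group n)\<^esub> (a i \<otimes>\<^bsub>AutoGroup (free_group n)\<^esub> a (Suc i))) (u j)"
        by cases (use i j in simp_all)
    qed (use i in simp_all)
  next
    fix i k assume i: "1 \<le> i" "Suc i < k" "k < n"
    note [simp] = auto[of i] auto[of k] F.auto_apply[OF auto[of i]] F.auto_apply[OF auto[of k]]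
      comp F.m_assoc F.inv_mult_group nxt conj other
    show "a i \<otimes>\<^bsub>AutoGroup (free_group n)\<^esub> a k = a k \<otimes>\<^bsub>AutoGroup (free_group n)\<^esub> a i"
    proof (rule auto_free_eqI[where n = n], fold u_def)
      fix j assume j: "j \<in> {1..n}"
      consider "j = i" | "j = Suc i" | "j = k" | "j = Suc k" | "j \<notin> {i, Suc i, k, Suc k}" by auto
      then show "(a i \<otimes>\<^bsub>AutoGroup (free_group n)\<^esub> a k) (u j) = (a k \<otimes>\<^bsub>AutoGroup (free_group n)\<^esub> a i) (u j)"
        by cases (use i j in simp_all)
    qed (use i in simp_all)
  qed
qed


section \<open>Fundamental groups\<close>

lemma loop_class_eq_iff:
  assumes "p \<in> loops S x"
  shows "loop_class S p = loop_class S q \<longleftrightarrow> homotopic_paths S p q"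
proof
  assume "loop_class S p = loop_class S q"
  moreover have "p \<in> loop_class S p"
    using assms by (simp add: loop_class_def loops_def)
  ultimately have "p \<in> loop_class S q" by simp
  then show "homotopic_paths S p q" by (simp add: loop_class_def homotopic_paths_sym)
next
  assume "homotopic_paths S p q"
  then show "loop_class S p = loop_class S q"
    unfolding loop_class_def by (blast intro: homotopic_paths_sym homotopic_paths_trans)
qed

lemma loop_class_eqI: "homotopic_paths S p q \<Longrightarrow> loop_class S p = loop_class S q"
  unfolding loop_class_def by (blast intro: homotopic_paths_sym homotopic_paths_trans)

lemma loops_join: "p \<in> loops S x \<Longrightarrow> q \<in> loops S x \<Longrightarrow> p +++ q \<in> loops S x"
  by (auto simp: loops_def path_image_join)

lemma loops_reversepath: "p \<in> loops S x \<Longrightarrow> reversepath p \<in> loops S x"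
  by (auto simp: loops_def)

lemma loops_const: "x \<in> S \<Longrightarrow> linepath x x \<in> loops S x"
  by (auto simp: loops_def)

lemma carrier_pi1: "carrier (pi1 S x) = loop_class S ` loops S x"
  by (auto simp: pi1_def quotient_def loop_class_def)

lemma one_pi1: "\<one>\<^bsub>pi1 S x\<^esub> = loop_class S (linepath x x)"
  by (simp add: pi1_def)

lemma mult_pi1:
  assumes "p \<in> loops S x" "q \<in> loops S x"
  shows "loop_class S p \<otimes>\<^bsub>pi1 S x\<^esub> loop_class S q = loop_class S (p +++ q)"
proof -
  have "loop_class S (p' +++ q') = loop_class S (p +++ q)"
    if "p' \<in> loop_class S p" "q' \<in> loop_class S q" for p' q'
  proof -
    have "homotopic_paths S p p'" "homotopic_paths S q q'" "pathfinish p = pathstart q"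
      using that assms by (auto simp: loop_class_def loops_def)
    then have "homotopic_paths S (p +++ q) (p' +++ q')"
      by (rule homotopic_paths_join)
    then show ?thesis
      by (simp add: loop_class_eqI)
  qed
  moreover have "p \<in> loop_class S p" "q \<in> loop_class S q"
    using assms by (auto simp: loop_class_def loops_def)
  ultimately have "(\<Union>p'\<in>loop_class S p. \<Union>q'\<in>loop_class S q. loop_class S (p' +++ q'))
      = loop_class S (p +++ q)"
    by blast
  then show ?thesis
    by (simp add: pi1_def)
qed

lemma group_pi1:
  assumes "x \<in> S"
  shows "group (pi1 S x)"
proof (rule groupI)
  show "\<one>\<^bsub>pi1 S x\<^esub> \<in> carrier (pi1 S x)"
    using loops_const[OF assms] by (auto simp: carrier_pi1 one_pi1)
next
  fix P Q assume "P \<in> carrier (pi1 S x)" "Q \<in> carrier (pi1 S x)"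
  then show "P \<otimes>\<^bsub>pi1 S x\<^esub> Q \<in> carrier (pi1 S x)"
    by (auto simp: carrier_pi1 mult_pi1 loops_join)
next
  fix P Q R assume "P \<in> carrier (pi1 S x)" "Q \<in> carrier (pi1 S x)" "R \<in> carrier (pi1 S x)"
  then obtain p q r where "P = loop_class S p" "Q = loop_class S q" "R = loop_class S r"
    and l: "p \<in> loops S x" "q \<in> loops S x" "r \<in> loops S x"
    by (auto simp: carrier_pi1)
  then show "P \<otimes>\<^bsub>pi1 S x\<^esub> Q \<otimes>\<^bsub>pi1 S x\<^esub> R = P \<otimes>\<^bsub>pi1 S x\<^esub> (Q \<otimes>\<^bsub>pi1 S x\<^esub> R)"
    by (simp add: mult_pi1 loops_join)
      (intro loop_class_eqI homotopic_paths_sym[OF homotopic_paths_assoc]; simp add: loops_def)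
next
  fix P assume "P \<in> carrier (pi1 S x)"
  then obtain p where P: "P = loop_class S p" and l: "p \<in> loops S x"
    by (auto simp: carrier_pi1)
  note c = loops_const[OF assms]
  have s: "pathstart p = x" "pathfinish p = x" "path p" "path_image p \<subseteq> S"
    using l by (auto simp: loops_def)
  show "\<one>\<^bsub>pi1 S x\<^esub> \<otimes>\<^bsub>pi1 S x\<^esub> P = P"
    using l c s homotopic_paths_lid'[of p S x] by (simp add: P one_pi1 mult_pi1 loop_class_eqI)
  have "homotopic_paths S (reversepath p +++ p) (linepath x x)"
    using homotopic_paths_linv[of p S] s by simp
  then have "loop_class S (reversepath p) \<otimes>\<^bsub>pi1 S x\<^esub> P = \<one>\<^bsub>pi1 S x\<^esub>"
    using l by (simp add: P one_pi1 mult_pi1 loops_reversepath loop_class_eqI)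
  then show "\<exists>Q\<in>carrier (pi1 S x). Q \<otimes>\<^bsub>pi1 S x\<^esub> P = \<one>\<^bsub>pi1 S x\<^esub>"
    using loops_reversepath[OF l] by (auto simp: carrier_pi1)
qed

lemma inv_pi1:
  assumes "x \<in> S" "p \<in> loops S x"
  shows "inv\<^bsub>pi1 S x\<^esub> (loop_class S p) = loop_class S (reversepath p)"
proof (rule group.inv_equality[OF group_pi1[OF assms(1)]])
  show "loop_class S (reversepath p) \<otimes>\<^bsub>pi1 S x\<^esub> loop_class S p = \<one>\<^bsub>pi1 S x\<^esub>"
    using assms homotopic_paths_linv[of p S]
    by (simp add: mult_pi1 loops_reversepath one_pi1 loop_class_eqI loops_def)
qed (use assms loops_reversepath in \<open>auto simp: carrier_pi1\<close>)

lemma pi1_map_loop_class: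
  assumes "continuous_on S f" "f \<in> S \<rightarrow> T" "p \<in> loops S x"
  shows "pi1_map T f (loop_class S p) = loop_class T (f \<circ> p)"
proof -
  have "loop_class T (f \<circ> q) = loop_class T (f \<circ> p)" if "q \<in> loop_class S p" for q
  proof -
    have "homotopic_paths S p q" using that by (simp add: loop_class_def)
    then have "homotopic_paths T (f \<circ> p) (f \<circ> q)"
      using assms(1,2) by (rule homotopic_paths_continuous_image)
    then show ?thesis
      by (simp add: loop_class_eqI)
  qed
  moreover have "p \<in> loop_class S p"
    using assms by (auto simp: loop_class_def loops_def)
  ultimately show ?thesis
    unfolding pi1_map_def by blast
qed

lemma loops_image:
  assumes "continuous_on S f" "f \<in> S \<rightarrow> T" "p \<in> loops S x"
  shows "f \<circ> p \<in> loops T (f x)"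
proof -
  have p: "path p" "path_image p \<subseteq> S" "pathstart p = x" "pathfinish p = x"
    using assms(3) by (auto simp: loops_def)
  have "path (f \<circ> p)"
    using p assms(1) by (intro path_continuous_image) (auto intro: continuous_on_subset)
  then show ?thesis
    using p assms(2) by (auto simp: loops_def pathstart_compose pathfinish_compose path_image_compose)
qed

lemma pi1_map_hom:
  assumes "continuous_on S f" "f \<in> S \<rightarrow> T" "f x = y"
  shows "pi1_map T f \<in> hom (pi1 S x) (pi1 T y)"
proof (rule homI)
  note image = loops_image[OF assms(1,2), of _ x, unfolded assms(3)]
    and map = pi1_map_loop_class[OF assms(1,2), where x = x]
  fix P assume "P \<in> carrier (pi1 S x)"
  then obtain p where p: "P = loop_class S p" "p \<in> loops S x" by (auto simp: carrier_pi1)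
  then show "pi1_map T f P \<in> carrier (pi1 T y)"
    by (simp add: carrier_pi1 map image)
  fix Q assume "Q \<in> carrier (pi1 S x)"
  then obtain q where q: "Q = loop_class S q" "q \<in> loops S x" by (auto simp: carrier_pi1)
  show "pi1_map T f (P \<otimes>\<^bsub>pi1 S x\<^esub> Q) = pi1_map T f P \<otimes>\<^bsub>pi1 T y\<^esub> pi1_map T f Q"
    using p q mult_pi1[OF image[OF p(2)] image[OF q(2)]]
    by (simp add: mult_pi1 map loops_join path_compose_join)
qed

section \<open>Parallel transport for a locally constant cocycle\<close>

text \<open>The fibre over \<open>z \<in> U \<alpha>\<close> is a copy of \<open>'x\<close>, and \<open>e \<alpha> z\<close> identifies it with the
  sheets over \<open>U \<alpha>\<close>. Points \<open>x\<close> over \<open>z\<close> and \<open>y\<close> over \<open>z'\<close> lie in the same sheet if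
  \<open>e \<alpha> z x = e \<alpha> z' y\<close>. This is a covering space without its total space.\<close>

locale covering_data =
  fixes S :: "'a::topological_space set" and I :: "'i set" and U :: "'i \<Rightarrow> 'a set"
    and e :: "'i \<Rightarrow> 'a \<Rightarrow> 'x \<Rightarrow> 'x"
  assumes open_U: "\<alpha> \<in> I \<Longrightarrow> open (U \<alpha>)"
    and cover: "S \<subseteq> (\<Union>\<alpha>\<in>I. U \<alpha>)"
    and bij_e: "\<alpha> \<in> I \<Longrightarrow> z \<in> U \<alpha> \<Longrightarrow> bij (e \<alpha> z)"
    and transition: "\<alpha> \<in> I \<Longrightarrow> \<beta> \<in> I \<Longrightarrow> z \<in> U \<alpha> \<Longrightarrow> z \<in> U \<beta> \<Longrightarrow>
      \<exists>V. open V \<and> z \<in> V \<and> (\<forall>z'\<in>V. \<forall>x y. e \<alpha> z' y = e \<alpha> z x \<longrightarrow> e \<beta> z' y = e \<beta> z x)"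
begin

text \<open>Staying in one sheet near \<open>s\<close> is demanded in every chart around
  \<open>p s\<close>; the assumption \<open>transition\<close> lets a single chart produce this. The
  set \<open>A\<close> is arbitrary so that lifts can be restricted, glued and
  reparametrized.\<close>

definition lift_on :: "real set \<Rightarrow> (real \<Rightarrow> 'a) \<Rightarrow> (real \<Rightarrow> 'x) \<Rightarrow> bool" where
  "lift_on A p \<phi> \<longleftrightarrow> (\<forall>s\<in>A. \<forall>\<alpha>\<in>I. p s \<in> U \<alpha> \<longrightarrow>
     (\<exists>N. open N \<and> s \<in> N \<and> (\<forall>s'\<in>N \<inter> A. e \<alpha> (p s') (\<phi> s') = e \<alpha> (p s) (\<phi> s))))"

lemma lift_onD:
  assumes "lift_on A p \<phi>" "s \<in> A" "\<alpha> \<in> I" "p s \<in> U \<alpha>"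
  obtains N where "open N" "s \<in> N" "\<And>s'. s' \<in> N \<Longrightarrow> s' \<in> A \<Longrightarrow> e \<alpha> (p s') (\<phi> s') = e \<alpha> (p s) (\<phi> s)"
proof -
  have "\<exists>N. open N \<and> s \<in> N \<and> (\<forall>s'\<in>N \<inter> A. e \<alpha> (p s') (\<phi> s') = e \<alpha> (p s) (\<phi> s))"
    using assms(1)[unfolded lift_on_def, rule_format, OF assms(2,3,4)] .
  then show ?thesis using that by auto
qed

lemma lift_on_subset:
  assumes "lift_on A p \<phi>" "B \<subseteq> A"
  shows "lift_on B p \<phi>"
  unfolding lift_on_def
proof (intro ballI impI)
  fix s \<alpha> assume s: "s \<in> B" "\<alpha> \<in> I" "p s \<in> U \<alpha>"
  then have "s \<in> A" using assms(2) by auto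
  from lift_onD[OF assms(1) this s(2,3)]
  obtain N where "open N" "s \<in> N" "\<And>s'. s' \<in> N \<Longrightarrow> s' \<in> A \<Longrightarrow> e \<alpha> (p s') (\<phi> s') = e \<alpha> (p s) (\<phi> s)"
    by metis
  then show "\<exists>N. open N \<and> s \<in> N \<and> (\<forall>s'\<in>N \<inter> B. e \<alpha> (p s') (\<phi> s') = e \<alpha> (p s) (\<phi> s))"
    using assms(2) by (intro exI[of _ N]) auto
qed

lemma lift_on_cong:
  "(\<And>s. s \<in> A \<Longrightarrow> p s = q s) \<Longrightarrow> (\<And>s. s \<in> A \<Longrightarrow> \<phi> s = \<psi> s) \<Longrightarrow> lift_on A p \<phi> = lift_on A q \<psi>"
  unfolding lift_on_def by simp

text \<open>The sheet is a locally constant function on a connected set.\<close>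

lemma lift_on_parallel:
  assumes "lift_on A p \<phi>" "connected A" "p ` A \<subseteq> U \<alpha>" "\<alpha> \<in> I" "s \<in> A" "t \<in> A"
  shows "e \<alpha> (p s) (\<phi> s) = e \<alpha> (p t) (\<phi> t)"
proof (rule connected_local_const[OF assms(2,5,6)], rule ballI)
  fix r assume r: "r \<in> A"
  then have "p r \<in> U \<alpha>" using assms by auto
  from lift_onD[OF assms(1) r assms(4) this]
  obtain N where "open N" "r \<in> N" "\<And>s'. s' \<in> N \<Longrightarrow> s' \<in> A \<Longrightarrow> e \<alpha> (p s') (\<phi> s') = e \<alpha> (p r) (\<phi> r)" by metis
  then show "\<forall>\<^sub>F b in at r within A. e \<alpha> (p r) (\<phi> r) = e \<alpha> (p b) (\<phi> b)"
    unfolding eventually_at_topological by metis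
qed

lemma continuous_nhd:
  assumes "continuous_on A p" "s \<in> A" "open V" "p s \<in> V"
  obtains M where "open M" "s \<in> M" "\<And>y. y \<in> A \<Longrightarrow> y \<in> M \<Longrightarrow> p y \<in> V"
proof -
  have "\<exists>M. open M \<and> s \<in> M \<and> (\<forall>y\<in>A. y \<in> M \<longrightarrow> p y \<in> V)"
    using assms(1)[unfolded continuous_on_topological, rule_format, OF assms(2-4)] .
  then show ?thesis using that by auto
qed

text \<open>Whether the two lifts agree is locally constant along \<open>A\<close>, because the maps
  to the sheets are injective.\<close>

lemma lift_on_unique:
  assumes l: "lift_on A p \<phi>" "lift_on A p \<psi>" and c: "continuous_on A p" "p ` A \<subseteq> S"
    and A: "connected A" "s \<in> A" "t \<in> A" and eq: "\<phi> s = \<psi> s"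
  shows "\<phi> t = \<psi> t"
proof -
  have "(\<phi> s = \<psi> s) = (\<phi> t = \<psi> t)"
  proof (rule connected_local_const[OF A], rule ballI)
    fix r assume r: "r \<in> A"
    then obtain \<alpha> where \<alpha>: "\<alpha> \<in> I" "p r \<in> U \<alpha>" using c(2) cover by blast
    obtain M where M: "open M" "r \<in> M" "\<And>y. y \<in> A \<Longrightarrow> y \<in> M \<Longrightarrow> p y \<in> U \<alpha>"
      using continuous_nhd[OF c(1) r open_U[OF \<alpha>(1)] \<alpha>(2)] by metis
    obtain N where N: "open N" "r \<in> N" "\<And>s'. s' \<in> N \<Longrightarrow> s' \<in> A \<Longrightarrow> e \<alpha> (p s') (\<phi> s') = e \<alpha> (p r) (\<phi> r)"
      using lift_onD[OF l(1) r \<alpha>] by metis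
    obtain N' where N': "open N'" "r \<in> N'" "\<And>s'. s' \<in> N' \<Longrightarrow> s' \<in> A \<Longrightarrow> e \<alpha> (p s') (\<psi> s') = e \<alpha> (p r) (\<psi> r)"
      using lift_onD[OF l(2) r \<alpha>] by metis
    show "\<forall>\<^sub>F b in at r within A. (\<phi> r = \<psi> r) = (\<phi> b = \<psi> b)"
      unfolding eventually_at_topological
    proof (intro exI[of _ "M \<inter> N \<inter> N'"] conjI ballI impI)
      fix b assume b: "b \<in> M \<inter> N \<inter> N'" "b \<in> A"
      then have "inj (e \<alpha> (p b))" "inj (e \<alpha> (p r))"
        using M(3) \<alpha> bij_e bij_is_inj by blast+
      then show "(\<phi> r = \<psi> r) = (\<phi> b = \<psi> b)"
        using N(3)[of b] N'(3)[of b] b by (metis IntD1 IntD2 injD)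
    qed (use M N N' in auto)
  qed
  then show ?thesis using eq by simp
qed

lemma lift_on_glue:
  assumes "lift_on {a..b} p \<phi>" "lift_on {b..c} p \<psi>" "\<phi> b = \<psi> b" "a \<le> b" "b \<le> c"
  shows "lift_on {a..c} p (\<lambda>s. if s \<le> b then \<phi> s else \<psi> s)"
  unfolding lift_on_def
proof (intro ballI impI)
  let ?\<chi> = "\<lambda>s. if s \<le> b then \<phi> s else \<psi> s"
  have 1: "lift_on {a..b} p ?\<chi>" 
    using assms(1) by (subst lift_on_cong[of _ p p _ \<phi>]) auto
  have 2: "lift_on {b..c} p ?\<chi>"
    using assms(2,3) by (subst lift_on_cong[of _ p p _ \<psi>]) auto
  \<comment> \<open>At a point outside a closed piece the condition for that piece is vacuous
    nearby, so both pieces can be treated alike at every \<open>s\<close>.\<close>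
  have *: "\<exists>N. open N \<and> s \<in> N \<and> (\<forall>s'\<in>N \<inter> A. e \<alpha> (p s') (?\<chi> s') = e \<alpha> (p s) (?\<chi> s))"
    if "lift_on A p ?\<chi>" "closed A" "\<alpha> \<in> I" "p s \<in> U \<alpha>" for A s \<alpha>
  proof (cases "s \<in> A")
    case True
    then show ?thesis using that(1,3,4) unfolding lift_on_def by blast
  next
    case False
    then show ?thesis using \<open>closed A\<close> by (intro exI[of _ "- A"]) auto
  qed
  fix s \<alpha> assume s: "s \<in> {a..c}" "\<alpha> \<in> I" "p s \<in> U \<alpha>"
  obtain N where N: "open N" "s \<in> N" "\<And>s'. s' \<in> N \<inter> {a..b} \<Longrightarrow> e \<alpha> (p s') (?\<chi> s') = e \<alpha> (p s) (?\<chi> s)"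
    using *[OF 1 closed_atLeastAtMost s(2,3)] by blast
  obtain N' where N': "open N'" "s \<in> N'" "\<And>s'. s' \<in> N' \<inter> {b..c} \<Longrightarrow> e \<alpha> (p s') (?\<chi> s') = e \<alpha> (p s) (?\<chi> s)"
    using *[OF 2 closed_atLeastAtMost s(2,3)] by blast
  show "\<exists>N. open N \<and> s \<in> N \<and> (\<forall>s'\<in>N \<inter> {a..c}. e \<alpha> (p s') (?\<chi> s') = e \<alpha> (p s) (?\<chi> s))"
  proof (intro exI[of _ "N \<inter> N'"] conjI ballI)
    fix s' assume "s' \<in> N \<inter> N' \<inter> {a..c}"
    then show "e \<alpha> (p s') (?\<chi> s') = e \<alpha> (p s) (?\<chi> s)"
      using N(3)[of s'] N'(3)[of s'] by (cases "s' \<le> b") auto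
  qed (use N N' in auto)
qed

text \<open>Over a chart the lift is the section with constant sheet label \<open>w\<close>;
  \<open>transition\<close> carries this to the other charts.\<close>

lemma lift_on_chart:
  assumes "continuous_on A p" "p ` A \<subseteq> U \<alpha>" "\<alpha> \<in> I"
  shows "lift_on A p (\<lambda>s. inv_into UNIV (e \<alpha> (p s)) w)"
  unfolding lift_on_def
proof (intro ballI impI)
  fix s \<beta> assume s: "s \<in> A" "\<beta> \<in> I" "p s \<in> U \<beta>"
  then have s\<alpha>: "p s \<in> U \<alpha>" using assms by auto
  obtain V where V: "open V" "p s \<in> V"
    "\<And>z' x y. z' \<in> V \<Longrightarrow> e \<alpha> z' y = e \<alpha> (p s) x \<Longrightarrow> e \<beta> z' y = e \<beta> (p s) x"
    using transition[OF assms(3) s(2) s\<alpha> s(3)] by metis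
  obtain M where M: "open M" "s \<in> M" "\<And>y. y \<in> A \<Longrightarrow> y \<in> M \<Longrightarrow> p y \<in> V"
    using continuous_nhd[OF assms(1) s(1) V(1,2)] by metis
  have w: "e \<alpha> (p r) (inv_into UNIV (e \<alpha> (p r)) w) = w" if "r \<in> A" for r
    using that assms(2) by (intro surj_f_inv_f[OF bij_is_surj[OF bij_e[OF assms(3)]]]) auto
  show "\<exists>N. open N \<and> s \<in> N \<and> (\<forall>s'\<in>N \<inter> A. e \<beta> (p s') (inv_into UNIV (e \<alpha> (p s')) w) = e \<beta> (p s) (inv_into UNIV (e \<alpha> (p s)) w))"
    using M V(3) s by (intro exI[of _ M]) (auto simp: w)
qed

text \<open>Lifts exist over short intervals inside one chart and can be glued; the subdivision is
  supplied by \<open>Bolzano\<close>.\<close>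

lemma lift_on_exists:
  assumes "u \<le> v" "continuous_on {u..v} p" "p ` {u..v} \<subseteq> S"
  shows "\<exists>\<phi>. \<phi> u = x \<and> lift_on {u..v} p \<phi>"
proof -
  \<comment> \<open>The inequalities make \<open>P\<close> trivial for intervals that leave [u, v],
    and the start value is arbitrary so that consecutive lifts can be matched.\<close>
  define P where "P a b \<longleftrightarrow> (u \<le> a \<longrightarrow> a \<le> b \<longrightarrow> b \<le> v \<longrightarrow> (\<forall>x. \<exists>\<phi>. \<phi> a = x \<and> lift_on {a..b} p \<phi>))"
    for a b
  have "P u v"
    using assms(1)
  proof (induction rule: Bolzano)
    case (trans a b c)
    show ?case
      unfolding P_def
    proof (intro impI allI)
      fix x assume uc: "u \<le> a" "c \<le> v"
      obtain \<phi> where \<phi>: "\<phi> a = x" "lift_on {a..b} p \<phi>"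
        using trans uc unfolding P_def by fastforce
      obtain \<psi> where \<psi>: "\<psi> b = \<phi> b" "lift_on {b..c} p \<psi>"
        using trans uc unfolding P_def by fastforce
      have "lift_on {a..c} p (\<lambda>s. if s \<le> b then \<phi> s else \<psi> s)"
        using \<phi> \<psi> trans by (intro lift_on_glue) auto
      then show "\<exists>\<phi>. \<phi> a = x \<and> lift_on {a..c} p \<phi>"
        using \<phi> \<open>a \<le> b\<close> by (intro exI[of _ "\<lambda>s. if s \<le> b then \<phi> s else \<psi> s"]) auto
    qed
  next
    case (local s)
    then have s: "s \<in> {u..v}" by simp
    then obtain \<alpha> where \<alpha>: "\<alpha> \<in> I" "p s \<in> U \<alpha>" using assms(3) cover by blast
    obtain M where M: "open M" "s \<in> M" "\<And>y. y \<in> {u..v} \<Longrightarrow> y \<in> M \<Longrightarrow> p y \<in> U \<alpha>"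
      using continuous_nhd[OF assms(2) s open_U[OF \<alpha>(1)] \<alpha>(2)] by metis
    obtain d where d: "d > 0" "\<And>y. \<bar>y - s\<bar> < d \<Longrightarrow> y \<in> M"
      using M(1,2) unfolding open_dist dist_real_def by blast
    have "P a b" if ab: "a \<le> s" "s \<le> b" "b - a < d" for a b
      unfolding P_def
    proof (intro impI allI)
      fix x assume uv: "u \<le> a" "b \<le> v"
      have sub: "p ` {a..b} \<subseteq> U \<alpha>"
        using ab uv by (auto intro!: M(3) d(2))
      have "lift_on {a..b} p (\<lambda>r. inv_into UNIV (e \<alpha> (p r)) (e \<alpha> (p a) x))"
        using sub \<alpha> uv by (intro lift_on_chart) (auto intro: continuous_on_subset[OF assms(2)])
      moreover have "inv_into UNIV (e \<alpha> (p a)) (e \<alpha> (p a) x) = x"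
        using sub ab \<alpha> by (intro inv_f_f bij_is_inj bij_e) auto
      ultimately show "\<exists>\<phi>. \<phi> a = x \<and> lift_on {a..b} p \<phi>"
        by (intro exI[of _ "\<lambda>r. inv_into UNIV (e \<alpha> (p r)) (e \<alpha> (p a) x)"] conjI)
    qed
    then show ?case using d(1) by blast
  qed
  then show ?thesis using assms(1) by (simp add: P_def)
qed

text \<open>The lifts of the rows of the homotopy are chosen independently and share only their
  start. The endpoint is nevertheless locally constant in \<open>t\<close>, because nearby rows stay
  in the same sheets all along.\<close>

lemma lift_on_endpoint_homotopy:
  fixes h :: "real \<times> real \<Rightarrow> 'a" and \<phi> :: "real \<Rightarrow> real \<Rightarrow> 'x"
  assumes h: "continuous_on ({0..1} \<times> {0..1}) h" "h ` ({0..1} \<times> {0..1}) \<subseteq> S"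
    and ends: "\<And>t. t \<in> {0..1} \<Longrightarrow> h (t, 0) = a" "\<And>t. t \<in> {0..1} \<Longrightarrow> h (t, 1) = b"
    and lift: "\<And>t. t \<in> {0..1} \<Longrightarrow> lift_on {0..1} (\<lambda>s. h (t, s)) (\<phi> t)"
    and start: "\<And>t. t \<in> {0..1} \<Longrightarrow> \<phi> t 0 = x"
  shows "\<phi> 0 1 = \<phi> 1 1"
proof -
  have "\<phi> (0::real) 1 = \<phi> (1::real) 1"
  proof (rule connected_local_const[of "{0..1::real}"], safe)
    fix t :: real assume "t \<in> {0..1}"
    note t = this
    \<comment> \<open>\<open>R s\<close> says that the lifts of nearby rows are in one sheet at
      \<open>s\<close>. It holds at 0, where all rows and lifts coincide, it passes across each
      small rectangle that is mapped into one chart, and at 1 it gives equality since all rows end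
      in \<open>b\<close>.\<close>
    define R where "R s \<longleftrightarrow> (\<forall>\<alpha>\<in>I. h (t, s) \<in> U \<alpha> \<longrightarrow>
        (\<forall>\<^sub>F t' in at t within {0..1}. e \<alpha> (h (t', s)) (\<phi> t' s) = e \<alpha> (h (t, s)) (\<phi> t s)))" for s
    define P where "P s s' \<longleftrightarrow> (0 \<le> s \<longrightarrow> s \<le> s' \<longrightarrow> s' \<le> 1 \<longrightarrow> R s \<longrightarrow> R s')" for s s'
    have "(0::real) \<le> 1" by simp
    then have "P 0 1"
    proof (induction rule: Bolzano)
      case (trans a b c)
      then show ?case unfolding P_def by auto
    next
      case (local s)
      then have ts: "(t, s) \<in> {0..1} \<times> {0..1}" using t by simp
      then obtain \<alpha> where \<alpha>: "\<alpha> \<in> I" "h (t, s) \<in> U \<alpha>" using h(2) cover by blast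
      obtain M where M: "open M" "(t, s) \<in> M" "\<And>y. y \<in> {0..1} \<times> {0..1} \<Longrightarrow> y \<in> M \<Longrightarrow> h y \<in> U \<alpha>"
        using h(1)[unfolded continuous_on_topological, rule_format, OF ts open_U[OF \<alpha>(1)] \<alpha>(2)] by auto
      obtain T N where "open T" "open N" "(t, s) \<in> T \<times> N" "T \<times> N \<subseteq> M"
        using open_prod_elim[OF M(1,2)] by blast
      then have TN: "open T" "open N" "t \<in> T" "s \<in> N" "T \<times> N \<subseteq> M"
        by auto
      obtain d where d: "d > 0" "\<And>y. \<bar>y - s\<bar> < d \<Longrightarrow> y \<in> N"
        using TN(2,4) unfolding open_dist dist_real_def by blast
      have "P u v" if uv: "u \<le> s" "s \<le> v" "v - u < d" for u v
        unfolding P_def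
      proof (intro impI)
        assume uv': "0 \<le> u" "u \<le> v" "v \<le> 1" and Ru: "R u"
        have inU: "h (t', r) \<in> U \<alpha>" if "t' \<in> T" "t' \<in> {0..1}" "r \<in> {u..v}" for t' r
        proof -
          have "\<bar>r - s\<bar> < d" using that uv by (auto simp: abs_if)
          then show ?thesis
            using that uv' d(2) TN(5) by (intro M(3)) auto
        qed
        have par: "e \<alpha> (h (t', v)) (\<phi> t' v) = e \<alpha> (h (t', u)) (\<phi> t' u)" if "t' \<in> T" "t' \<in> {0..1}" for t'
        proof -
          have "lift_on {u..v} (\<lambda>s. h (t', s)) (\<phi> t')"
            using uv' by (intro lift_on_subset[OF lift[OF that(2)]]) auto
          moreover have "(\<lambda>s. h (t', s)) ` {u..v} \<subseteq> U \<alpha>"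
            using inU[OF that] by blast
          ultimately show ?thesis
            using lift_on_parallel[of "{u..v}" "\<lambda>s. h (t', s)" "\<phi> t'" \<alpha> v u] uv' \<alpha>(1) by auto
        qed
        have "\<forall>\<^sub>F t' in at t within {0..1}. e \<alpha> (h (t', u)) (\<phi> t' u) = e \<alpha> (h (t, u)) (\<phi> t u)"
          using Ru \<alpha>(1) inU[OF TN(3) t, of u] uv' unfolding R_def by auto
        moreover have "\<forall>\<^sub>F t' in at t within {0..1}. t' \<in> T \<and> t' \<in> {0..1}"
          using TN(1,3) unfolding eventually_at_topological by auto
        ultimately have v: "\<forall>\<^sub>F t' in at t within {0..1}. e \<alpha> (h (t', v)) (\<phi> t' v) = e \<alpha> (h (t, v)) (\<phi> t v)"
          by eventually_elim (use par t TN(3) in auto)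
        show "R v"
          unfolding R_def
        proof (intro ballI impI)
          fix \<beta> assume \<beta>: "\<beta> \<in> I" "h (t, v) \<in> U \<beta>"
          obtain V where V: "open V" "h (t, v) \<in> V"
            "\<And>z' x y. z' \<in> V \<Longrightarrow> e \<alpha> z' y = e \<alpha> (h (t, v)) x \<Longrightarrow> e \<beta> z' y = e \<beta> (h (t, v)) x"
            using transition[OF \<alpha>(1) \<beta>(1) inU[OF TN(3) t, of v] \<beta>(2)] uv' by auto
          have "continuous_on {0..1} (\<lambda>t. h (t, v))"
            using uv' by (intro continuous_on_compose2[OF h(1)] continuous_intros) auto
          from continuous_nhd[OF this t V(1,2)]
          obtain M' where "open M'" "t \<in> M'" "\<And>y. y \<in> {0..1} \<Longrightarrow> y \<in> M' \<Longrightarrow> h (y, v) \<in> V"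
            by metis
          then have "\<forall>\<^sub>F t' in at t within {0..1}. h (t', v) \<in> V"
            unfolding eventually_at_topological by auto
          with v show "\<forall>\<^sub>F t' in at t within {0..1}. e \<beta> (h (t', v)) (\<phi> t' v) = e \<beta> (h (t, v)) (\<phi> t v)"
            by eventually_elim (use V(3) in auto)
        qed
      qed
      then show ?case using d(1) by blast
    qed
    moreover have "R 0"
      unfolding R_def using ends(1) start t by (auto simp: eventually_at_topological)
    ultimately have R1: "R 1" by (simp add: P_def)
    have "b \<in> S" using h(2) ends(2)[OF t] t by force
    then obtain \<alpha> where \<alpha>: "\<alpha> \<in> I" "b \<in> U \<alpha>" using cover by blast
    then have inj: "inj (e \<alpha> b)" using bij_e bij_is_inj by blast
    have "\<forall>\<^sub>F t' in at t within {0..1}. e \<alpha> (h (t', 1)) (\<phi> t' 1) = e \<alpha> (h (t, 1)) (\<phi> t 1)"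
      using R1 \<alpha> ends(2)[OF t] unfolding R_def by auto
    moreover have "\<forall>\<^sub>F t' in at t within {0..1}. t' \<in> {0..1}"
      unfolding eventually_at_topological by auto
    ultimately show "\<forall>\<^sub>F t' in at t within {0..1}. \<phi> t 1 = \<phi> t' 1"
      by eventually_elim (use ends(2) t inj in \<open>auto simp: inj_eq\<close>)
  qed auto
  then show ?thesis .
qed

text \<open>The end of a lift that starts at \<open>x\<close>; \<open>lift_on_unique\<close> makes
  the choice immaterial.\<close>

definition transport :: "(real \<Rightarrow> 'a) \<Rightarrow> 'x \<Rightarrow> 'x" where
  "transport p x = (SOME \<phi>. \<phi> 0 = x \<and> lift_on {0..1} p \<phi>) 1"

lemma transport_eqI:
  assumes "path p" "path_image p \<subseteq> S" "lift_on {0..1} p \<phi>"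
  shows "transport p (\<phi> 0) = \<phi> 1"
proof -
  have ex: "\<exists>\<psi>. \<psi> 0 = \<phi> 0 \<and> lift_on {0..1} p \<psi>" using assms(3) by blast
  show ?thesis
    unfolding transport_def
    by (rule lift_on_unique[of "{0..1}" p _ _ 0 1])
      (use someI_ex[OF ex] assms in \<open>auto simp: path_def path_image_def\<close>)
qed

lemma transport_lift:
  assumes "path p" "path_image p \<subseteq> S"
  obtains \<phi> where "\<phi> 0 = x" "\<phi> 1 = transport p x" "lift_on {0..1} p \<phi>"
proof -
  obtain \<phi> where \<phi>: "\<phi> 0 = x" "lift_on {0..1} p \<phi>"
    using lift_on_exists[of 0 1 p x] assms by (auto simp: path_def path_image_def)
  then show ?thesis
    using that[of \<phi>] transport_eqI[OF assms \<phi>(2)] by simp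
qed

lemma transport_homotopic:
  assumes "homotopic_paths S p q"
  shows "transport p x = transport q x"
proof -
  obtain h :: "real \<times> real \<Rightarrow> 'a" where h: "continuous_on ({0..1} \<times> {0..1}) h" "h \<in> ({0..1} \<times> {0..1}) \<rightarrow> S"
    and pq: "\<forall>x\<in>{0..1}. h (0, x) = p x" "\<forall>x\<in>{0..1}. h (1, x) = q x"
    and ends: "\<forall>t\<in>{0..1}. pathstart (h \<circ> Pair t) = pathstart p \<and> pathfinish (h \<circ> Pair t) = pathfinish p"
    using assms unfolding homotopic_paths by blast
  have c: "continuous_on {0..1} (\<lambda>s. h (t, s))" "(\<lambda>s. h (t, s)) ` {0..1} \<subseteq> S" if "t \<in> {0..1}" for t
    using that h(2) by (auto intro!: continuous_on_compose2[OF h(1)] continuous_intros)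
  define \<phi> where "\<phi> t = (SOME \<psi>. \<psi> 0 = x \<and> lift_on {0..1} (\<lambda>s. h (t, s)) \<psi>)" for t
  have \<phi>: "\<phi> t 0 = x \<and> lift_on {0..1} (\<lambda>s. h (t, s)) (\<phi> t)" if "t \<in> {0..1}" for t
    unfolding \<phi>_def
    using lift_on_exists[OF _ c[OF that], of x] by (intro someI_ex[of "\<lambda>\<psi>. \<psi> 0 = x \<and> lift_on {0..1} (\<lambda>s. h (t, s)) \<psi>"]) simp
  have "\<phi> 0 1 = \<phi> 1 1"
    by (rule lift_on_endpoint_homotopy[OF h(1), of "pathstart p" "pathfinish p" \<phi> x])
      (use h ends \<phi> in \<open>auto simp: pathstart_def pathfinish_def\<close>)
  moreover have "lift_on {0..1} p (\<phi> 0)" "lift_on {0..1} q (\<phi> 1)"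
    using \<phi>[of 0] \<phi>[of 1] pq lift_on_cong[of "{0..1}" p "\<lambda>s. h (0, s)"] lift_on_cong[of "{0..1}" q "\<lambda>s. h (1, s)"]
    by auto
  then have "transport p x = \<phi> 0 1" "transport q x = \<phi> 1 1"
    using transport_eqI[of p "\<phi> 0"] transport_eqI[of q "\<phi> 1"] \<phi>[of 0] \<phi>[of 1]
      homotopic_paths_imp_path[OF assms] homotopic_paths_imp_subset[OF assms] by auto
  ultimately show ?thesis by simp
qed

lemma transport_chart:
  assumes "path p" "path_image p \<subseteq> S" "path_image p \<subseteq> U \<alpha>" "\<alpha> \<in> I"
  shows "e \<alpha> (pathfinish p) (transport p x) = e \<alpha> (pathstart p) x"
proof -
  obtain \<phi> where "\<phi> 0 = x" "\<phi> 1 = transport p x" "lift_on {0..1} p \<phi>"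
    using transport_lift[OF assms(1,2)] .
  then show ?thesis
    using lift_on_parallel[of "{0..1}" p \<phi> \<alpha> 1 0] assms
    by (auto simp: path_image_def pathstart_def pathfinish_def)
qed

lemma lift_on_reparametrize:
  assumes "lift_on A p \<phi>" "continuous_on B g" "g ` B \<subseteq> A"
  shows "lift_on B (p \<circ> g) (\<phi> \<circ> g)"
  unfolding lift_on_def
proof (intro ballI impI)
  fix s \<alpha> assume s: "s \<in> B" "\<alpha> \<in> I" "(p \<circ> g) s \<in> U \<alpha>"
  obtain N where N: "open N" "g s \<in> N" "\<And>s'. s' \<in> N \<Longrightarrow> s' \<in> A \<Longrightarrow> e \<alpha> (p s') (\<phi> s') = e \<alpha> (p (g s)) (\<phi> (g s))"
    using lift_onD[OF assms(1), of "g s" \<alpha>] s assms(3) by (metis comp_apply image_subset_iff)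
  obtain M where M: "open M" "s \<in> M" "\<And>y. y \<in> B \<Longrightarrow> y \<in> M \<Longrightarrow> g y \<in> N"
    using assms(2)[unfolded continuous_on_topological, rule_format, OF s(1) N(1,2)] by auto
  show "\<exists>N. open N \<and> s \<in> N \<and> (\<forall>s'\<in>N \<inter> B. e \<alpha> ((p \<circ> g) s') ((\<phi> \<circ> g) s') = e \<alpha> ((p \<circ> g) s) ((\<phi> \<circ> g) s))"
    using M N(3) assms(3) by (intro exI[of _ M]) auto
qed

text \<open>The first path acts first, which is why the action on the fibre will be a right
  multiplication.\<close>

lemma transport_join:
  assumes "path p" "path_image p \<subseteq> S" "path q" "path_image q \<subseteq> S" "pathfinish p = pathstart q"
  shows "transport (p +++ q) x = transport q (transport p x)"
proof -
  obtain \<phi> where \<phi>: "\<phi> 0 = x" "\<phi> 1 = transport p x" "lift_on {0..1} p \<phi>"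
    using transport_lift[OF assms(1,2)] .
  obtain \<psi> where \<psi>: "\<psi> 0 = transport p x" "\<psi> 1 = transport q (transport p x)" "lift_on {0..1} q \<psi>"
    using transport_lift[OF assms(3,4)] .
  have "lift_on {0..1/2} (p \<circ> (\<lambda>s. 2 * s)) (\<phi> \<circ> (\<lambda>s. 2 * s))"
    by (intro lift_on_reparametrize[OF \<phi>(3)] continuous_intros) auto
  then have 1: "lift_on {0..1/2} (p +++ q) (\<lambda>s. \<phi> (2 * s))"
    by (subst lift_on_cong) (auto simp: joinpaths_def comp_def)
  have "lift_on {1/2..1} (q \<circ> (\<lambda>s. 2 * s - 1)) (\<psi> \<circ> (\<lambda>s. 2 * s - 1))"
    by (intro lift_on_reparametrize[OF \<psi>(3)] continuous_intros) auto
  moreover have "(p +++ q) s = q (2 * s - 1)" if "s \<in> {1/2..1}" for s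
  proof (cases "s = 1/2")
    case True
    show ?thesis using assms(5) unfolding True by (simp add: joinpaths_def pathfinish_def pathstart_def)
  qed (use that in \<open>auto simp: joinpaths_def\<close>)
  ultimately have 2: "lift_on {1/2..1} (p +++ q) (\<lambda>s. \<psi> (2 * s - 1))"
    by (subst lift_on_cong) (auto simp: comp_def)
  have "lift_on {0..1} (p +++ q) (\<lambda>s. if s \<le> 1/2 then \<phi> (2 * s) else \<psi> (2 * s - 1))"
    using 1 2 \<phi> \<psi> by (intro lift_on_glue) auto
  from transport_eqI[OF _ _ this] show ?thesis
    using assms \<phi> \<psi> by (auto simp: path_image_join)
qed

end

section \<open>Paths up to homotopy\<close>

definition paths :: "'a::topological_space set \<Rightarrow> 'a \<Rightarrow> 'a \<Rightarrow> (real \<Rightarrow> 'a) set" where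
  "paths S a b = {p. path p \<and> path_image p \<subseteq> S \<and> pathstart p = a \<and> pathfinish p = b}"

lemma loops_eq_paths: "loops S x = paths S x x"
  by (simp add: loops_def paths_def)

lemma paths_join:
  "p \<in> paths S a b \<Longrightarrow> q \<in> paths S b c \<Longrightarrow> p +++ q \<in> paths S a c"
  by (simp add: paths_def path_image_join)

lemma paths_reversepath:
  "p \<in> paths S a b \<Longrightarrow> reversepath p \<in> paths S b a"
  by (simp add: paths_def)

lemma paths_linepath:
  "closed_segment a b \<subseteq> S \<Longrightarrow> linepath a b \<in> paths S a b"
  by (simp add: paths_def)

lemma paths_mono: "p \<in> paths S a b \<Longrightarrow> S \<subseteq> T \<Longrightarrow> p \<in> paths T a b"
  by (auto simp: paths_def)

lemma paths_homotopic:
  assumes "homotopic_paths S p q" "p \<in> paths S a b"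
  shows "q \<in> paths S a b"
  using assms homotopic_paths_imp_path[OF assms(1)] homotopic_paths_imp_subset[OF assms(1)]
    homotopic_paths_imp_pathstart[OF assms(1)] homotopic_paths_imp_pathfinish[OF assms(1)]
  by (simp add: paths_def)

lemma homotopic_refl: "p \<in> paths S a b \<Longrightarrow> homotopic_paths S p p"
  by (simp add: paths_def)

lemma homotopic_assoc:
  assumes "p \<in> paths S a b" "q \<in> paths S b c" "r \<in> paths S c d"
  shows "homotopic_paths S (p +++ (q +++ r)) ((p +++ q) +++ r)"
  using assms by (intro homotopic_paths_assoc) (auto simp: paths_def)

lemma homotopic_join:
  assumes "homotopic_paths S p p'" "homotopic_paths S q q'" "p \<in> paths S a b" "q \<in> paths S b c"
  shows "homotopic_paths S (p +++ q) (p' +++ q')"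
  using assms by (intro homotopic_paths_join) (auto simp: paths_def)

text \<open>Serves both to multiply two quotients of paths and to cut off a common final
  piece.\<close>

lemma homotopic_cancel:
  fixes S :: "'a::real_normed_vector set"
  assumes s: "\<sigma> \<in> paths S a b" and p: "p \<in> paths S b c" and t: "\<tau> \<in> paths S b d"
  shows "homotopic_paths S ((\<sigma> +++ p) +++ (reversepath p +++ \<tau>)) (\<sigma> +++ \<tau>)"
proof -
  note r = paths_reversepath[OF p]
  note pt = paths_join[OF r t]
  have "homotopic_paths S ((\<sigma> +++ p) +++ (reversepath p +++ \<tau>)) (\<sigma> +++ (p +++ (reversepath p +++ \<tau>)))"
    by (rule homotopic_paths_sym[OF homotopic_assoc[OF s p pt]])
  also have "homotopic_paths S \<dots> (\<sigma> +++ ((p +++ reversepath p) +++ \<tau>))"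
    by (rule homotopic_join[OF homotopic_refl[OF s] homotopic_assoc[OF p r t] s paths_join[OF p pt]])
  also have "homotopic_paths S \<dots> (\<sigma> +++ (linepath b b +++ \<tau>))"
  proof (rule homotopic_join[OF homotopic_refl[OF s] _ s])
    have "homotopic_paths S (p +++ reversepath p) (linepath b b)"
      using homotopic_paths_rinv[of p S] p by (simp add: paths_def)
    then show "homotopic_paths S ((p +++ reversepath p) +++ \<tau>) (linepath b b +++ \<tau>)"
      by (rule homotopic_join[OF _ homotopic_refl[OF t] paths_join[OF p r] t])
    show "(p +++ reversepath p) +++ \<tau> \<in> paths S b d"
      by (rule paths_join[OF paths_join[OF p r] t])
  qed
  also have "homotopic_paths S \<dots> (\<sigma> +++ \<tau>)"
  proof -
    have l: "homotopic_paths S (linepath b b +++ \<tau>) \<tau>"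
      using t by (intro homotopic_paths_lid') (auto simp: paths_def)
    then have "linepath b b +++ \<tau> \<in> paths S b d"
      using paths_homotopic[OF homotopic_paths_sym t] by blast
    then show ?thesis
      by (rule homotopic_join[OF homotopic_refl[OF s] l s])
  qed
  finally show ?thesis .
qed

lemma simply_connected_homotopic:
  fixes C :: "'a::real_normed_vector set"
  assumes "simply_connected C" "C \<subseteq> S" "p \<in> paths C a b" "q \<in> paths C a b"
  shows "homotopic_paths S p q"
proof -
  have "homotopic_paths C p q"
    using assms(1,3,4) unfolding simply_connected_eq_homotopic_paths by (simp add: paths_def)
  then show ?thesis using assms(2) by (rule homotopic_paths_subset)
qed

lemma simply_connected_path:
  fixes C :: "'a::real_normed_vector set"
  assumes "simply_connected C" "a \<in> C" "b \<in> C"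
  obtains p where "p \<in> paths C a b"
  using simply_connected_imp_path_connected[OF assms(1)] assms(2,3)
  unfolding path_connected_def paths_def by fast

locale pi1_subgroup =
  fixes S :: "'a::real_normed_vector set" and x :: 'a and H
  assumes x: "x \<in> S" and H: "subgroup H (pi1 S x)"
begin

text \<open>Equality of the cosets H\<sigma> = H\<tau>, that is, equal endpoints of the lifts to the
  covering that belongs to \<open>H\<close>. A loop has its class in \<open>H\<close> exactly if it
  is related to the constant path.\<close>

definition coset_eq :: "(real \<Rightarrow> 'a) \<Rightarrow> (real \<Rightarrow> 'a) \<Rightarrow> bool" where
  "coset_eq \<sigma> \<tau> \<longleftrightarrow> (\<exists>b. \<sigma> \<in> paths S x b \<and> \<tau> \<in> paths S x b) \<and>
     loop_class S (\<sigma> +++ reversepath \<tau>) \<in> H"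

lemma coset_eqI:
  "\<sigma> \<in> paths S x b \<Longrightarrow> \<tau> \<in> paths S x b \<Longrightarrow>
    loop_class S (\<sigma> +++ reversepath \<tau>) \<in> H \<Longrightarrow> coset_eq \<sigma> \<tau>"
  by (auto simp: coset_eq_def)

lemma coset_eqE:
  assumes "coset_eq \<sigma> \<tau>" "\<sigma> \<in> paths S x b \<or> \<tau> \<in> paths S x b"
  shows "\<sigma> \<in> paths S x b" "\<tau> \<in> paths S x b"
    "\<sigma> +++ reversepath \<tau> \<in> loops S x" "loop_class S (\<sigma> +++ reversepath \<tau>) \<in> H"
proof -
  show *: "\<sigma> \<in> paths S x b" "\<tau> \<in> paths S x b"
    using assms by (auto simp: coset_eq_def paths_def)
  show "\<sigma> +++ reversepath \<tau> \<in> loops S x"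
    unfolding loops_eq_paths by (rule paths_join[OF *(1) paths_reversepath[OF *(2)]])
  show "loop_class S (\<sigma> +++ reversepath \<tau>) \<in> H"
    using assms by (simp add: coset_eq_def)
qed

lemma coset_eq_homotopic:
  assumes "homotopic_paths S \<sigma> \<tau>" "\<sigma> \<in> paths S x b"
  shows "coset_eq \<sigma> \<tau>"
proof (rule coset_eqI[OF assms(2) paths_homotopic[OF assms]])
  note \<tau> = paths_homotopic[OF assms]
  note r = paths_reversepath[OF \<tau>]
  have "homotopic_paths S (\<sigma> +++ reversepath \<tau>) (\<tau> +++ reversepath \<tau>)"
    by (rule homotopic_join[OF assms(1) homotopic_refl[OF r] assms(2) r])
  also have "homotopic_paths S \<dots> (linepath x x)"
    using homotopic_paths_rinv[of \<tau> S] \<tau> by (simp add: paths_def)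
  finally have "loop_class S (\<sigma> +++ reversepath \<tau>) = \<one>\<^bsub>pi1 S x\<^esub>"
    by (simp add: one_pi1 loop_class_eqI)
  then show "loop_class S (\<sigma> +++ reversepath \<tau>) \<in> H"
    using subgroup.one_closed[OF H] by simp
qed

lemma coset_eq_sym:
  assumes "coset_eq \<sigma> \<tau>"
  shows "coset_eq \<tau> \<sigma>"
proof -
  obtain b where b: "\<sigma> \<in> paths S x b" using assms by (auto simp: coset_eq_def)
  note * = coset_eqE[OF assms disjI1[OF b]]
  show ?thesis
  proof (rule coset_eqI[OF *(2,1)])
    have "inv\<^bsub>pi1 S x\<^esub> (loop_class S (\<sigma> +++ reversepath \<tau>)) \<in> H"
      using subgroup.m_inv_closed[OF H *(4)] .
    then show "loop_class S (\<tau> +++ reversepath \<sigma>) \<in> H"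
      using * by (simp add: inv_pi1 x reversepath_joinpaths paths_def)
  qed
qed

lemma coset_eq_trans:
  assumes "coset_eq \<sigma> \<tau>" "coset_eq \<tau> \<upsilon>"
  shows "coset_eq \<sigma> \<upsilon>"
proof -
  obtain b where b: "\<sigma> \<in> paths S x b" using assms by (auto simp: coset_eq_def)
  note 1 = coset_eqE[OF assms(1) disjI1[OF b]]
  note 2 = coset_eqE[OF assms(2) disjI1[OF 1(2)]]
  show ?thesis
  proof (rule coset_eqI[OF 1(1) 2(2)])
    have "homotopic_paths S ((\<sigma> +++ reversepath \<tau>) +++ (\<tau> +++ reversepath \<upsilon>)) (\<sigma> +++ reversepath \<upsilon>)"
      using homotopic_cancel[OF 1(1) paths_reversepath[OF 1(2)] paths_reversepath[OF 2(2)]]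
      by simp
    then have "loop_class S (\<sigma> +++ reversepath \<tau>) \<otimes>\<^bsub>pi1 S x\<^esub> loop_class S (\<tau> +++ reversepath \<upsilon>)
        = loop_class S (\<sigma> +++ reversepath \<upsilon>)"
      using 1 2 by (simp add: mult_pi1 loop_class_eqI)
    then show "loop_class S (\<sigma> +++ reversepath \<upsilon>) \<in> H"
      using subgroup.m_closed[OF H 1(4) 2(4)] by simp
  qed
qed

lemma coset_eq_join:
  assumes "coset_eq \<sigma> \<tau>" "\<sigma> \<in> paths S x b" "p \<in> paths S b c"
  shows "coset_eq (\<sigma> +++ p) (\<tau> +++ p)"
proof -
  note * = coset_eqE[OF assms(1) disjI1[OF assms(2)]]
  show ?thesis
  proof (rule coset_eqI[OF paths_join[OF *(1) assms(3)] paths_join[OF *(2) assms(3)]])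
    have "homotopic_paths S ((\<sigma> +++ p) +++ (reversepath p +++ reversepath \<tau>)) (\<sigma> +++ reversepath \<tau>)"
      by (rule homotopic_cancel[OF *(1) assms(3) paths_reversepath[OF *(2)]])
    then have "loop_class S ((\<sigma> +++ p) +++ reversepath (\<tau> +++ p)) = loop_class S (\<sigma> +++ reversepath \<tau>)"
      using *(2) assms(3) by (simp add: reversepath_joinpaths paths_def loop_class_eqI)
    then show "loop_class S ((\<sigma> +++ p) +++ reversepath (\<tau> +++ p)) \<in> H"
      using *(4) by simp
  qed
qed

end

section \<open>The slit charts of the punctured plane\<close>

text \<open>Chart \<open>0\<close> is the plane cut along the vertical rays going down from the punctures, and
  chart \<open>i\<close> is a strip around the \<open>i\<close>-th ray, cut along the opposite ray.\<close>

definition chart :: "nat \<Rightarrow> nat \<Rightarrow> complex set" where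
  "chart n i = (if i = 0 then {z. 0 < Im z \<or> (\<forall>k\<in>{1..n}. Re z \<noteq> real k)}
     else {z. real i - 1 < Re z \<and> Re z < real i + 1 \<and> (Re z = real i \<longrightarrow> Im z < 0)})"

lemma Sigma_B_iff: "z \<in> Sigma_B n \<longleftrightarrow> (\<forall>k\<in>{1..n}. z \<noteq> of_nat k)"
  by (auto simp: Sigma_B_def)

lemma zero_in_Sigma_B [simp]: "0 \<in> Sigma_B n"
  by (auto simp: Sigma_B_iff)

lemma zero_in_chart_0 [simp]: "0 \<in> chart n 0"
  by (auto simp: chart_def)

lemma chart_subset: "chart n i \<subseteq> Sigma_B n"
proof
  fix z assume z: "z \<in> chart n i"
  show "z \<in> Sigma_B n"
    unfolding Sigma_B_iff
  proof safe
    fix k assume k: "k \<in> {1..n}" "z = of_nat k"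
    then show False
      using z by (cases "i = k") (auto simp: chart_def split: if_splits)
  qed
qed

lemma chart_cover: "Sigma_B n \<subseteq> (\<Union>i\<in>{0..n}. chart n i)"
proof
  fix z assume z: "z \<in> Sigma_B n"
  show "z \<in> (\<Union>i\<in>{0..n}. chart n i)"
  proof (cases "z \<in> chart n 0")
    case False
    then obtain k where k: "k \<in> {1..n}" "Re z = real k" "Im z \<le> 0"
      by (auto simp: chart_def)
    with z have "Im z \<noteq> 0" by (auto simp: Sigma_B_iff complex_eq_iff)
    then have "z \<in> chart n k" using k by (auto simp: chart_def)
    then show ?thesis using k by auto
  qed auto
qed

lemma open_chart: "open (chart n i)"
proof (cases "i = 0")
  case True
  have "chart n 0 = {z. 0 < Im z} \<union> (\<Inter>k\<in>{1..n}. {z. Re z \<noteq> real k})"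
    by (auto simp: chart_def)
  moreover have "open (\<Inter>k\<in>{1..n}. {z. Re z \<noteq> real k})"
    by (intro open_INT ballI open_Collect_neq continuous_intros) auto
  moreover have "open {z. 0 < Im z}"
    by (intro open_Collect_less continuous_intros)
  ultimately show ?thesis using True by auto
next
  case False
  then have "chart n i = {z. real i - 1 < Re z} \<inter> {z. Re z < real i + 1} \<inter> ({z. Re z \<noteq> real i} \<union> {z. Im z < 0})"
    by (auto simp: chart_def)
  then show ?thesis
    by (simp only:) (intro open_Int open_Un open_Collect_less open_Collect_neq continuous_intros)
qed

text \<open>Vertical translation upwards stays in the chart. Translating a loop by more than a bound
  for its norm moves it into the upper half-plane, which is convex.\<close>

lemma simply_connected_chart_0: "simply_connected (chart n 0)"
proof -
  let ?C = "chart n 0" and ?U = "{z. 0 < Im z}"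
  have UC: "?U \<subseteq> ?C" by (auto simp: chart_def)
  have convex: "convex ?U" by (simp add: convex_halfspace_Im_gt)
  have up: "closed_segment z (z + \<i> * of_real K) \<subseteq> ?C" if "z \<in> ?C" "K \<ge> 0" for z K
    using that unfolding closed_segment_def chart_def by (auto simp: algebra_simps)
       (metis add_pos_nonneg mult_nonneg_nonneg)
  have "path_connected ?C"
    unfolding path_connected_component
  proof (intro ballI)
    fix x y assume xy: "x \<in> ?C" "y \<in> ?C"
    define K where "K = \<bar>Im x\<bar> + \<bar>Im y\<bar> + 1"
    have K_nonneg: "0 \<le> K" by (simp add: K_def)
    have "x + \<i> * of_real K \<in> ?U" "y + \<i> * of_real K \<in> ?U" by (auto simp: K_def)
    then have "closed_segment (x + \<i> * of_real K) (y + \<i> * of_real K) \<subseteq> ?C"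
      using convex UC by (meson closed_segment_subset order_trans)
    then have "path_component ?C (x + \<i> * of_real K) (y + \<i> * of_real K)"
      by (rule path_component_linepath)
    moreover have "path_component ?C x (x + \<i> * of_real K)" "path_component ?C y (y + \<i> * of_real K)"
      using xy by (auto intro!: path_component_linepath[OF up] simp: K_nonneg)
    ultimately show "path_component ?C x y"
      by (meson path_component_sym path_component_trans)
  qed
  moreover have "\<exists>a. a \<in> ?C \<and> homotopic_loops ?C p (linepath a a)"
    if p: "path p" "path_image p \<subseteq> ?C" "pathfinish p = pathstart p" for p
  proof -
    have "bounded (path_image p)" using p(1) by (rule bounded_path_image)
    then obtain B where B: "\<And>z. z \<in> path_image p \<Longrightarrow> cmod z \<le> B" unfolding bounded_iff by blast
    define q where "q t = p t + \<i> * of_real (\<bar>B\<bar> + 1)" for t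
    have q: "path q" using p(1) unfolding q_def path_def by (intro continuous_intros)
    have pim: "p t \<in> path_image p" if "t \<in> {0..1}" for t
      using that by (auto simp: path_image_def)
    have "homotopic_loops ?C p q"
    proof (rule homotopic_loops_linear[OF p(1) q p(3)])
      show "pathfinish q = pathstart q" using p(3) by (simp add: q_def pathfinish_def pathstart_def)
      show "closed_segment (p t) (q t) \<subseteq> ?C" if "t \<in> {0..1}" for t
        unfolding q_def using pim[OF that] p(2) by (intro up) auto
    qed
    moreover have "path_image q \<subseteq> ?U"
    proof -
      have "0 < Im (q t)" if "t \<in> {0..1}" for t
        using B[OF pim[OF that]] abs_Im_le_cmod[of "p t"] by (auto simp: q_def)
      then show ?thesis by (auto simp: path_image_def)
    qed
    then have "homotopic_loops ?U q (linepath \<i> \<i>)"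
      using convex_imp_simply_connected[OF convex] q p(3)
      unfolding simply_connected_eq_contractible_loop_any by (simp add: q_def pathfinish_def pathstart_def)
    then have "homotopic_loops ?C q (linepath \<i> \<i>)"
      using UC by (rule homotopic_loops_subset)
    ultimately have "homotopic_loops ?C p (linepath \<i> \<i>)" by (rule homotopic_loops_trans)
    moreover have "\<i> \<in> ?C" using UC by auto
    ultimately show ?thesis by blast
  qed
  ultimately show ?thesis
    unfolding simply_connected_eq_contractible_loop_some by blast
qed


lemma simply_connected_chart: "simply_connected (chart n i)"
proof (cases "i = 0")
  case True
  then show ?thesis by (simp add: simply_connected_chart_0)
next
  case False
  have "starlike (chart n i)"
    unfolding starlike_def
  proof (intro bexI ballI subsetI)
    \<comment> \<open>The star centre lies on the \<open>i\<close>-th ray itself, opposite to the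
      cut of the strip.\<close>
    show "of_nat i - \<i> \<in> chart n i" using False by (simp add: chart_def)
    fix z y assume z: "z \<in> chart n i" and "y \<in> closed_segment (of_nat i - \<i>) z"
    then obtain t where t: "0 \<le> t" "t \<le> 1" and y: "y = (1 - t) *\<^sub>R (of_nat i - \<i>) + t *\<^sub>R z"
      unfolding closed_segment_def by blast
    have Re: "Re y - real i = t * (Re z - real i)" by (simp add: y algebra_simps)
    have Im: "Im y = t * Im z - (1 - t)" by (simp add: y algebra_simps)
    have zz: "\<bar>Re z - real i\<bar> < 1" "Re z = real i \<Longrightarrow> Im z < 0" using z False by (auto simp: chart_def)
    have "\<bar>Re y - real i\<bar> \<le> 1 * \<bar>Re z - real i\<bar>"
      unfolding Re abs_mult using t by (intro mult_right_mono) auto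
    moreover have "Im y < 0" if "Re y = real i"
    proof (cases "t = 0")
      case False
      then have "Im z < 0" using that Re zz(2) by auto
      then have "t * Im z < 0" using t False by (intro mult_pos_neg) auto
      then show ?thesis using t Im by linarith
    qed (use Im in auto)
    ultimately show "y \<in> chart n i" using zz(1) False by (auto simp: chart_def abs_less_iff)
  qed
  then show ?thesis by (rule starlike_imp_simply_connected)
qed

text \<open>A point on the k-th ray can lie only in chart k, so overlaps avoid the rays. Chart i
  contains no point above its puncture either, which leaves \<open>Re z\<close> different from i;
  this makes the transitions locally constant.\<close>

lemma chart_overlap:
  assumes "z \<in> chart n i" "z \<in> chart n j" "i \<noteq> j" "i \<le> n" "j \<le> n"
  shows "z \<in> chart n 0" "i \<noteq> 0 \<Longrightarrow> Re z \<noteq> real i"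
proof -
  have *: "Re z \<noteq> real k" if "k \<in> {1..n}" "Im z \<le> 0" for k
  proof
    assume k: "Re z = real k"
    have "i = k \<or> i = 0" "j = k \<or> j = 0" using k assms(1,2) by (auto simp: chart_def split: if_splits)
    then have "i = 0 \<or> j = 0" using assms(3) by auto
    then show False using assms(1,2) that k by (auto simp: chart_def split: if_splits)
  qed
  show "z \<in> chart n 0"
  proof (rule ccontr)
    assume "z \<notin> chart n 0"
    then obtain k where "k \<in> {1..n}" "Re z = real k" "Im z \<le> 0" by (auto simp: chart_def not_less)
    then show False using * by blast
  qed
  show "Re z \<noteq> real i" if "i \<noteq> 0"
    using *[of i] assms(1,4) that by (auto simp: chart_def split: if_splits)
qed


section \<open>Generation by the loops around the punctures\<close>

text \<open>A parity argument. Half-integral abscissas keep anchor points and vertical box edges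
  away from all rays.\<close>

lemma half_integer: "real i - 1/2 \<noteq> real k" "real i + 1/2 \<noteq> real k"
proof -
  have "2 * i \<noteq> 2 * k + 1" "2 * i + 1 \<noteq> 2 * k" by presburger+
  then have "real (2 * i) \<noteq> real (2 * k + 1)" "real (2 * i + 1) \<noteq> real (2 * k)"
    unfolding of_nat_eq_iff .
  then show "real i - 1/2 \<noteq> real k" "real i + 1/2 \<noteq> real k" by auto
qed

text \<open>The points where the circle of \<open>gamma i\<close> meets the real axis.
  \<open>right_of i\<close> is also the centre of the half twist of i and i+1.\<close>

definition left_of :: "nat \<Rightarrow> complex" where "left_of i = of_nat i - 1/2"
definition right_of :: "nat \<Rightarrow> complex" where "right_of i = of_nat i + 1/2"

lemma left_right_of_sel [simp]:
  "Re (left_of i) = real i - 1/2" "Im (left_of i) = 0"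
  "Re (right_of i) = real i + 1/2" "Im (right_of i) = 0"
  by (simp_all add: left_of_def right_of_def)

text \<open>The angles from pi to 2 pi form the lower arc, which lies in the strip of the i-th ray;
  the two upper quarter arcs lie in chart 0 and are joined to the tails. The counterclockwise loop
  thus crosses only its own ray, from left to right.\<close>

lemma gamma_decomposition:
  assumes "i \<in> {1..n}"
  obtains c1 c2 c3 where "c1 \<in> paths (chart n 0) 0 (left_of i)"
    "c2 \<in> paths (chart n i) (left_of i) (right_of i)"
    "c3 \<in> paths (chart n 0) (right_of i) 0"
    "homotopic_paths (Sigma_B n) (gamma i) ((c1 +++ c2) +++ c3)"
proof -
  define tail where "tail = linepath 0 (of_nat i + \<i> / 2)"
  define arc where "arc = part_circlepath (of_nat i) (1/2)"
  have \<gamma>: "gamma i = tail +++ (arc (pi/2) (pi/2 + 2 * pi) +++ reversepath tail)"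
    by (simp add: gamma_def tail_def arc_def)
  have tail: "tail \<in> paths (chart n 0) 0 (of_nat i + \<i> / 2)"
    unfolding tail_def by (intro paths_linepath) (auto simp: closed_segment_def chart_def)
  have ends: "cis (pi/2) = \<i>" "cis pi = -1" "cis (2 * pi) = 1" "cis (pi/2 + 2 * pi) = \<i>"
  proof -
    have "cis (pi/2 + 2 * pi) = cis (pi/2) * cis (2 * pi)" by (rule cis_mult[symmetric])
    also have "\<dots> = \<i>" by simp
    finally show "cis (pi/2 + 2 * pi) = \<i>" .
  qed simp_all
  have arcI: "arc s t \<in> paths C (of_nat i + (1/2) * cis s) (of_nat i + (1/2) * cis t)"
    if "s \<le> t" "\<And>x. s \<le> x \<Longrightarrow> x \<le> t \<Longrightarrow> of_nat i + (1/2) * cis x \<in> C" for s t C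
    using that unfolding arc_def paths_def
    by (auto simp: path_image_part_circlepath' closed_segment_eq_real_ivl cis_conv_exp[symmetric])
  have k1: "arc (pi/2) pi \<in> paths (chart n 0) (of_nat i + \<i> / 2) (left_of i)"
  proof -
    \<comment> \<open>At the angle pi the point is on the real axis, where chart 0 requires a real
      part different from the punctures; before that the sine is positive.\<close>
    have *: "of_nat i + (1/2) * cis x \<in> chart n 0" if "pi/2 \<le> x" "x \<le> pi" for x
    proof (cases "x = pi")
      case True
      then show ?thesis using half_integer(1) by (auto simp: chart_def)
    next
      case False
      then have "0 < sin x" using that pi_gt_zero by (intro sin_gt_zero) linarith+
      then show ?thesis by (simp add: chart_def)
    qed
    have "arc (pi/2) (pi) \<in> paths (chart n 0) (of_nat i + (1/2) * cis (pi/2)) (of_nat i + (1/2) * cis (pi))"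
      by (rule arcI) (use * pi_gt_zero in auto)
    then show ?thesis unfolding ends by (simp add: left_of_def)
  qed
  have k3: "arc (2 * pi) (pi/2 + 2 * pi) \<in> paths (chart n 0) (right_of i) (of_nat i + \<i> / 2)"
  proof -
    have *: "of_nat i + (1/2) * cis x \<in> chart n 0" if "2 * pi \<le> x" "x \<le> pi/2 + 2 * pi" for x
    proof (cases "x = 2 * pi")
      case True
      then show ?thesis using half_integer(2) by (auto simp: chart_def)
    next
      case False
      then have "0 < sin (x - 2 * pi)" using that pi_gt_zero by (intro sin_gt_zero) linarith+
      then show ?thesis by (simp add: chart_def sin_diff)
    qed
    have "arc (2 * pi) (pi/2 + 2 * pi) \<in> paths (chart n 0) (of_nat i + (1/2) * cis (2 * pi)) (of_nat i + (1/2) * cis (pi/2 + 2 * pi))"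
      by (rule arcI) (use * pi_gt_zero in auto)
    then show ?thesis unfolding ends by (simp add: right_of_def)
  qed
  have k2: "arc pi (2 * pi) \<in> paths (chart n i) (left_of i) (right_of i)"
  proof -
    have *: "of_nat i + (1/2) * cis x \<in> chart n i" if "pi \<le> x" "x \<le> 2 * pi" for x
    proof -
      have "sin x \<le> 0"
        using that sin_ge_zero[of "x - pi"] by (simp add: sin_diff)
      moreover have "sin x \<noteq> 0" if "cos x = 0" using that sin_cos_squared_add[of x] by auto
      ultimately show ?thesis using assms by (auto simp: chart_def less_le)
         (smt (verit) cos_ge_minus_one cos_le_one)+
    qed
    have "arc (pi) (2 * pi) \<in> paths (chart n i) (of_nat i + (1/2) * cis (pi)) (of_nat i + (1/2) * cis (2 * pi))"
      by (rule arcI) (use * pi_gt_zero in auto)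
    then show ?thesis unfolding ends by (simp add: right_of_def left_of_def)
  qed
  note sub = paths_mono[OF _ chart_subset]
  note t = sub[OF tail] and t' = paths_reversepath[OF sub[OF tail]]
    and s1 = sub[OF k1] and s2 = sub[OF k2] and s3 = sub[OF k3]
  note s12 = paths_join[OF s1 s2]
  note s123 = paths_join[OF s12 s3]
  have split: "homotopic_paths (Sigma_B n) (arc (pi/2) (pi/2 + 2 * pi))
      ((arc (pi/2) pi +++ arc pi (2 * pi)) +++ arc (2 * pi) (pi/2 + 2 * pi))"
  proof -
    let ?A = "arc (pi/2) (pi/2 + 2 * pi)"
    have A: "path ?A" "path_image ?A \<subseteq> Sigma_B n"
    proof -
      show "path ?A" by (simp add: arc_def)
      have "path_image ?A = path_image (arc (pi/2) pi) \<union> path_image (arc pi (2 * pi)) \<union> path_image (arc (2 * pi) (pi/2 + 2 * pi))"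
        unfolding arc_def path_image_part_circlepath' image_Un[symmetric]
        by (rule arg_cong[of _ _ "image _"]) (auto simp: closed_segment_eq_real_ivl)
      then show "path_image ?A \<subseteq> Sigma_B n"
        using s1 s2 s3 by (auto simp: paths_def)
    qed
    \<comment> \<open>The angle is pi/2 plus 2 pi times the parameter, so pi and 2 pi are reached at
      the parameters 1/4 and 3/4.\<close>
    have l: "linepath (pi/2) pi x = linepath (pi/2) (pi/2 + 2 * pi) ((1/4 - 0) * x + 0)"
      "linepath pi (2 * pi) x = linepath (pi/2) (pi/2 + 2 * pi) ((3/4 - 1/4) * x + 1/4)"
      "linepath (2 * pi) (pi/2 + 2 * pi) x = linepath (pi/2) (pi/2 + 2 * pi) ((1 - 3/4) * x + 3/4)" for x
      by (simp_all add: linepath_def field_simps)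
    have e: "arc (pi/2) pi = subpath 0 (1/4) ?A" "arc pi (2 * pi) = subpath (1/4) (3/4) ?A"
      "arc (2 * pi) (pi/2 + 2 * pi) = subpath (3/4) 1 ?A"
      unfolding arc_def part_circlepath_def subpath_def by (simp_all only: l)
    have "homotopic_paths (Sigma_B n) (arc (pi/2) pi +++ arc pi (2 * pi)) (subpath 0 (3/4) ?A)"
      unfolding e by (intro homotopic_join_subpaths A) auto
    then have "homotopic_paths (Sigma_B n) ((arc (pi/2) pi +++ arc pi (2 * pi)) +++ arc (2 * pi) (pi/2 + 2 * pi))
        (subpath 0 (3/4) ?A +++ arc (2 * pi) (pi/2 + 2 * pi))"
      by (rule homotopic_join[OF _ homotopic_refl[OF s3] s12 s3])
    also have "homotopic_paths (Sigma_B n) \<dots> (subpath 0 1 ?A)"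
      unfolding e by (intro homotopic_join_subpaths A) auto
    finally show ?thesis by (simp add: homotopic_paths_sym)
  qed
  have "homotopic_paths (Sigma_B n) (gamma i)
      (tail +++ (((arc (pi/2) pi +++ arc pi (2 * pi)) +++ arc (2 * pi) (pi/2 + 2 * pi)) +++ reversepath tail))"
    unfolding \<gamma>
    using homotopic_join[OF split homotopic_refl[OF t'] paths_homotopic[OF homotopic_paths_sym[OF split] s123] t']
    by (intro homotopic_join[OF homotopic_refl[OF t] _ t
          paths_join[OF paths_homotopic[OF homotopic_paths_sym[OF split] s123] t']])
  also have "homotopic_paths (Sigma_B n) \<dots>
      (tail +++ ((arc (pi/2) pi +++ arc pi (2 * pi)) +++ (arc (2 * pi) (pi/2 + 2 * pi) +++ reversepath tail)))"
    by (rule homotopic_join[OF homotopic_refl[OF t] homotopic_paths_sym[OF homotopic_assoc[OF s12 s3 t']] t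
          paths_join[OF s123 t']])
  also have "homotopic_paths (Sigma_B n) \<dots>
      ((tail +++ (arc (pi/2) pi +++ arc pi (2 * pi))) +++ (arc (2 * pi) (pi/2 + 2 * pi) +++ reversepath tail))"
    by (rule homotopic_assoc[OF t s12 paths_join[OF s3 t']])
  also have "homotopic_paths (Sigma_B n) \<dots>
      (((tail +++ arc (pi/2) pi) +++ arc pi (2 * pi)) +++ (arc (2 * pi) (pi/2 + 2 * pi) +++ reversepath tail))"
    using paths_join[OF s3 t']
    by (intro homotopic_join[OF homotopic_assoc[OF t s1 s2] homotopic_refl paths_join[OF t s12]])
  finally show ?thesis
    by (rule that[OF paths_join[OF tail k1] k2 paths_join[OF k3 paths_reversepath[OF tail]]])
qed

lemma gamma_in_loops: "i \<in> {1..n} \<Longrightarrow> gamma i \<in> loops (Sigma_B n) 0"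
proof -
  assume "i \<in> {1..n}"
  then obtain c1 c2 c3 where c: "c1 \<in> paths (chart n 0) 0 (left_of i)"
    "c2 \<in> paths (chart n i) (left_of i) (right_of i)"
    "c3 \<in> paths (chart n 0) (right_of i) 0"
    and h: "homotopic_paths (Sigma_B n) (gamma i) ((c1 +++ c2) +++ c3)"
    by (rule gamma_decomposition)
  note sub = paths_mono[OF _ chart_subset]
  show ?thesis
    unfolding loops_eq_paths
    by (rule paths_homotopic[OF homotopic_paths_sym[OF h]
          paths_join[OF paths_join[OF sub[OF c(1)] sub[OF c(2)]] sub[OF c(3)]]])
qed

text \<open>Strips are entered on the left of their rays, so reaching the right side through the
  strip costs one crossing.\<close>

definition anchor :: "nat \<Rightarrow> complex" where "anchor i = (if i = 0 then 0 else left_of i)"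

lemma anchor_in_chart: "anchor i \<in> chart n 0" "anchor i \<in> chart n i"
  using half_integer(1) by (auto simp: anchor_def chart_def)

text \<open>A standard path to \<open>z\<close> through chart \<open>i\<close>, unique up to
  homotopy since both of its pieces lie in simply connected charts.\<close>

definition base_path :: "nat \<Rightarrow> nat \<Rightarrow> complex \<Rightarrow> (real \<Rightarrow> complex) \<Rightarrow> bool" where
  "base_path n i z b \<longleftrightarrow> (\<exists>b1 b2. b1 \<in> paths (chart n 0) 0 (anchor i) \<and>
     b2 \<in> paths (chart n i) (anchor i) z \<and> homotopic_paths (Sigma_B n) b (b1 +++ b2))"

lemma base_path_paths:
  assumes "base_path n i z b"
  shows "b \<in> paths (Sigma_B n) 0 z"
proof -
  obtain b1 b2 where "b1 \<in> paths (chart n 0) 0 (anchor i)" "b2 \<in> paths (chart n i) (anchor i) z"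
    and h: "homotopic_paths (Sigma_B n) b (b1 +++ b2)"
    using assms unfolding base_path_def by blast
  then have "b1 +++ b2 \<in> paths (Sigma_B n) 0 z"
    by (intro paths_join) (auto intro: paths_mono[OF _ chart_subset])
  then show ?thesis by (rule paths_homotopic[OF homotopic_paths_sym[OF h]])
qed

lemma base_path_exists:
  assumes "z \<in> chart n i"
  obtains b where "base_path n i z b"
proof -
  obtain b1 where b1: "b1 \<in> paths (chart n 0) 0 (anchor i)"
    using simply_connected_path[OF simply_connected_chart zero_in_chart_0 anchor_in_chart(1)] .
  obtain b2 where b2: "b2 \<in> paths (chart n i) (anchor i) z"
    using simply_connected_path[OF simply_connected_chart anchor_in_chart(2) assms] .
  note sub = paths_mono[OF _ chart_subset]
  have "base_path n i z (b1 +++ b2)"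
    unfolding base_path_def using b1 b2 homotopic_refl[OF paths_join[OF sub[OF b1] sub[OF b2]]] by blast
  then show ?thesis by (rule that)
qed

lemma base_path_extend:
  assumes "base_path n i z b" "q \<in> paths (chart n i) z z'"
  shows "base_path n i z' (b +++ q)"
proof -
  obtain b1 b2 where b: "b1 \<in> paths (chart n 0) 0 (anchor i)" "b2 \<in> paths (chart n i) (anchor i) z"
    and h: "homotopic_paths (Sigma_B n) b (b1 +++ b2)"
    using assms unfolding base_path_def by blast
  note sub = paths_mono[OF _ chart_subset]
  note q = sub[OF assms(2)]
  have "homotopic_paths (Sigma_B n) (b +++ q) ((b1 +++ b2) +++ q)"
    by (rule homotopic_join[OF h homotopic_refl[OF q] base_path_paths[OF assms(1)] q])
  also have "homotopic_paths (Sigma_B n) \<dots> (b1 +++ (b2 +++ q))"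
    by (rule homotopic_paths_sym[OF homotopic_assoc[OF sub[OF b(1)] sub[OF b(2)] q]])
  finally show ?thesis
    unfolding base_path_def using b(1) paths_join[OF b(2) assms(2)] by blast
qed

lemma base_path_same_chart:
  assumes "base_path n i z b" "base_path n i z b'"
  shows "homotopic_paths (Sigma_B n) b b'"
proof -
  note sub = paths_mono[OF _ chart_subset]
  note sc = simply_connected_homotopic[OF simply_connected_chart chart_subset]
  obtain b1 b2 where b: "b1 \<in> paths (chart n 0) 0 (anchor i)" "b2 \<in> paths (chart n i) (anchor i) z"
    and h: "homotopic_paths (Sigma_B n) b (b1 +++ b2)"
    using assms unfolding base_path_def by blast
  obtain b1' b2' where b': "b1' \<in> paths (chart n 0) 0 (anchor i)" "b2' \<in> paths (chart n i) (anchor i) z"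
    and h': "homotopic_paths (Sigma_B n) b' (b1' +++ b2')"
    using assms unfolding base_path_def by blast
  note h
  also have "homotopic_paths (Sigma_B n) (b1 +++ b2) (b1' +++ b2')"
    by (rule homotopic_join[OF sc[OF b(1) b'(1)] sc[OF b(2) b'(2)] sub[OF b(1)] sub[OF b(2)]])
  also note homotopic_paths_sym[OF h']
  finally show ?thesis .
qed

locale gamma_subgroup = pi1_subgroup "Sigma_B n" 0 H for n H +
  assumes gamma_in_H: "i \<in> {1..n} \<Longrightarrow> loop_class (Sigma_B n) (gamma i) \<in> H"
begin

text \<open>The overlap of the strip with chart 0 has a left and a right part. On the left the two
  paths are homotopic; on the right their quotient is the loop \<open>gamma i\<close>.\<close>

lemma base_path_0_coset_eq:
  assumes i: "i \<in> {1..n}" and b: "base_path n i z b" and b0: "base_path n 0 z b0" and z: "z \<in> chart n i" "z \<in> chart n 0"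
  shows "coset_eq b b0"
proof -
  note sub = paths_mono[OF _ chart_subset]
  note sc = simply_connected_homotopic[OF simply_connected_chart chart_subset]
  have i0: "i \<noteq> 0" using i by simp
  obtain b1 b2 where b12: "b1 \<in> paths (chart n 0) 0 (left_of i)" "b2 \<in> paths (chart n i) (left_of i) z"
    and h: "homotopic_paths (Sigma_B n) b (b1 +++ b2)"
    using b i0 unfolding base_path_def anchor_def by auto
  obtain d1 d2 where d: "d1 \<in> paths (chart n 0) 0 0" "d2 \<in> paths (chart n 0) 0 z"
    and hd: "homotopic_paths (Sigma_B n) b0 (d1 +++ d2)"
    using b0 unfolding base_path_def anchor_def by auto
  define d where "d = d1 +++ d2"
  have d: "d \<in> paths (chart n 0) 0 z" unfolding d_def using d by (intro paths_join)
  have hd: "homotopic_paths (Sigma_B n) b0 d" using hd unfolding d_def .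
  note b0' = base_path_paths[OF b0] and b' = base_path_paths[OF b]
  have "Re z \<noteq> real i" using chart_overlap(2)[OF z i0] i i0 by simp
  then consider "Re z < real i" | "Re z > real i" by linarith
  then show ?thesis
  proof cases
    case 1
    have l: "linepath (left_of i) z \<in> paths (chart n i \<inter> chart n 0) (left_of i) z"
    proof (rule paths_linepath)
      have "convex {z. real i - 1 < Re z \<and> Re z < real i}"
        using convex_Int[OF convex_halfspace_Re_gt[of "real i - 1"] convex_halfspace_Re_lt[of "real i"]]
        by (simp add: Collect_conj_eq)
      then have "closed_segment (left_of i) z \<subseteq> {z. real i - 1 < Re z \<and> Re z < real i}"
        using 1 z i0 by (intro closed_segment_subset) (auto simp: chart_def)
      also have "\<dots> \<subseteq> chart n i \<inter> chart n 0"
        by (auto simp: chart_def)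
      finally show "closed_segment (left_of i) z \<subseteq> chart n i \<inter> chart n 0" .
    qed
    note l1 = paths_mono[OF l Int_lower1] and l2 = paths_mono[OF l Int_lower2]
    note h
    also have "homotopic_paths (Sigma_B n) (b1 +++ b2) (b1 +++ linepath (left_of i) z)"
      by (rule homotopic_join[OF homotopic_refl[OF sub[OF b12(1)]] sc[OF b12(2) l1] sub[OF b12(1)] sub[OF b12(2)]])
    also have "homotopic_paths (Sigma_B n) \<dots> d"
      by (rule sc[OF paths_join[OF b12(1) l2] d])
    also note homotopic_paths_sym[OF hd]
    finally show ?thesis using b' by (rule coset_eq_homotopic)
  next
    case 2
    have l: "linepath (right_of i) z \<in> paths (chart n i \<inter> chart n 0) (right_of i) z"
    proof (rule paths_linepath)
      have "convex {z. real i < Re z \<and> Re z < real i + 1}"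
        using convex_Int[OF convex_halfspace_Re_gt[of "real i"] convex_halfspace_Re_lt[of "real i + 1"]]
        by (simp add: Collect_conj_eq)
      then have "closed_segment (right_of i) z \<subseteq> {z. real i < Re z \<and> Re z < real i + 1}"
        using 2 z i0 by (intro closed_segment_subset) (auto simp: chart_def)
      also have "\<dots> \<subseteq> chart n i \<inter> chart n 0"
        by (auto simp: chart_def)
      finally show "closed_segment (right_of i) z \<subseteq> chart n i \<inter> chart n 0" .
    qed
    note l1 = paths_mono[OF l Int_lower1] and l2 = paths_mono[OF l Int_lower2]
    let ?l = "linepath (right_of i) z"
    obtain c1 c2 c3 where c: "c1 \<in> paths (chart n 0) 0 (left_of i)"
      "c2 \<in> paths (chart n i) (left_of i) (right_of i)"
      "c3 \<in> paths (chart n 0) (right_of i) 0"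
      and hc: "homotopic_paths (Sigma_B n) (gamma i) ((c1 +++ c2) +++ c3)"
      using gamma_decomposition[OF i] .
    have 1: "homotopic_paths (Sigma_B n) b ((c1 +++ c2) +++ ?l)"
    proof -
      note h
      also have "homotopic_paths (Sigma_B n) (b1 +++ b2) (c1 +++ (c2 +++ ?l))"
        by (rule homotopic_join[OF sc[OF b12(1) c(1)] sc[OF b12(2) paths_join[OF c(2) l1]] sub[OF b12(1)] sub[OF b12(2)]])
      also have "homotopic_paths (Sigma_B n) \<dots> ((c1 +++ c2) +++ ?l)"
        by (rule homotopic_assoc[OF sub[OF c(1)] sub[OF c(2)] sub[OF l1]])
      finally show ?thesis .
    qed
    have 2: "homotopic_paths (Sigma_B n) (reversepath b0) (reversepath ?l +++ c3)"
    proof -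
      have "homotopic_paths (Sigma_B n) (reversepath b0) (reversepath d)"
        using hd by (simp add: homotopic_paths_reversepath)
      also have "homotopic_paths (Sigma_B n) \<dots> (reversepath ?l +++ c3)"
        by (rule sc[OF paths_reversepath[OF d] paths_join[OF paths_reversepath[OF l2] c(3)]])
      finally show ?thesis .
    qed
    have "homotopic_paths (Sigma_B n) (b +++ reversepath b0) (((c1 +++ c2) +++ ?l) +++ (reversepath ?l +++ c3))"
      by (rule homotopic_join[OF 1 2 b' paths_reversepath[OF b0']])
    also have "homotopic_paths (Sigma_B n) \<dots> ((c1 +++ c2) +++ c3)"
      by (rule homotopic_cancel[OF paths_join[OF sub[OF c(1)] sub[OF c(2)]] sub[OF l1] sub[OF c(3)]])
    also note homotopic_paths_sym[OF hc]
    finally have "loop_class (Sigma_B n) (b +++ reversepath b0) \<in> H"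
      using gamma_in_H[OF i] by (simp add: loop_class_eqI)
    with b' b0' show ?thesis by (rule coset_eqI)
  qed
qed

lemma base_path_coset_eq:
  assumes "i \<in> {0..n}" "j \<in> {0..n}" "base_path n i z b" "base_path n j z b'" "z \<in> chart n i" "z \<in> chart n j"
  shows "coset_eq b b'"
proof (cases "i = j")
  case True
  then show ?thesis
    using assms by (intro coset_eq_homotopic[OF base_path_same_chart[of n i z]] base_path_paths) auto
next
  case False
  then have z0: "z \<in> chart n 0" using chart_overlap(1)[OF assms(5,6)] assms(1,2) by auto
  obtain b0 where b0: "base_path n 0 z b0" using base_path_exists[OF z0] .
  have *: "coset_eq c b0" if "k \<in> {0..n}" "base_path n k z c" "z \<in> chart n k" for k c
  proof (cases "k = 0")
    case True
    then show ?thesis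
      using that b0 by (intro coset_eq_homotopic[OF base_path_same_chart[of n 0 z]] base_path_paths) auto
  next
    case False
    then show ?thesis using base_path_0_coset_eq[of k z c b0] that b0 z0 by auto
  qed
  show ?thesis
    using *[OF assms(1,3,5)] coset_eq_sym[OF *[OF assms(2,4,6)]] by (rule coset_eq_trans)
qed

text \<open>The invariant \<open>K t\<close> puts the part of the loop up to \<open>t\<close> into
  the same coset as every standard path to \<open>p t\<close>. It is carried along by
  \<open>Bolzano\<close>, and at the end of the loop the constant path is standard.\<close>

lemma loop_class_in_H:
  assumes p: "p \<in> loops (Sigma_B n) 0"
  shows "loop_class (Sigma_B n) p \<in> H"
proof -
  have path: "path p" "path_image p \<subseteq> Sigma_B n" "pathstart p = 0" "pathfinish p = 0"
    using p by (auto simp: loops_def)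
  have im: "p t \<in> Sigma_B n" if "t \<in> {0..1}" for t
    using that path(2) by (auto simp: path_image_def)
  have sp: "subpath u v p \<in> paths (Sigma_B n) (p u) (p v)" if "u \<in> {0..1}" "v \<in> {0..1}" for u v
    using that path path_image_subpath_subset[OF that, of p] unfolding paths_def by auto
  define K where "K t \<longleftrightarrow> (\<forall>i\<in>{0..n}. p t \<in> chart n i \<longrightarrow>
      (\<forall>b. base_path n i (p t) b \<longrightarrow> coset_eq (subpath 0 t p) b))" for t
  define P where "P u v \<longleftrightarrow> (0 \<le> u \<longrightarrow> u \<le> v \<longrightarrow> v \<le> 1 \<longrightarrow> K u \<longrightarrow> K v)" for u v
  have "(0::real) \<le> 1" by simp
  then have "P 0 1"
  proof (induction rule: Bolzano)
    case (trans a b c)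
    then show ?case unfolding P_def by auto
  next
    case (local s)
    then have s: "s \<in> {0..1}" by simp
    then obtain i where i: "i \<in> {0..n}" "p s \<in> chart n i" using im chart_cover by blast
    obtain M where M: "open M" "s \<in> M" "\<And>y. y \<in> {0..1} \<Longrightarrow> y \<in> M \<Longrightarrow> p y \<in> chart n i"
      using path(1)[unfolded path_def continuous_on_topological, rule_format, OF s open_chart i(2)] by auto
    obtain d where d: "d > 0" "\<And>y. \<bar>y - s\<bar> < d \<Longrightarrow> y \<in> M"
      using M(1,2) unfolding open_dist dist_real_def by blast
    have "P u v" if uv: "u \<le> s" "s \<le> v" "v - u < d" for u v
      unfolding P_def
    proof (intro impI)
      assume uv': "0 \<le> u" "u \<le> v" "v \<le> 1" and Ku: "K u"
      have u: "u \<in> {0..1}" and v: "v \<in> {0..1}" using uv' by auto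
      have inC: "p y \<in> chart n i" if "y \<in> {u..v}" for y
        using that uv uv' by (intro M(3) d(2)) auto
      have q: "subpath u v p \<in> paths (chart n i) (p u) (p v)"
        using sp[OF u v] inC uv' by (auto simp: paths_def path_image_subpath)
      obtain b where b: "base_path n i (p u) b" using base_path_exists[OF inC[of u]] uv' by auto
      then have "coset_eq (subpath 0 u p) b"
        using Ku i(1) inC[of u] uv' unfolding K_def by auto
      moreover have s0: "subpath 0 u p \<in> paths (Sigma_B n) 0 (p u)"
        using sp[of 0 u] u path(3) by (simp add: pathstart_def)
      ultimately have 1: "coset_eq (subpath 0 u p +++ subpath u v p) (b +++ subpath u v p)"
        using sp[OF u v] by (intro coset_eq_join)
      have "homotopic_paths (Sigma_B n) (subpath 0 u p +++ subpath u v p) (subpath 0 v p)"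
        using u v path by (intro homotopic_join_subpaths) auto
      then have 2: "coset_eq (subpath 0 v p) (subpath 0 u p +++ subpath u v p)"
        using paths_join[OF s0 sp[OF u v]] by (rule coset_eq_sym[OF coset_eq_homotopic])
      show "K v"
        unfolding K_def
      proof (intro ballI impI allI)
        fix j b' assume j: "j \<in> {0..n}" "p v \<in> chart n j" "base_path n j (p v) b'"
        have "coset_eq (b +++ subpath u v p) b'"
          using base_path_coset_eq[OF i(1) j(1) base_path_extend[OF b q] j(3)] inC[of v] uv' j(2) by auto
        then show "coset_eq (subpath 0 v p) b'"
          using 1 2 coset_eq_trans by blast
      qed
    qed
    then show ?case using d(1) by blast
  qed
  have const: "base_path n 0 0 (linepath 0 0)"
  proof -
    have l: "linepath 0 0 \<in> paths (chart n 0) 0 0"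
      by (intro paths_linepath) simp
    have "homotopic_paths (Sigma_B n) (linepath 0 0 +++ linepath 0 0) (linepath 0 0)"
      by (intro homotopic_paths_lid') auto
    then show ?thesis
      unfolding base_path_def anchor_def using l homotopic_paths_sym by (auto intro!: exI[of _ "linepath 0 0"])
  qed
  have "K 0"
    unfolding K_def
  proof (intro ballI impI allI)
    fix i b assume i: "i \<in> {0..n}" "p 0 \<in> chart n i" "base_path n i (p 0) b"
    have "subpath 0 0 p = linepath 0 0"
      using path(3) by (auto simp: subpath_def linepath_def pathstart_def fun_eq_iff)
    then show "coset_eq (subpath 0 0 p) b"
      using base_path_coset_eq[OF _ i(1) const, of b] i path(3) by (simp add: pathstart_def)
  qed
  with \<open>P 0 1\<close> have "K 1" by (simp add: P_def)
  then have "coset_eq p (linepath 0 0)"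
    using const path(4) unfolding K_def by (auto simp: pathfinish_def dest!: bspec[of _ _ 0])
  from coset_eqE(4)[OF this, of 0] have "loop_class (Sigma_B n) (p +++ linepath 0 0) \<in> H"
    using p by (simp add: loops_eq_paths)
  moreover have "homotopic_paths (Sigma_B n) (p +++ linepath 0 0) p"
    using path by (intro homotopic_paths_rid') auto
  ultimately show ?thesis by (simp add: loop_class_eqI)
qed

end

section \<open>The fundamental group of the punctured plane is free\<close>

text \<open>Labels on the left of the i-th ray are shifted by u_i, so a path in the strip that
  passes from left to right changes the fibre coordinate from x to x u_i. Outside the carrier the
  map is the identity, because \<open>covering_data\<close> asks for a bijection of the whole
  type.\<close>

definition sheet :: "nat \<Rightarrow> nat \<Rightarrow> complex \<Rightarrow> nat word set \<Rightarrow> nat word set" where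
  "sheet n i z x = (if i \<noteq> 0 \<and> Re z < real i \<and> x \<in> carrier (free_group n)
     then x \<otimes>\<^bsub>free_group n\<^esub> free_gen n i else x)"

lemma (in group) bij_right_mult:
  assumes g: "g \<in> carrier G"
  shows "bij (\<lambda>x. if x \<in> carrier G then x \<otimes> g else x)"
  by (rule o_bij[of "\<lambda>x. if x \<in> carrier G then x \<otimes> inv g else x"])
    (use g in \<open>auto simp: fun_eq_iff m_assoc\<close>)

lemma bij_sheet:
  assumes "i \<in> {0..n}"
  shows "bij (sheet n i z)"
proof (cases "i \<noteq> 0 \<and> Re z < real i")
  case True
  interpret F: group "free_group n" by (rule group_free)
  have "sheet n i z = (\<lambda>x. if x \<in> carrier (free_group n) then x \<otimes>\<^bsub>free_group n\<^esub> free_gen n i else x)"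
    using True by (simp add: sheet_def fun_eq_iff)
  then show ?thesis
    using True assms F.bij_right_mult[OF free_gen_closed[of i n]] by simp
next
  case False
  then have "sheet n i z = id" by (auto simp: sheet_def fun_eq_iff)
  then show ?thesis by simp
qed

lemma sheet_locally_constant:
  assumes "i = 0 \<or> Re z \<noteq> real i"
  obtains V where "open V" "z \<in> V" "\<And>z'. z' \<in> V \<Longrightarrow> sheet n i z' = sheet n i z"
proof (cases "i = 0")
  case True
  then show ?thesis using that[of UNIV] by (simp add: sheet_def fun_eq_iff)
next
  case False
  let ?V = "if Re z < real i then {z. Re z < real i} else {z. Re z > real i}"
  show ?thesis
  proof (rule that[of ?V])
    show "open ?V" by (auto intro!: open_Collect_less continuous_intros)
  qed (use assms False in \<open>auto simp: sheet_def fun_eq_iff\<close>)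
qed

interpretation cover: covering_data "Sigma_B n" "{0..n}" "chart n" "sheet n" for n
proof
  show "open (chart n i)" for i by (rule open_chart)
  show "Sigma_B n \<subseteq> (\<Union>i\<in>{0..n}. chart n i)" by (rule chart_cover)
  show "bij (sheet n i z)" if "i \<in> {0..n}" for i z using that by (rule bij_sheet)
  fix i j z assume ij: "i \<in> {0..n}" "j \<in> {0..n}" "z \<in> chart n i" "z \<in> chart n j"
  show "\<exists>V. open V \<and> z \<in> V \<and> (\<forall>z'\<in>V. \<forall>x y. sheet n i z' y = sheet n i z x \<longrightarrow> sheet n j z' y = sheet n j z x)"
  proof (cases "i = j")
    case True
    then show ?thesis by (intro exI[of _ UNIV]) auto
  next
    case False
    have "i = 0 \<or> Re z \<noteq> real i" "j = 0 \<or> Re z \<noteq> real j"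
      using chart_overlap(2)[OF ij(3,4) False] chart_overlap(2)[OF ij(4,3)] False ij(1,2) by auto
    then obtain V W where V: "open V" "z \<in> V" "\<And>z'. z' \<in> V \<Longrightarrow> sheet n i z' = sheet n i z"
      and W: "open W" "z \<in> W" "\<And>z'. z' \<in> W \<Longrightarrow> sheet n j z' = sheet n j z"
      using sheet_locally_constant by metis
    have "inj (sheet n i z)" using bij_sheet[OF ij(1)] by (rule bij_is_inj)
    show ?thesis
    proof (intro exI[of _ "V \<inter> W"] conjI ballI allI impI)
      fix z' x y assume z': "z' \<in> V \<inter> W" and "sheet n i z' y = sheet n i z x"
      then have "sheet n i z y = sheet n i z x" using V(3)[of z'] by simp
      then have "y = x" using \<open>inj (sheet n i z)\<close> by (simp add: inj_eq)
      then show "sheet n j z' y = sheet n j z x" using W(3)[of z'] z' by simp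
    qed (use V W in auto)
  qed
qed

abbreviation monodromy :: "nat \<Rightarrow> (real \<Rightarrow> complex) \<Rightarrow> nat word set \<Rightarrow> nat word set" where
  "monodromy n \<equiv> cover.transport n"

lemma monodromy_join:
  assumes "p \<in> paths (Sigma_B n) a b" "q \<in> paths (Sigma_B n) b c"
  shows "monodromy n (p +++ q) x = monodromy n q (monodromy n p x)"
  using assms by (intro cover.transport_join) (auto simp: paths_def)

lemma monodromy_chart:
  assumes "p \<in> paths (chart n i) a b" "i \<in> {0..n}"
  shows "sheet n i b (monodromy n p x) = sheet n i a x"
  using cover.transport_chart[of p n i x] assms chart_subset[of n i]
  by (auto simp: paths_def)

lemma monodromy_chart_0:
  assumes "p \<in> paths (chart n 0) a b"
  shows "monodromy n p x = x"
  using monodromy_chart[OF assms, of x] by (simp add: sheet_def)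

lemma monodromy_chart_cross:
  assumes "p \<in> paths (chart n i) a b" "i \<in> {1..n}" "Re a < real i" "real i \<le> Re b" "x \<in> carrier (free_group n)"
  shows "monodromy n p x = x \<otimes>\<^bsub>free_group n\<^esub> free_gen n i"
  using monodromy_chart[OF assms(1), of x] assms(2-5) by (simp add: sheet_def)

lemma monodromy_const: "z \<in> Sigma_B n \<Longrightarrow> monodromy n (linepath z z) x = x"
proof -
  assume "z \<in> Sigma_B n"
  then obtain i where i: "i \<in> {0..n}" "z \<in> chart n i" using chart_cover by blast
  then have "linepath z z \<in> paths (chart n i) z z" by (intro paths_linepath) simp
  from monodromy_chart[OF this i(1), of x] show ?thesis
    using bij_is_inj[OF bij_sheet[OF i(1)]] by (simp add: inj_eq)
qed

lemma monodromy_reversepath: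
  assumes "p \<in> paths (Sigma_B n) a b"
  shows "monodromy n (reversepath p) (monodromy n p x) = x"
proof -
  have "homotopic_paths (Sigma_B n) (p +++ reversepath p) (linepath a a)"
    using homotopic_paths_rinv[of p "Sigma_B n"] assms by (simp add: paths_def)
  then have "monodromy n (p +++ reversepath p) x = monodromy n (linepath a a) x"
    by (rule cover.transport_homotopic)
  moreover have "a \<in> Sigma_B n"
    using assms pathstart_in_path_image[of p] by (auto simp: paths_def)
  ultimately show ?thesis
    using monodromy_join[OF assms paths_reversepath[OF assms], of x] monodromy_const by simp
qed

lemma monodromy_gamma:
  assumes "i \<in> {1..n}" "x \<in> carrier (free_group n)"
  shows "monodromy n (gamma i) x = x \<otimes>\<^bsub>free_group n\<^esub> free_gen n i"
proof -
  obtain c1 c2 c3 where c: "c1 \<in> paths (chart n 0) 0 (left_of i)"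
    "c2 \<in> paths (chart n i) (left_of i) (right_of i)"
    "c3 \<in> paths (chart n 0) (right_of i) 0"
    and h: "homotopic_paths (Sigma_B n) (gamma i) ((c1 +++ c2) +++ c3)"
    using gamma_decomposition[OF assms(1)] .
  note sub = paths_mono[OF _ chart_subset]
  have "monodromy n (gamma i) x = monodromy n c3 (monodromy n c2 (monodromy n c1 x))"
    using cover.transport_homotopic[OF h] monodromy_join[OF sub[OF c(1)] sub[OF c(2)]]
      monodromy_join[OF paths_join[OF sub[OF c(1)] sub[OF c(2)]] sub[OF c(3)]] by simp
  then show ?thesis
    using monodromy_chart_0[OF c(1)] monodromy_chart_0[OF c(3)] monodromy_chart_cross[OF c(2) assms(1) _ _ assms(2)]
    by simp
qed

lemma pres_hom_gamma:
  "pres_hom (pi1 (Sigma_B n) 0) {1..n} {} (\<lambda>i. loop_class (Sigma_B n) (gamma i))"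
  using gamma_in_loops by (intro pres_hom_free group_pi1) (auto simp: carrier_pi1)

lemmas free_to_pi1_hom = pres_hom.pres_lift_hom[OF pres_hom_gamma, folded free_group_def free_to_pi1_def]
lemmas free_to_pi1_gen = pres_hom.pres_lift_gen[OF pres_hom_gamma, folded free_gen_def free_to_pi1_def]

lemmas free_group_induct [consumes 1, case_names one gen inv_gen] =
  presented_group_induct[of _ "{1..n}" "{}" for n :: nat, folded free_group_def free_gen_def]

text \<open>A letter in front of a word is a loop in front of \<open>p\<close>, which fits right
  multiplication because the first path of a join acts first. With \<open>x\<close> the unit,
  \<open>f\<close> can be read off from the loop.\<close>

lemma free_to_pi1_monodromy:
  assumes "f \<in> carrier (free_group n)"
  shows "\<exists>p\<in>loops (Sigma_B n) 0. free_to_pi1 n f = loop_class (Sigma_B n) p \<and>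
    (\<forall>x\<in>carrier (free_group n). monodromy n p x = x \<otimes>\<^bsub>free_group n\<^esub> f)"
proof -
  interpret F: group "free_group n" by (rule group_free)
  interpret h: group_hom "free_group n" "pi1 (Sigma_B n) 0" "free_to_pi1 n"
    using free_to_pi1_hom F.is_group group_pi1[OF zero_in_Sigma_B] by (simp add: group_hom_def group_hom_axioms_def)
  show ?thesis
    using assms
  proof (induction rule: free_group_induct)
    case one
    show ?case
    proof (intro bexI[of _ "linepath 0 0"] conjI ballI)
      show "linepath 0 0 \<in> loops (Sigma_B n) 0" by (intro loops_const) simp
      show "free_to_pi1 n \<one>\<^bsub>free_group n\<^esub> = loop_class (Sigma_B n) (linepath 0 0)"
        by (simp only: h.hom_one one_pi1)
      show "monodromy n (linepath 0 0) x = x \<otimes>\<^bsub>free_group n\<^esub> \<one>\<^bsub>free_group n\<^esub>"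
        if "x \<in> carrier (free_group n)" for x
        using that by (simp only: monodromy_const[OF zero_in_Sigma_B] F.r_one)
    qed
  next
    case (gen i f)
    then obtain p where p: "p \<in> loops (Sigma_B n) 0" "free_to_pi1 n f = loop_class (Sigma_B n) p"
      "\<And>x. x \<in> carrier (free_group n) \<Longrightarrow> monodromy n p x = x \<otimes>\<^bsub>free_group n\<^esub> f" by blast
    note g = gamma_in_loops[OF gen.hyps(1)]
    note u = free_gen_closed[OF gen.hyps(1)]
    show ?case
    proof (intro bexI[of _ "gamma i +++ p"] conjI ballI)
      show "gamma i +++ p \<in> loops (Sigma_B n) 0" using g p(1) by (rule loops_join)
      show "free_to_pi1 n (free_gen n i \<otimes>\<^bsub>free_group n\<^esub> f) = loop_class (Sigma_B n) (gamma i +++ p)"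
        using gen.hyps u p g by (simp add: free_to_pi1_gen mult_pi1)
      show "monodromy n (gamma i +++ p) x = x \<otimes>\<^bsub>free_group n\<^esub> (free_gen n i \<otimes>\<^bsub>free_group n\<^esub> f)"
        if "x \<in> carrier (free_group n)" for x
        using monodromy_join[OF g[unfolded loops_eq_paths] p(1)[unfolded loops_eq_paths]]
          monodromy_gamma[OF gen.hyps(1) that] p(3) that u gen.hyps(2) by (simp add: F.m_assoc)
    qed
  next
    case (inv_gen i f)
    then obtain p where p: "p \<in> loops (Sigma_B n) 0" "free_to_pi1 n f = loop_class (Sigma_B n) p"
      "\<And>x. x \<in> carrier (free_group n) \<Longrightarrow> monodromy n p x = x \<otimes>\<^bsub>free_group n\<^esub> f" by blast
    note g = gamma_in_loops[OF inv_gen.hyps(1)]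
    note r = loops_reversepath[OF g]
    note u = free_gen_closed[OF inv_gen.hyps(1)]
    show ?case
    proof (intro bexI[of _ "reversepath (gamma i) +++ p"] conjI ballI)
      show "reversepath (gamma i) +++ p \<in> loops (Sigma_B n) 0" using r p(1) by (rule loops_join)
      show "free_to_pi1 n (inv\<^bsub>free_group n\<^esub> free_gen n i \<otimes>\<^bsub>free_group n\<^esub> f)
          = loop_class (Sigma_B n) (reversepath (gamma i) +++ p)"
        using inv_gen.hyps u p r inv_pi1[OF zero_in_Sigma_B g] by (simp add: free_to_pi1_gen mult_pi1)
      fix x assume x: "x \<in> carrier (free_group n)"
      let ?y = "x \<otimes>\<^bsub>free_group n\<^esub> inv\<^bsub>free_group n\<^esub> free_gen n i"
      have "monodromy n (gamma i) ?y = x"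
        using monodromy_gamma[OF inv_gen.hyps(1), of ?y] x u by (simp add: F.m_assoc)
      then have "monodromy n (reversepath (gamma i)) x = ?y"
        using monodromy_reversepath[OF g[unfolded loops_eq_paths], of ?y] by simp
      then show "monodromy n (reversepath (gamma i) +++ p) x
          = x \<otimes>\<^bsub>free_group n\<^esub> (inv\<^bsub>free_group n\<^esub> free_gen n i \<otimes>\<^bsub>free_group n\<^esub> f)"
        using monodromy_join[OF r[unfolded loops_eq_paths] p(1)[unfolded loops_eq_paths]]
          p(3) x u inv_gen.hyps(2) by (simp add: F.m_assoc)
    qed
  qed
qed

lemma monodromy_free_to_pi1:
  assumes "f \<in> carrier (free_group n)" "p \<in> loops (Sigma_B n) 0" "free_to_pi1 n f = loop_class (Sigma_B n) p"
    "x \<in> carrier (free_group n)"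
  shows "monodromy n p x = x \<otimes>\<^bsub>free_group n\<^esub> f"
proof -
  obtain q where q: "q \<in> loops (Sigma_B n) 0" "free_to_pi1 n f = loop_class (Sigma_B n) q"
    "monodromy n q x = x \<otimes>\<^bsub>free_group n\<^esub> f"
    using free_to_pi1_monodromy[OF assms(1)] assms(4) by blast
  then have "homotopic_paths (Sigma_B n) p q"
    using assms(2,3) loop_class_eq_iff by metis
  then show ?thesis using cover.transport_homotopic q(3) by simp
qed

text \<open>Transport of the unit recovers \<open>f\<close>, which gives injectivity; the image is a
  subgroup that contains the classes of all \<open>gamma i\<close>, which gives surjectivity by
  \<open>gamma_subgroup\<close>.\<close>

lemma free_to_pi1_iso: "free_to_pi1 n \<in> iso (free_group n) (pi1 (Sigma_B n) 0)"
proof -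
  interpret F: group "free_group n" by (rule group_free)
  interpret P: group "pi1 (Sigma_B n) 0" by (rule group_pi1) simp
  interpret h: group_hom "free_group n" "pi1 (Sigma_B n) 0" "free_to_pi1 n"
    using free_to_pi1_hom by (simp add: group_hom_def group_hom_axioms_def F.is_group P.is_group)
  have inj: "inj_on (free_to_pi1 n) (carrier (free_group n))"
  proof (rule inj_onI)
    fix f g assume fg: "f \<in> carrier (free_group n)" "g \<in> carrier (free_group n)" "free_to_pi1 n f = free_to_pi1 n g"
    obtain p where p: "p \<in> loops (Sigma_B n) 0" "free_to_pi1 n f = loop_class (Sigma_B n) p"
      using free_to_pi1_monodromy[OF fg(1)] by blast
    have "\<one>\<^bsub>free_group n\<^esub> \<otimes>\<^bsub>free_group n\<^esub> f = monodromy n p \<one>\<^bsub>free_group n\<^esub>"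
      by (rule monodromy_free_to_pi1[OF fg(1) p F.one_closed, symmetric])
    also have "\<dots> = \<one>\<^bsub>free_group n\<^esub> \<otimes>\<^bsub>free_group n\<^esub> g"
      by (rule monodromy_free_to_pi1[OF fg(2) p(1) _ F.one_closed]) (simp only: p(2)[symmetric] fg(3))
    finally show "f = g" using fg(1,2) by simp
  qed
  let ?H = "free_to_pi1 n ` carrier (free_group n)"
  have "gamma_subgroup n ?H"
  proof (intro gamma_subgroup.intro pi1_subgroup.intro gamma_subgroup_axioms.intro)
    show "0 \<in> Sigma_B n" by simp
    show "subgroup ?H (pi1 (Sigma_B n) 0)" by (rule h.img_is_subgroup)
    show "loop_class (Sigma_B n) (gamma i) \<in> ?H" if "i \<in> {1..n}" for i
      using free_to_pi1_gen[OF that] free_gen_closed[OF that] by (metis imageI)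
  qed
  then have "carrier (pi1 (Sigma_B n) 0) \<subseteq> ?H"
    using gamma_subgroup.loop_class_in_H by (auto simp: carrier_pi1)
  then have "?H = carrier (pi1 (Sigma_B n) 0)" using h.hom_closed by blast
  then show ?thesis using inj free_to_pi1_hom by (simp add: iso_def bij_betw_def)
qed

text \<open>Transport of the unit inverts \<open>free_to_pi1\<close>; later loops are identified by
  means of it.\<close>

lemma loop_class_free_to_pi1:
  assumes "p \<in> loops (Sigma_B n) 0"
  shows "monodromy n p \<one>\<^bsub>free_group n\<^esub> \<in> carrier (free_group n)"
    and "free_to_pi1 n (monodromy n p \<one>\<^bsub>free_group n\<^esub>) = loop_class (Sigma_B n) p"
proof -
  interpret F: group "free_group n" by (rule group_free)
  have "loop_class (Sigma_B n) p \<in> free_to_pi1 n ` carrier (free_group n)"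
    using free_to_pi1_iso[of n] assms by (auto simp: iso_def bij_betw_def carrier_pi1)
  then obtain f where f: "f \<in> carrier (free_group n)" "free_to_pi1 n f = loop_class (Sigma_B n) p" by auto
  have "monodromy n p \<one>\<^bsub>free_group n\<^esub> = f"
    using monodromy_free_to_pi1[OF f(1) assms f(2) F.one_closed] f(1) by simp
  then show "monodromy n p \<one>\<^bsub>free_group n\<^esub> \<in> carrier (free_group n)"
    "free_to_pi1 n (monodromy n p \<one>\<^bsub>free_group n\<^esub>) = loop_class (Sigma_B n) p"
    using f by simp_all
qed

text \<open>The loops \<open>box_loop j\<close> below replace \<open>gamma j\<close> when a half twist is applied, because the disk
  moved by a half twist meets only one of their vertical segments.\<close>

definition top_pt :: "nat \<Rightarrow> complex" where "top_pt j = of_nat j - 1/2 + \<i>"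
definition bot_pt :: "nat \<Rightarrow> complex" where "bot_pt j = of_nat j - 1/2 - \<i>"

text \<open>The path climbs to height 1 before it moves sideways, so it can enter the open unit disc
  around the centre of a twist only on its last, vertical segment.\<close>

definition descent :: "nat \<Rightarrow> real \<Rightarrow> complex" where
  "descent j = (linepath 0 \<i> +++ linepath \<i> (top_pt j)) +++ linepath (top_pt j) (bot_pt j)"

definition bottom_edge :: "nat \<Rightarrow> real \<Rightarrow> complex" where
  "bottom_edge j = linepath (bot_pt j) (bot_pt (Suc j))"

definition box_loop :: "nat \<Rightarrow> real \<Rightarrow> complex" where
  "box_loop j = (descent j +++ bottom_edge j) +++ reversepath (descent (Suc j))"

lemma segment_Re_Im:
  assumes "z \<in> closed_segment a b"
  shows "Re z \<in> closed_segment (Re a) (Re b)" "Im z \<in> closed_segment (Im a) (Im b)"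
  using assms unfolding closed_segment_def by auto

lemma linepath_chart_0:
  assumes "(0 < Im a \<or> a = 0) \<and> 0 < Im b \<or> Re a = Re b \<and> (\<forall>k. Re a \<noteq> real k)"
  shows "linepath a b \<in> paths (chart n 0) a b"
proof (rule paths_linepath, rule subsetI)
  fix z assume z: "z \<in> closed_segment a b"
  show "z \<in> chart n 0"
    using assms
  proof
    assume *: "(0 < Im a \<or> a = 0) \<and> 0 < Im b"
    obtain t where t: "0 \<le> t" "t \<le> 1" "z = (1 - t) *\<^sub>R a + t *\<^sub>R b" using z unfolding closed_segment_def by auto
    have "z = 0 \<or> 0 < Im z"
    proof (cases "t = 0 \<and> a = 0")
      case False
      then have "0 < (1 - t) * Im a + t * Im b"
        using * t by (cases "t = 0"; cases "a = 0") (auto intro!: add_nonneg_pos mult_pos_pos)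
      then show ?thesis by (simp add: t)
    qed (simp add: t)
    then show ?thesis by (auto simp: chart_def)
  next
    assume "Re a = Re b \<and> (\<forall>k. Re a \<noteq> real k)"
    then show ?thesis using segment_Re_Im(1)[OF z] by (auto simp: chart_def)
  qed
qed

lemma pt_sel [simp]:
  "Re (top_pt j) = real j - 1/2" "Im (top_pt j) = 1" "Re (bot_pt j) = real j - 1/2" "Im (bot_pt j) = -1"
  by (simp_all add: top_pt_def bot_pt_def)

lemma descent_paths: "descent j \<in> paths (chart n 0) 0 (bot_pt j)"
  unfolding descent_def
  by (intro paths_join[of _ _ _ "top_pt j"] paths_join[of _ _ _ \<i>] linepath_chart_0)
    (use half_integer(1) in simp_all)

lemma bottom_paths:
  assumes "j \<in> {1..n}"
  shows "bottom_edge j \<in> paths (chart n j) (bot_pt j) (bot_pt (Suc j))"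
  unfolding bottom_edge_def
proof (rule paths_linepath, rule subsetI)
  fix z assume z: "z \<in> closed_segment (bot_pt j) (bot_pt (Suc j))"
  then show "z \<in> chart n j"
    using segment_Re_Im[OF z] assms by (auto simp: chart_def closed_segment_eq_real_ivl split: if_splits)
qed

lemma monodromy_bottom:
  assumes "j \<in> {1..n}" "x \<in> carrier (free_group n)"
  shows "monodromy n (bottom_edge j) x = x \<otimes>\<^bsub>free_group n\<^esub> free_gen n j"
  using monodromy_chart_cross[OF bottom_paths[OF assms(1)] assms(1) _ _ assms(2)] by simp

lemma box_in_loops: "j \<in> {1..n} \<Longrightarrow> box_loop j \<in> loops (Sigma_B n) 0"
  unfolding loops_eq_paths box_loop_def
  using paths_mono[OF descent_paths chart_subset]
    paths_mono[OF bottom_paths chart_subset]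
  by (meson paths_join paths_reversepath)

lemma monodromy_box:
  assumes "j \<in> {1..n}" "x \<in> carrier (free_group n)"
  shows "monodromy n (box_loop j) x = x \<otimes>\<^bsub>free_group n\<^esub> free_gen n j"
proof -
  note sub = paths_mono[OF _ chart_subset]
  note d = sub[OF descent_paths] and b = sub[OF bottom_paths[OF assms(1)]]
  show ?thesis
    unfolding box_loop_def
    using monodromy_join[OF paths_join[OF d b] paths_reversepath[OF d]] monodromy_join[OF d b]
      monodromy_chart_0[OF descent_paths] monodromy_bottom[OF assms]
      monodromy_chart_0[OF paths_reversepath[OF descent_paths]] by simp
qed

text \<open>The transport of the unit around \<open>box_loop j\<close> is u_j, and this determines
  the class.\<close>

lemma free_to_pi1_gen_box:
  assumes "j \<in> {1..n}"
  shows "free_to_pi1 n (free_gen n j) = loop_class (Sigma_B n) (box_loop j)"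
proof -
  interpret F: group "free_group n" by (rule group_free)
  show ?thesis
    using loop_class_free_to_pi1(2)[OF box_in_loops[OF assms]] monodromy_box[OF assms F.one_closed]
      free_gen_closed[OF assms] by simp
qed

section \<open>Half twists\<close>

text \<open>The sign \<open>s\<close> lets the inverse of a half twist be given by the same formula;
  \<open>s = -1\<close> is the clockwise \<open>half_twist\<close>.\<close>

definition twist :: "nat \<Rightarrow> real \<Rightarrow> real \<Rightarrow> complex \<Rightarrow> complex" where
  "twist i s \<epsilon> z = right_of i + (z - right_of i) *
     cis (s * pi * max 0 (min 1 ((1/2 + \<epsilon> - cmod (z - right_of i)) / \<epsilon>)))"

lemma half_twist_eq_twist: "half_twist i \<epsilon> = twist i (-1) \<epsilon>"
  by (simp add: half_twist_def twist_def right_of_def Let_def fun_eq_iff)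

lemma norm_twist [simp]: "cmod (twist i s \<epsilon> z - right_of i) = cmod (z - right_of i)"
  by (simp add: twist_def norm_mult)

text \<open>The angle depends only on the distance to the centre, which the twist preserves, so the
  opposite angle undoes it.\<close>

lemma twist_twist: "twist i (- s) \<epsilon> (twist i s \<epsilon> z) = z"
proof -
  let ?m = "max 0 (min 1 ((1/2 + \<epsilon> - cmod (z - right_of i)) / \<epsilon>))"
  have "twist i (- s) \<epsilon> (twist i s \<epsilon> z)
      = right_of i + (twist i s \<epsilon> z - right_of i) * cis (- s * pi * ?m)"
    by (subst twist_def) simp
  also have "\<dots> = right_of i + (z - right_of i) * (cis (s * pi * ?m) * cis (- s * pi * ?m))"
    by (simp add: twist_def)
  also have "cis (s * pi * ?m) * cis (- s * pi * ?m) = 1"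
    by (simp add: cis_mult)
  finally show ?thesis by simp
qed

lemma twist_far:
  assumes "0 < \<epsilon>" "1/2 + \<epsilon> \<le> cmod (z - right_of i)"
  shows "twist i s \<epsilon> z = z"
proof -
  have "(1/2 + \<epsilon> - cmod (z - right_of i)) / \<epsilon> \<le> 0"
    using assms by (simp add: divide_nonpos_pos)
  then show ?thesis by (simp add: twist_def max_def min_def)
qed

lemma twist_near:
  assumes "0 < \<epsilon>" "cmod (z - right_of i) \<le> 1/2" "s = 1 \<or> s = -1"
  shows "twist i s \<epsilon> z = 2 * right_of i - z"
proof -
  have "1 \<le> (1/2 + \<epsilon> - cmod (z - right_of i)) / \<epsilon>"
    using assms by (simp add: pos_le_divide_eq)
  then have "max 0 (min 1 ((1/2 + \<epsilon> - cmod (z - right_of i)) / \<epsilon>)) = 1"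
    by (simp add: max_def min_def)
  then have "twist i s \<epsilon> z = right_of i + (z - right_of i) * cis (s * pi)"
    by (simp add: twist_def)
  also have "cis (s * pi) = -1"
    using assms(3) by (auto simp: complex_eq_iff)
  finally show ?thesis by simp
qed

lemma continuous_on_half_twist:
  "continuous_on ({0<..} \<times> UNIV) (\<lambda>(\<epsilon>, z). half_twist i \<epsilon> z)"
  unfolding half_twist_eq_twist twist_def case_prod_beta
  by (intro continuous_intros) auto

lemma continuous_on_twist: "0 < \<epsilon> \<Longrightarrow> continuous_on A (twist i s \<epsilon>)"
  unfolding twist_def by (intro continuous_intros) auto

text \<open>The punctures i and i+1 are at distance 1/2 from the centre and are exchanged by the
  half-turn; all others are at distance at least 3/2, beyond 1/2 + \<epsilon>.\<close>

lemma twist_puncture: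
  assumes "i \<in> {1..n - 1}" "k \<in> {1..n}" "0 < \<epsilon>" "\<epsilon> < 1" "s = 1 \<or> s = -1"
  shows "\<exists>l\<in>{1..n}. twist i s \<epsilon> (of_nat k) = of_nat l"
proof -
  have c: "of_nat k - right_of i = complex_of_real (real k - real i - 1/2)" by (simp add: right_of_def)
  have cm: "cmod (of_nat k - right_of i) = \<bar>real k - real i - 1/2\<bar>" unfolding c norm_of_real ..
  consider "k = i" | "k = Suc i" | "k < i" | "Suc i < k" by linarith
  then show ?thesis
  proof cases
    case 1
    have "cmod (of_nat k - right_of i) \<le> 1/2" unfolding cm using 1 by simp
    then have "twist i s \<epsilon> (of_nat k) = 2 * right_of i - of_nat k"
      by (rule twist_near[OF assms(3) _ assms(5)])
    then have "twist i s \<epsilon> (of_nat k) = of_nat (Suc i)" using 1 by (simp add: right_of_def)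
    then show ?thesis using assms(1) by (intro bexI[of _ "Suc i"]) auto
  next
    case 2
    have "cmod (of_nat k - right_of i) \<le> 1/2" unfolding cm using 2 by simp
    then have "twist i s \<epsilon> (of_nat k) = 2 * right_of i - of_nat k"
      by (rule twist_near[OF assms(3) _ assms(5)])
    then have "twist i s \<epsilon> (of_nat k) = of_nat i" using 2 by (simp add: right_of_def)
    then show ?thesis using assms(1) by (intro bexI[of _ i]) auto
  next
    case 3
    then have "real k + 1 \<le> real i" by simp
    then have "1/2 + \<epsilon> \<le> cmod (of_nat k - right_of i)" unfolding cm using assms(4) by simp
    then have "twist i s \<epsilon> (of_nat k) = of_nat k" by (rule twist_far[OF assms(3)])
    then show ?thesis using assms(2) by blast
  next
    case 4
    then have "real i + 2 \<le> real k" by simp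
    then have "1/2 + \<epsilon> \<le> cmod (of_nat k - right_of i)" unfolding cm using assms(4) by simp
    then have "twist i s \<epsilon> (of_nat k) = of_nat k" by (rule twist_far[OF assms(3)])
    then show ?thesis using assms(2) by blast
  qed
qed

text \<open>A point that reached a puncture would be the image of a puncture under the inverse
  twist, which permutes the punctures as well.\<close>

lemma twist_Sigma_B:
  assumes "i \<in> {1..n - 1}" "0 < \<epsilon>" "\<epsilon> < 1" "s = 1 \<or> s = -1" "z \<in> Sigma_B n"
  shows "twist i s \<epsilon> z \<in> Sigma_B n"
proof (rule ccontr)
  assume "twist i s \<epsilon> z \<notin> Sigma_B n"
  then obtain k where k: "k \<in> {1..n}" "twist i s \<epsilon> z = of_nat k" by (auto simp: Sigma_B_iff)
  then have z: "z = twist i (- s) \<epsilon> (of_nat k)" using twist_twist[of i s \<epsilon> z] by simp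
  have "- s = 1 \<or> - s = -1" using assms(4) by auto
  then obtain l where "l \<in> {1..n}" "z = of_nat l"
    using twist_puncture[OF assms(1) k(1) assms(2,3), of "- s"] z by auto
  then show False using assms(5) by (auto simp: Sigma_B_iff)
qed

lemma twist_zero:
  assumes "1 \<le> i" "0 < \<epsilon>" "\<epsilon> < 1"
  shows "twist i s \<epsilon> 0 = 0"
proof (rule twist_far[OF assms(2)])
  have "cmod (right_of i) = \<bar>real i + 1/2\<bar>"
    using norm_of_real[of "real i + 1/2", where 'a = complex] by (simp add: right_of_def)
  then show "1/2 + \<epsilon> \<le> cmod (0 - right_of i)" using assms by simp
qed

lemma homeomorphism_half_twist:
  assumes "i \<in> {1..n - 1}" "0 < \<epsilon>" "\<epsilon> < 1"
  shows "homeomorphism (Sigma_B n) (Sigma_B n) (half_twist i \<epsilon>) (twist i 1 \<epsilon>)"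
proof (rule homeomorphismI)
  show "continuous_on (Sigma_B n) (half_twist i \<epsilon>)" "continuous_on (Sigma_B n) (twist i 1 \<epsilon>)"
    using assms(2) by (simp_all add: half_twist_eq_twist continuous_on_twist)
qed (use twist_Sigma_B[OF assms] twist_twist[of i 1 \<epsilon>] twist_twist[of i "-1" \<epsilon>]
      in \<open>auto simp: half_twist_eq_twist\<close>)

abbreviation fixes_base_homeo where
  "fixes_base_homeo n \<equiv> \<lambda>h. h (0::complex) = 0 \<and> (\<exists>k. homeomorphism (Sigma_B n) (Sigma_B n) h k)"

text \<open>The width is interpolated linearly, and every intermediate twist is a homeomorphism that
  fixes 0. One width can therefore stand for all representatives.\<close>

lemma half_twist_isotopic:
  assumes i: "i \<in> {1..n - 1}" and e: "0 < \<epsilon>" "\<epsilon> < 1" "0 < \<epsilon>'" "\<epsilon>' < 1"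
  shows "homotopic_with_canon (fixes_base_homeo n) (Sigma_B n) (Sigma_B n) (half_twist i \<epsilon>) (half_twist i \<epsilon>')"
proof -
  define \<eta> where "\<eta> t = (1 - t) * \<epsilon> + t * \<epsilon>'" for t :: real
  have \<eta>: "0 < \<eta> t" "\<eta> t < 1" if "t \<in> {0..1}" for t
  proof -
    show "0 < \<eta> t"
      using that e unfolding \<eta>_def by (cases "t = 0") (auto intro!: add_nonneg_pos)
    have "(1 - t) * \<epsilon> + t * \<epsilon>' < 1"
    proof (cases "t = 0")
      case False
      then have "t * \<epsilon>' < t * 1" using that e by (intro mult_strict_left_mono) auto
      moreover have "(1 - t) * \<epsilon> \<le> (1 - t) * 1" using that e by (intro mult_left_mono) auto
      ultimately show ?thesis by simp
    qed (use e in simp)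
    then show "\<eta> t < 1" by (simp add: \<eta>_def)
  qed
  let ?h = "\<lambda>y. half_twist i (\<eta> (fst y)) (snd y)"
  have c: "continuous_on ({0..1} \<times> Sigma_B n) ?h"
    by (rule continuous_on_compose2[OF continuous_on_half_twist[of i], of _ "\<lambda>y. (\<eta> (fst y), snd y)", simplified])
      (use \<eta> in \<open>auto simp: \<eta>_def intro!: continuous_intros\<close>)
  have "?h y \<in> Sigma_B n" if "y \<in> {0..1} \<times> Sigma_B n" for y
    using that \<eta> twist_Sigma_B[OF i] by (auto simp: half_twist_eq_twist)
  then have "continuous_map (prod_topology (top_of_set {0..1}) (top_of_set (Sigma_B n))) (top_of_set (Sigma_B n)) ?h"
    using c by (auto simp: continuous_map_in_subtopology)
  moreover have "fixes_base_homeo n (half_twist i (\<eta> t))" if "t \<in> {0..1}" for t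
    using homeomorphism_half_twist[OF i \<eta>[OF that]] twist_zero[OF _ \<eta>[OF that], of i] i
    by (auto simp: half_twist_eq_twist)
  ultimately show ?thesis
    unfolding homotopic_with_def
    by (intro exI[of _ ?h] conjI allI ballI) (simp_all add: \<eta>_def)
qed

text \<open>With width 1/2 the support is the unit disc around \<open>right_of i\<close>. The
  horizontal box edges, and all vertical ones except the one through the centre, stay outside its
  interior.\<close>

abbreviation std_twist where "std_twist i \<equiv> half_twist i (1/2)"

lemma std_twist_in_braid_twist: "i \<in> {1..n - 1} \<Longrightarrow> std_twist i \<in> braid_twist n i"
  unfolding braid_twist_def using half_twist_isotopic[of i n "1/2" "1/2"]
  by (intro CollectI exI[of _ "1/2"]) auto

lemma std_twist_Sigma_B: "i \<in> {1..n - 1} \<Longrightarrow> std_twist i \<in> Sigma_B n \<rightarrow> Sigma_B n"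
  using twist_Sigma_B[of i n "1/2" "-1"] by (simp add: half_twist_eq_twist)

lemma continuous_on_std_twist: "continuous_on A (std_twist i)"
  unfolding half_twist_eq_twist by (rule continuous_on_twist) simp

lemma std_twist_zero: "1 \<le> i \<Longrightarrow> std_twist i 0 = 0"
  using twist_zero[of i "1/2"] by (simp add: half_twist_eq_twist)

lemma homotopic_with_based_loops:
  fixes S :: "'a::real_normed_vector set"
  assumes "homotopic_with_canon P S S f g" "\<And>h. P h \<Longrightarrow> h x = x" "p \<in> loops S x"
  shows "homotopic_paths S (f \<circ> p) (g \<circ> p)"
proof -
  have p: "path p" "path_image p \<subseteq> S" "p 0 = x" "p 1 = x"
    using assms(3) by (auto simp: loops_def pathstart_def pathfinish_def)
  have "homotopic_with_canon (\<lambda>r. pathstart r = x \<and> pathfinish r = x) {0..1} S (f \<circ> p) (g \<circ> p)"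
  proof (rule homotopic_with_compose_continuous_map_right[OF assms(1)])
    show "continuous_map (top_of_set {0..1}) (top_of_set S) p"
      using p(1,2) by (auto simp: continuous_map_in_subtopology path_def path_image_def)
    show "pathstart (h \<circ> p) = x \<and> pathfinish (h \<circ> p) = x" if "P h" for h
      using assms(2)[OF that] p by (simp add: pathstart_def pathfinish_def)
  qed
  moreover have "P f" using homotopic_with_imp_property[OF assms(1)] by simp
  then have "pathstart (f \<circ> p) = x" "pathfinish (f \<circ> p) = x"
    using assms(2) p by (simp_all add: pathstart_def pathfinish_def)
  ultimately show ?thesis unfolding homotopic_paths_def by simp
qed

lemma braid_twist_isotopic_std_twist:
  assumes "i \<in> {1..n - 1}" "\<sigma> \<in> braid_twist n i"
  shows "homotopic_with_canon (fixes_base_homeo n) (Sigma_B n) (Sigma_B n) (std_twist i) \<sigma>"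
proof -
  obtain \<epsilon> where e: "0 < \<epsilon>" "\<epsilon> < 1"
    "homotopic_with_canon (fixes_base_homeo n) (Sigma_B n) (Sigma_B n) (half_twist i \<epsilon>) \<sigma>"
    using assms(2) unfolding braid_twist_def by blast
  then show ?thesis
    using homotopic_with_trans[OF half_twist_isotopic[OF assms(1), of "1/2" \<epsilon>]] by simp
qed

lemma pi1_map_braid_twist:
  assumes "i \<in> {1..n - 1}" "\<sigma> \<in> braid_twist n i" "p \<in> loops (Sigma_B n) 0"
  shows "pi1_map (Sigma_B n) \<sigma> (loop_class (Sigma_B n) p) = loop_class (Sigma_B n) (std_twist i \<circ> p)"
proof -
  note h = braid_twist_isotopic_std_twist[OF assms(1,2)]
  have "\<sigma> 0 = 0 \<and> (\<exists>k. homeomorphism (Sigma_B n) (Sigma_B n) \<sigma> k)"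
    using homotopic_with_imp_property[OF h] by blast
  then have "continuous_on (Sigma_B n) \<sigma>" "\<sigma> \<in> Sigma_B n \<rightarrow> Sigma_B n"
    by (auto simp: homeomorphism_def)
  then have "pi1_map (Sigma_B n) \<sigma> (loop_class (Sigma_B n) p) = loop_class (Sigma_B n) (\<sigma> \<circ> p)"
    using assms(3) by (rule pi1_map_loop_class)
  moreover have "homotopic_paths (Sigma_B n) (std_twist i \<circ> p) (\<sigma> \<circ> p)"
    by (rule homotopic_with_based_loops[OF h _ assms(3)]) simp
  ultimately show ?thesis by (simp add: loop_class_eqI)
qed

lemma std_twist_paths:
  assumes "i \<in> {1..n - 1}" "p \<in> paths (Sigma_B n) a b"
  shows "std_twist i \<circ> p \<in> paths (Sigma_B n) (std_twist i a) (std_twist i b)"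
  using assms(2) std_twist_Sigma_B[OF assms(1)] continuous_on_std_twist
  unfolding paths_def
  by (auto simp: pathstart_compose pathfinish_compose path_image_compose intro!: path_continuous_image)

lemma std_twist_fixed:
  assumes "1 \<le> cmod (z - right_of i)"
  shows "std_twist i z = z"
  unfolding half_twist_eq_twist using assms by (intro twist_far) auto

lemma monodromy_std_twist_fixed:
  assumes "p \<in> paths (Sigma_B n) a b" "\<And>z. z \<in> path_image p \<Longrightarrow> 1 \<le> cmod (z - right_of i)"
  shows "monodromy n (std_twist i \<circ> p) x = monodromy n p x"
proof -
  have "homotopic_paths (Sigma_B n) p (std_twist i \<circ> p)"
    using assms by (intro homotopic_paths_eq) (auto simp: paths_def path_image_def std_twist_fixed)
  then show ?thesis by (simp add: cover.transport_homotopic)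
qed

section \<open>The half twist on the vertical line between its punctures\<close>

text \<open>Coordinates centred at the twist, rotated by pi for \<open>s = -1\<close>, so that one
  computation serves both halves of the vertical line.\<close>

definition half_pt :: "nat \<Rightarrow> real \<Rightarrow> real \<Rightarrow> real \<Rightarrow> complex" where
  "half_pt i s a b = Complex (real i + 1/2 + s * a) (s * b)"

text \<open>The strip of the puncture \<open>i + 1\<close> (for \<open>s = 1\<close>) or \<open>i\<close> (for \<open>s = -1\<close>), cut along a ray that
  starts at the puncture and meets the vertical line above (below) the centre of the twist. The
  twist moves the segment from \<open>half_pt i s 0 1\<close> to the centre around the other end of the ray.\<close>

definition slit_strip :: "nat \<Rightarrow> real \<Rightarrow> complex set" where
  "slit_strip i s = {z. -1/2 < s * (Re z - (real i + 1/2)) \<and> s * (Re z - (real i + 1/2)) < 3/2 \<and>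
     (s * (Re z - (real i + 1/2)) + s * Im z = 1/2 \<longrightarrow> 1/2 < s * (Re z - (real i + 1/2)))}"

text \<open>In these coordinates the cut is the half-line a + b = 1/2, a \<le> 1/2. It starts at the
  puncture (1/2, 0) and meets the vertical line a = 0 at b = 1/2. The bounds -1/2 and 3/2 keep out
  the neighbouring punctures.\<close>

lemma slit_strip_iff:
  assumes "s = 1 \<or> s = -1"
  shows "half_pt i s a b \<in> slit_strip i s \<longleftrightarrow> -1/2 < a \<and> a < 3/2 \<and> (a + b = 1/2 \<longrightarrow> 1/2 < a)"
  using assms by (auto simp: slit_strip_def half_pt_def)

lemma half_pt_cases:
  assumes "s = 1 \<or> s = -1"
  obtains a b where "z = half_pt i s a b"
proof
  show "z = half_pt i s (s * (Re z - (real i + 1/2))) (s * Im z)"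
    using assms by (auto simp: half_pt_def complex_eq_iff)
qed

lemma segment_half_pt:
  assumes "z \<in> closed_segment (half_pt i s a b) (half_pt i s a' b')"
  obtains t where "0 \<le> t" "t \<le> 1" "z = half_pt i s ((1 - t) * a + t * a') ((1 - t) * b + t * b')"
  using assms unfolding closed_segment_def
  by (auto simp: half_pt_def complex_eq_iff algebra_simps)

lemma simply_connected_slit_strip:
  assumes s: "s = 1 \<or> s = -1"
  shows "simply_connected (slit_strip i s)"
proof -
  have "starlike (slit_strip i s)"
    unfolding starlike_def
  proof (intro bexI ballI subsetI)
    \<comment> \<open>The star centre is on the line of the cut, prolonged beyond the puncture, so a
      segment from it meets that line again only if it runs along it, and then on the uncut
      side.\<close>
    show "half_pt i s (3/4) (-1/4) \<in> slit_strip i s" using s by (simp add: slit_strip_iff)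
    fix z y assume z: "z \<in> slit_strip i s" and y: "y \<in> closed_segment (half_pt i s (3/4) (-1/4)) z"
    obtain a b where ab: "z = half_pt i s a b" using half_pt_cases[OF s] .
    then obtain t where t: "0 \<le> t" "t \<le> 1"
      "y = half_pt i s ((1 - t) * (3/4) + t * a) ((1 - t) * (-1/4) + t * b)"
      using y segment_half_pt by metis
    have a: "-1/2 < a" "a < 3/2" "a + b = 1/2 \<longrightarrow> 1/2 < a"
      using z ab s by (simp_all add: slit_strip_iff)
    have conv: "u < (1 - t) * v + t * w" if "u < v" "u < w" for u v w :: real
    proof -
      have "0 < (1 - t) * (v - u) + t * (w - u)"
        using t that by (cases "t = 0") (auto intro!: add_nonneg_pos)
      then show ?thesis by (simp add: algebra_simps)
    qed
    have "-1/2 < (1 - t) * (3/4) + t * a" using conv[of "-1/2" "3/4" a] a by simp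
    moreover have "(1 - t) * (3/4) + t * a < 3/2" using conv[of "-3/2" "-3/4" "-a"] a by (simp add: algebra_simps)
    moreover have "1/2 < (1 - t) * (3/4) + t * a"
      if "(1 - t) * (3/4) + t * a + ((1 - t) * (-1/4) + t * b) = 1/2"
    proof (cases "t = 0")
      case False
      have "t * (a + b - 1/2) = (1 - t) * (3/4) + t * a + ((1 - t) * (-1/4) + t * b) - 1/2"
        by (simp add: field_simps)
      then have "t * (a + b - 1/2) = 0" unfolding that by simp
      then have "1/2 < a" using a False by auto
      then show ?thesis by (intro conv) simp_all
    qed simp
    ultimately show "y \<in> slit_strip i s" using s by (simp add: t(3) slit_strip_iff)
  qed
  then show ?thesis by (rule starlike_imp_simply_connected)
qed

lemma slit_strip_subset_Sigma_B:
  assumes s: "s = 1 \<or> s = -1"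
  shows "slit_strip i s \<subseteq> Sigma_B n"
proof
  fix z assume z: "z \<in> slit_strip i s"
  show "z \<in> Sigma_B n"
    unfolding Sigma_B_iff
  proof safe
    fix k assume "z = of_nat k"
    then have k: "Re z = real k" "Im z = 0" by simp_all
    then have *: "-1/2 < s * (real k - (real i + 1/2))" "s * (real k - (real i + 1/2)) < 3/2"
      "s * (real k - (real i + 1/2)) \<noteq> 1/2"
      using z by (auto simp: slit_strip_def)
    from s show False
    proof
      assume "s = 1"
      then have "real i < real k" "real k < real (i + 2)" "real k \<noteq> real (i + 1)" using * by auto
      then show False unfolding of_nat_less_iff of_nat_eq_iff by linarith
    next
      assume "s = -1"
      then have "real k < real (i + 1)" "real i < real (k + 1)" "real k \<noteq> real i" using * by auto
      then show False unfolding of_nat_less_iff of_nat_eq_iff by linarith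
    qed
  qed
qed

text \<open>A route of box edges around the puncture at (1/2, 0), reaching the centre from the other
  side. It avoids the cut, and its transport is known edge by edge.\<close>

definition detour :: "nat \<Rightarrow> real \<Rightarrow> real \<Rightarrow> complex" where
  "detour i s = linepath (half_pt i s 0 1) (half_pt i s 1 1) +++ (linepath (half_pt i s 1 1) (half_pt i s 1 (-1))
     +++ (linepath (half_pt i s 1 (-1)) (half_pt i s 0 (-1)) +++ linepath (half_pt i s 0 (-1)) (half_pt i s 0 0)))"

lemma detour_paths:
  assumes "s = 1 \<or> s = -1"
  shows "detour i s \<in> paths (slit_strip i s) (half_pt i s 0 1) (half_pt i s 0 0)"
proof -
  have c: "closed_segment (half_pt i s 0 1) (half_pt i s 1 1) \<subseteq> slit_strip i s"
    "closed_segment (half_pt i s 1 1) (half_pt i s 1 (-1)) \<subseteq> slit_strip i s"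
    "closed_segment (half_pt i s 1 (-1)) (half_pt i s 0 (-1)) \<subseteq> slit_strip i s"
    "closed_segment (half_pt i s 0 (-1)) (half_pt i s 0 0) \<subseteq> slit_strip i s"
    using assms by (auto elim!: segment_half_pt simp: slit_strip_iff)
  show ?thesis
    unfolding detour_def
    by (rule paths_join[OF c(1)[THEN paths_linepath] paths_join[OF
          c(2)[THEN paths_linepath] paths_join[OF c(3,4)[THEN paths_linepath]]]])
qed

text \<open>The image (a, b) of (0, y) lies on the circle of radius y with a \<ge> 0. On the cut, a
  and b would be nonnegative with sum 1/2, hence y \<le> 1/2 because a^2 + b^2 \<le> (a + b)^2. But
  for such y the twist is the full half-turn, and a + b = -y.\<close>

lemma std_twist_half_line:
  assumes s: "s = 1 \<or> s = -1" and y: "0 \<le> y" "y \<le> 1"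
  shows "std_twist i (half_pt i s 0 y) \<in> slit_strip i s"
proof -
  define m where "m = max 0 (min 1 (2 * (1 - y)))"
  have d: "half_pt i s 0 y - right_of i = of_real s * (\<i> * of_real y)"
    by (simp add: complex_eq_iff half_pt_def)
  have n: "cmod (half_pt i s 0 y - right_of i) = y"
    unfolding d using s y by (auto simp: norm_mult)
  have "std_twist i (half_pt i s 0 y) = right_of i + of_real s * (\<i> * of_real y) * cis (- pi * m)"
    unfolding half_twist_eq_twist twist_def n unfolding d m_def by (simp add: field_simps)
  also have "\<dots> = half_pt i s (y * sin (pi * m)) (y * cos (pi * m))"
    by (simp add: complex_eq_iff half_pt_def)
  finally have T: "std_twist i (half_pt i s 0 y) = half_pt i s (y * sin (pi * m)) (y * cos (pi * m))" .
  have "0 \<le> m" "m \<le> 1" by (auto simp: m_def)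
  then have sin: "0 \<le> sin (pi * m)"
    by (intro sin_ge_zero) (auto simp: mult_left_le)
  then have w: "0 \<le> y * sin (pi * m)" "y * sin (pi * m) \<le> 1"
    using y by (auto intro: mult_le_one)
  have "1/2 < y * sin (pi * m)" if "y * sin (pi * m) + y * cos (pi * m) = 1/2"
  proof (rule ccontr)
    assume le: "\<not> 1/2 < y * sin (pi * m)"
    show False
    proof (cases "y \<le> 1/2")
      case True
      then have "m = 1" by (simp add: m_def)
      then show False using that y by simp
    next
      case False
      let ?a = "y * sin (pi * m)" and ?b = "y * cos (pi * m)"
      have "y\<^sup>2 = ?a\<^sup>2 + ?b\<^sup>2" by (simp add: power_mult_distrib flip: distrib_left)
      also have "\<dots> \<le> (?a + ?b)\<^sup>2"
        using w that le by (simp add: power2_sum)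
      also have "\<dots> = (1/2)\<^sup>2" using that by simp
      finally show False using False power2_le_imp_le[of y "1/2"] by simp
    qed
  qed
  then show ?thesis using s w by (simp add: T slit_strip_iff)
qed

text \<open>Image and detour lie in the same simply connected slit strip. They share their ends: the
  outer end is on the boundary of the support, and the centre is fixed.\<close>

lemma std_twist_half_line_homotopic:
  assumes s: "s = 1 \<or> s = -1"
  shows "homotopic_paths (Sigma_B n) (std_twist i \<circ> linepath (half_pt i s 0 1) (half_pt i s 0 0)) (detour i s)"
proof (rule simply_connected_homotopic[OF simply_connected_slit_strip[OF s] slit_strip_subset_Sigma_B[OF s] _ detour_paths[OF s]])
  have 1: "half_pt i s 0 1 - right_of i = of_real s * \<i>" and 0: "half_pt i s 0 0 = right_of i"
    by (simp_all add: complex_eq_iff half_pt_def)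
  have e1: "std_twist i (half_pt i s 0 1) = half_pt i s 0 1"
    using s by (intro std_twist_fixed) (auto simp: 1 norm_mult)
  have e0: "std_twist i (half_pt i s 0 0) = half_pt i s 0 0"
    by (simp add: half_twist_eq_twist twist_def 0)
  have "std_twist i z \<in> slit_strip i s" if z: "z \<in> closed_segment (half_pt i s 0 1) (half_pt i s 0 0)" for z
  proof -
    obtain t where "0 \<le> t" "t \<le> 1" "z = half_pt i s ((1 - t) * 0 + t * 0) ((1 - t) * 1 + t * 0)"
      using segment_half_pt[OF z] .
    then show ?thesis using std_twist_half_line[OF s, of "1 - t" i] by simp
  qed
  then show "std_twist i \<circ> linepath (half_pt i s 0 1) (half_pt i s 0 0)
      \<in> paths (slit_strip i s) (half_pt i s 0 1) (half_pt i s 0 0)"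
    unfolding paths_def
    by (auto simp: pathstart_compose pathfinish_compose path_image_compose e0 e1
        intro!: path_continuous_image continuous_on_std_twist)
qed

lemma half_pt_eq:
  "half_pt i s 0 0 = right_of i"
  "half_pt i 1 0 1 = top_pt (Suc i)" "half_pt i 1 1 1 = top_pt (Suc (Suc i))"
  "half_pt i 1 1 (-1) = bot_pt (Suc (Suc i))" "half_pt i 1 0 (-1) = bot_pt (Suc i)"
  "half_pt i (-1) 0 1 = bot_pt (Suc i)" "half_pt i (-1) 1 1 = bot_pt i"
  "half_pt i (-1) 1 (-1) = top_pt i" "half_pt i (-1) 0 (-1) = top_pt (Suc i)"
  by (simp_all add: complex_eq_iff half_pt_def)

lemma reversed_bottom:
  assumes "j \<in> {1..n}"
  shows "linepath (bot_pt (Suc j)) (bot_pt j) \<in> paths (Sigma_B n) (bot_pt (Suc j)) (bot_pt j)"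
    and "x \<in> carrier (free_group n) \<Longrightarrow> monodromy n (linepath (bot_pt (Suc j)) (bot_pt j)) x
      = x \<otimes>\<^bsub>free_group n\<^esub> inv\<^bsub>free_group n\<^esub> free_gen n j"
proof -
  interpret F: group "free_group n" by (rule group_free)
  note b = paths_mono[OF bottom_paths[OF assms] chart_subset]
  have r: "reversepath (bottom_edge j) = linepath (bot_pt (Suc j)) (bot_pt j)" by (simp add: bottom_edge_def)
  show "linepath (bot_pt (Suc j)) (bot_pt j) \<in> paths (Sigma_B n) (bot_pt (Suc j)) (bot_pt j)"
    using paths_reversepath[OF b] unfolding r .
  assume x: "x \<in> carrier (free_group n)"
  let ?y = "x \<otimes>\<^bsub>free_group n\<^esub> inv\<^bsub>free_group n\<^esub> free_gen n j"
  have "monodromy n (bottom_edge j) ?y = x"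
    using monodromy_bottom[OF assms, of ?y] x free_gen_closed[OF assms] by (simp add: F.m_assoc)
  then show "monodromy n (linepath (bot_pt (Suc j)) (bot_pt j)) x = ?y"
    using monodromy_reversepath[OF b, of ?y] unfolding r by simp
qed

lemma monodromy_linepath_chart_0:
  assumes "(0 < Im a \<or> a = 0) \<and> 0 < Im b \<or> Re a = Re b \<and> (\<forall>k. Re a \<noteq> real k)"
  shows "linepath a b \<in> paths (Sigma_B n) a b" "monodromy n (linepath a b) x = x"
  using paths_mono[OF linepath_chart_0[OF assms] chart_subset]
    monodromy_chart_0[OF linepath_chart_0[OF assms]] by auto

text \<open>Only the bottom edge crosses a ray, and it is run from right to left: under i+1 for s =
  1, under i for s = -1.\<close>

lemma monodromy_detour:
  assumes i: "i \<in> {1..n - 1}" and x: "x \<in> carrier (free_group n)"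
  shows "monodromy n (detour i 1) x = x \<otimes>\<^bsub>free_group n\<^esub> inv\<^bsub>free_group n\<^esub> free_gen n (Suc i)"
    and "monodromy n (detour i (-1)) x = x \<otimes>\<^bsub>free_group n\<^esub> inv\<^bsub>free_group n\<^esub> free_gen n i"
proof -
  have ij: "Suc i \<in> {1..n}" "i \<in> {1..n}" using i by auto
  have half: "real i + 1/2 \<noteq> real k" "real i - 1/2 \<noteq> real k" for k using half_integer[of i k] by auto
  have half': "real i + 3/2 \<noteq> real k" for k
    using half_integer(2)[of "Suc i" k] by (simp add: algebra_simps)
  have u: "linepath (top_pt j) (top_pt k) \<in> paths (Sigma_B n) (top_pt j) (top_pt k)"
    "monodromy n (linepath (top_pt j) (top_pt k)) y = y" for j k y
    by (rule monodromy_linepath_chart_0; simp)+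
  have v: "linepath a b \<in> paths (Sigma_B n) a b" "monodromy n (linepath a b) y = y"
    if "Re a = real j - 1/2" "Re b = real j - 1/2" for a b j y
    using monodromy_linepath_chart_0[of a b] that half_integer(1)[of j] by auto
  note r1 = reversed_bottom[OF ij(1)] and r0 = reversed_bottom[OF ij(2)]
  have l1: "linepath (top_pt (Suc (Suc i))) (bot_pt (Suc (Suc i))) \<in> paths (Sigma_B n) (top_pt (Suc (Suc i))) (bot_pt (Suc (Suc i)))"
    "monodromy n (linepath (top_pt (Suc (Suc i))) (bot_pt (Suc (Suc i)))) y = y" for y
    by (rule v[of _ "Suc (Suc i)"]; simp)+
  have l2: "linepath (bot_pt (Suc i)) (right_of i) \<in> paths (Sigma_B n) (bot_pt (Suc i)) (right_of i)"
    "monodromy n (linepath (bot_pt (Suc i)) (right_of i)) y = y" for y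
    by (rule v[of _ "Suc i"]; simp)+
  have l3: "linepath (bot_pt i) (top_pt i) \<in> paths (Sigma_B n) (bot_pt i) (top_pt i)"
    "monodromy n (linepath (bot_pt i) (top_pt i)) y = y" for y
    by (rule v[of _ i]; simp)+
  have l4: "linepath (top_pt (Suc i)) (right_of i) \<in> paths (Sigma_B n) (top_pt (Suc i)) (right_of i)"
    "monodromy n (linepath (top_pt (Suc i)) (right_of i)) y = y" for y
    by (rule v[of _ "Suc i"]; simp)+
  have join4: "monodromy n (p +++ (q +++ (r +++ s))) y = monodromy n s (monodromy n r (monodromy n q (monodromy n p y)))"
    if "p \<in> paths (Sigma_B n) a b" "q \<in> paths (Sigma_B n) b c"
      "r \<in> paths (Sigma_B n) c d" "s \<in> paths (Sigma_B n) d e" for p q r s a b c d e y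
    using monodromy_join[OF that(1) paths_join[OF that(2) paths_join[OF that(3,4)]]]
      monodromy_join[OF that(2) paths_join[OF that(3,4)]] monodromy_join[OF that(3,4)] by simp
  show "monodromy n (detour i 1) x = x \<otimes>\<^bsub>free_group n\<^esub> inv\<^bsub>free_group n\<^esub> free_gen n (Suc i)"
    unfolding detour_def half_pt_eq
    using join4[OF u(1)[of "Suc i" "Suc (Suc i)"] l1(1) r1(1) l2(1)] u(2) l1(2) l2(2) r1(2)[OF x] by simp
  show "monodromy n (detour i (-1)) x = x \<otimes>\<^bsub>free_group n\<^esub> inv\<^bsub>free_group n\<^esub> free_gen n i"
    unfolding detour_def half_pt_eq
    using join4[OF r0(1) l3(1) u(1)[of i "Suc i"] l4(1)] u(2) l3(2) l4(2) r0(2)[OF x] by simp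
qed

lemma linepath_join_midpoint:
  fixes a b :: complex
  shows
  "linepath a ((1/2) *\<^sub>R (a + b)) +++ linepath ((1/2) *\<^sub>R (a + b)) b = linepath a b"
proof
  fix t
  show "(linepath a ((1/2) *\<^sub>R (a + b)) +++ linepath ((1/2) *\<^sub>R (a + b)) b) t = linepath a b t"
    by (simp add: joinpaths_def linepath_def scaleR_conv_of_real field_simps)
qed

lemma far_from_centre:
  assumes "1 \<le> \<bar>Re z - (real i + 1/2)\<bar> \<or> 1 \<le> \<bar>Im z\<bar>"
  shows "1 \<le> cmod (z - right_of i)"
  using assms abs_Re_le_cmod[of "z - right_of i"] abs_Im_le_cmod[of "z - right_of i"] by auto

lemma descent_parts:
  "linepath 0 \<i> +++ linepath \<i> (top_pt j) \<in> paths (Sigma_B n) 0 (top_pt j)"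
  "linepath (top_pt j) (bot_pt j) \<in> paths (Sigma_B n) (top_pt j) (bot_pt j)"
proof -
  show "linepath 0 \<i> +++ linepath \<i> (top_pt j) \<in> paths (Sigma_B n) 0 (top_pt j)"
    by (rule paths_join[of _ _ _ \<i>]; rule monodromy_linepath_chart_0(1); simp)
  show "linepath (top_pt j) (bot_pt j) \<in> paths (Sigma_B n) (top_pt j) (bot_pt j)"
    by (rule monodromy_linepath_chart_0(1)) (use half_integer(1) in simp)
qed

lemma tail_far:
  assumes "1 \<le> i" "z \<in> path_image (linepath 0 \<i> +++ linepath \<i> (top_pt j))"
  shows "1 \<le> cmod (z - right_of i)"
proof -
  have "z \<in> closed_segment 0 \<i> \<or> z \<in> closed_segment \<i> (top_pt j)"
    using assms(2) by (auto simp: path_image_join)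
  then have "Re z = 0 \<or> Im z = 1"
    using segment_Re_Im[of z 0 \<i>] segment_Re_Im[of z \<i> "top_pt j"] by auto
  then show ?thesis using assms(1) by (intro far_from_centre) auto
qed

text \<open>For these \<open>j\<close> the vertical line at j - 1/2 is at distance at least 1 from
  the centre, so the path is fixed pointwise.\<close>

lemma monodromy_std_twist_descent:
  assumes i: "i \<in> {1..n - 1}" and j: "j \<noteq> Suc i"
  shows "monodromy n (std_twist i \<circ> descent j) x = x"
proof -
  note d = paths_mono[OF descent_paths chart_subset]
  have "1 \<le> cmod (z - right_of i)" if z: "z \<in> path_image (descent j)" for z
  proof -
    have "z \<in> path_image (linepath 0 \<i> +++ linepath \<i> (top_pt j)) \<or> z \<in> closed_segment (top_pt j) (bot_pt j)"
      using z by (auto simp: descent_def path_image_join)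
    then show ?thesis
    proof
      assume "z \<in> closed_segment (top_pt j) (bot_pt j)"
      then have z: "Re z = real j - 1/2" using segment_Re_Im(1) by fastforce
      have "j \<le> i \<or> Suc (Suc i) \<le> j" using j by linarith
      then have "real j \<le> real i \<or> real i + 2 \<le> real j" by auto
      then show ?thesis using z by (intro far_from_centre) auto
    qed (use tail_far i in auto)
  qed
  then show ?thesis
    using monodromy_std_twist_fixed[OF d] monodromy_chart_0[OF descent_paths] by simp
qed

lemma monodromy_std_twist_bottom:
  assumes "j \<in> {1..n}" "x \<in> carrier (free_group n)"
  shows "monodromy n (std_twist i \<circ> bottom_edge j) x = x \<otimes>\<^bsub>free_group n\<^esub> free_gen n j"
proof -
  have "1 \<le> cmod (z - right_of i)" if "z \<in> path_image (bottom_edge j)" for z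
    using that segment_Re_Im(2)[of z "bot_pt j" "bot_pt (Suc j)"]
    by (intro far_from_centre) (auto simp: bottom_edge_def)
  then show ?thesis
    using monodromy_std_twist_fixed[OF paths_mono[OF bottom_paths[OF assms(1)] chart_subset]]
      monodromy_bottom[OF assms] by simp
qed

lemma comp_reversepath: "f \<circ> reversepath p = reversepath (f \<circ> p)"
  by (simp add: reversepath_def comp_def)

text \<open>The vertical segment is divided at the centre. Its upper half becomes the detour around
  i+1 and its lower half the reverse of the detour around i, so the factors are the inverse of
  u_{i+1} and then u_i.\<close>

lemma monodromy_std_twist_descent_middle:
  assumes i: "i \<in> {1..n - 1}" and x: "x \<in> carrier (free_group n)"
  shows "monodromy n (std_twist i \<circ> descent (Suc i)) x
    = x \<otimes>\<^bsub>free_group n\<^esub> inv\<^bsub>free_group n\<^esub> free_gen n (Suc i) \<otimes>\<^bsub>free_group n\<^esub> free_gen n i"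
proof -
  interpret F: group "free_group n" by (rule group_free)
  have u: "free_gen n i \<in> carrier (free_group n)" "free_gen n (Suc i) \<in> carrier (free_group n)"
    using i by (auto intro: free_gen_closed)
  let ?t = "top_pt (Suc i)" and ?b = "bot_pt (Suc i)" and ?c = "right_of i"
  let ?tail = "linepath 0 \<i> +++ linepath \<i> ?t"
  have half: "linepath ?t ?c \<in> paths (Sigma_B n) ?t ?c" "linepath ?b ?c \<in> paths (Sigma_B n) ?b ?c"
    by (rule monodromy_linepath_chart_0(1); use half_integer(1)[of "Suc i"] in simp)+
  note Tp = std_twist_paths[OF i]
  have mid: "?c = (1/2) *\<^sub>R (?t + ?b)" by (simp add: complex_eq_iff)
  have "linepath ?t ?b = linepath ?t ?c +++ reversepath (linepath ?b ?c)"
    using linepath_join_midpoint[of ?t ?b] by (simp add: mid)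
  then have d: "std_twist i \<circ> descent (Suc i)
      = (std_twist i \<circ> ?tail) +++ ((std_twist i \<circ> linepath ?t ?c) +++ reversepath (std_twist i \<circ> linepath ?b ?c))"
    by (simp add: descent_def path_compose_join comp_reversepath[symmetric] del: reversepath_linepath)
  let ?y = "x \<otimes>\<^bsub>free_group n\<^esub> inv\<^bsub>free_group n\<^esub> free_gen n (Suc i)"
  have 1: "monodromy n (std_twist i \<circ> ?tail) x = x"
  proof -
    have "monodromy n ?tail x = x"
      by (rule monodromy_chart_0, rule paths_join[of _ _ _ \<i>]; rule linepath_chart_0; simp)
    then show ?thesis
      using monodromy_std_twist_fixed[OF descent_parts(1) tail_far] i by simp
  qed
  have 2: "monodromy n (std_twist i \<circ> linepath ?t ?c) x = ?y"
    using cover.transport_homotopic[OF std_twist_half_line_homotopic[of 1 n i]] monodromy_detour(1)[OF i x]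
    by (simp add: half_pt_eq)
  have 3: "monodromy n (reversepath (std_twist i \<circ> linepath ?b ?c)) ?y = ?y \<otimes>\<^bsub>free_group n\<^esub> free_gen n i"
  proof -
    have "monodromy n (std_twist i \<circ> linepath ?b ?c) (?y \<otimes>\<^bsub>free_group n\<^esub> free_gen n i) = ?y"
      using cover.transport_homotopic[OF std_twist_half_line_homotopic[of "-1" n i]]
        monodromy_detour(2)[OF i, of "?y \<otimes>\<^bsub>free_group n\<^esub> free_gen n i"] x u
      by (simp add: half_pt_eq F.m_assoc)
    then show ?thesis using monodromy_reversepath[OF Tp[OF half(2)], of "?y \<otimes>\<^bsub>free_group n\<^esub> free_gen n i"] by simp
  qed
  show ?thesis
    unfolding d
    using monodromy_join[OF Tp[OF descent_parts(1)] paths_join[OF Tp[OF half(1)] paths_reversepath[OF Tp[OF half(2)]]]]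
      monodromy_join[OF Tp[OF half(1)] paths_reversepath[OF Tp[OF half(2)]]] 1 2 3
    by simp
qed

text \<open>\<open>box_loop j\<close> contains the descents j and j+1. The moved one is the way back
  for j = i, which gives u_i (u_i^-1 u_{i+1}), and the way down for j = i+1, which gives (u_{i+1}^-1
  u_i) u_{i+1}.\<close>

lemma monodromy_std_twist_box:
  assumes i: "i \<in> {1..n - 1}" and j: "j \<in> {1..n}"
  shows "monodromy n (std_twist i \<circ> box_loop j) \<one>\<^bsub>free_group n\<^esub> =
    (if j = i then free_gen n (Suc i)
     else if j = Suc i then inv\<^bsub>free_group n\<^esub> free_gen n (Suc i) \<otimes>\<^bsub>free_group n\<^esub> free_gen n i
       \<otimes>\<^bsub>free_group n\<^esub> free_gen n (Suc i)
     else free_gen n j)"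
proof -
  interpret F: group "free_group n" by (rule group_free)
  have [simp]: "free_gen n i \<in> carrier (free_group n)" "free_gen n (Suc i) \<in> carrier (free_group n)"
    "free_gen n j \<in> carrier (free_group n)"
    using i j by (auto intro: free_gen_closed)
  note Tp = std_twist_paths[OF i]
  note d = Tp[OF paths_mono[OF descent_paths chart_subset]]
  note b = Tp[OF paths_mono[OF bottom_paths[OF j] chart_subset]]
  have e: "monodromy n (std_twist i \<circ> box_loop j) x
      = monodromy n (reversepath (std_twist i \<circ> descent (Suc j))) (monodromy n (std_twist i \<circ> bottom_edge j) (monodromy n (std_twist i \<circ> descent j) x))" for x
    using monodromy_join[OF paths_join[OF d b] paths_reversepath[OF d]] monodromy_join[OF d b]
    by (simp add: box_loop_def path_compose_join comp_reversepath)
  have rev: "monodromy n (reversepath (std_twist i \<circ> descent (Suc j))) y = y" if "j \<noteq> i" for y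
    using monodromy_reversepath[OF d, of "Suc j" y] monodromy_std_twist_descent[OF i, of "Suc j" y] that by simp
  show ?thesis
  proof (cases "j = i")
    case True
    \<comment> \<open>The element that the moved descent carries to u_i, so that the reversed path
      carries u_i back to it.\<close>
    let ?y = "free_gen n (Suc i)"
    have "monodromy n (std_twist i \<circ> descent (Suc i)) ?y = free_gen n i"
      using monodromy_std_twist_descent_middle[OF i, of ?y] by (simp add: F.m_assoc)
    then have "monodromy n (reversepath (std_twist i \<circ> descent (Suc i))) (free_gen n i) = ?y"
      using monodromy_reversepath[OF d, of "Suc i" ?y] by simp
    then show ?thesis
      using True e monodromy_std_twist_descent[OF i, of i] monodromy_std_twist_bottom[OF j F.one_closed] by simp
  next
    case False
    show ?thesis
    proof (cases "j = Suc i")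
      case True
      then show ?thesis
        using e rev monodromy_std_twist_descent_middle[OF i F.one_closed]
          monodromy_std_twist_bottom[OF j, of "inv\<^bsub>free_group n\<^esub> free_gen n (Suc i) \<otimes>\<^bsub>free_group n\<^esub> free_gen n i"] by simp
    next
      case False
      then show ?thesis
        using \<open>j \<noteq> i\<close> e rev monodromy_std_twist_descent[OF i False] monodromy_std_twist_bottom[OF j F.one_closed] by simp
    qed
  qed
qed

section \<open>Artin's representation\<close>

text \<open>Bijectivity comes from the map induced by the opposite twist; the values on generators
  come from the box loops that represent them.\<close>

lemma induced_on_free_std_twist:
  assumes i: "i \<in> {1..n - 1}"
  shows "f \<in> carrier (free_group n) \<Longrightarrow>
      free_to_pi1 n (induced_on_free n (std_twist i) f) = pi1_map (Sigma_B n) (std_twist i) (free_to_pi1 n f)"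
    and "induced_on_free n (std_twist i) \<in> auto (free_group n)"
    and "j \<in> {1..n} \<Longrightarrow> induced_on_free n (std_twist i) (free_gen n j) = monodromy n (std_twist i \<circ> box_loop j) \<one>\<^bsub>free_group n\<^esub>"
proof -
  let ?F = "free_group n" and ?P = "pi1 (Sigma_B n) 0" and ?R = "twist i 1 (1/2)"
  interpret F: group ?F by (rule group_free)
  have i1: "1 \<le> i" using i by simp
  have iso: "free_to_pi1 n \<in> iso ?F ?P" by (rule free_to_pi1_iso)
  have bij: "bij_betw (free_to_pi1 n) (carrier ?F) (carrier ?P)" using iso by (simp add: iso_def)
  have inv_iso: "inv_into (carrier ?F) (free_to_pi1 n) \<in> iso ?P ?F"
    using iso by (rule F.iso_set_sym)
  have R: "?R \<in> Sigma_B n \<rightarrow> Sigma_B n" "?R 0 = 0" "continuous_on (Sigma_B n) ?R"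
    using twist_Sigma_B[OF i, of "1/2" 1] twist_zero[OF i1, of "1/2" 1] continuous_on_twist[of "1/2"] by auto
  note Tm = pi1_map_loop_class[OF continuous_on_std_twist std_twist_Sigma_B[OF i], where x = 0]
    and Rm = pi1_map_loop_class[OF R(3,1), where x = 0]
  have Tl: "std_twist i \<circ> p \<in> loops (Sigma_B n) 0" if "p \<in> loops (Sigma_B n) 0" for p
    using loops_image[OF continuous_on_std_twist std_twist_Sigma_B[OF i] that] std_twist_zero[OF i1] by simp
  have Rl: "?R \<circ> p \<in> loops (Sigma_B n) 0" if "p \<in> loops (Sigma_B n) 0" for p
    using loops_image[OF R(3,1) that] R(2) by simp
  have TR: "std_twist i \<circ> (?R \<circ> p) = p" "?R \<circ> (std_twist i \<circ> p) = p" for p :: "real \<Rightarrow> complex"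
    using twist_twist[of i 1 "1/2"] twist_twist[of i "-1" "1/2"] by (simp_all add: half_twist_eq_twist fun_eq_iff)
  have "bij_betw (pi1_map (Sigma_B n) (std_twist i)) (carrier ?P) (carrier ?P)"
    by (rule bij_betw_byWitness[of _ "pi1_map (Sigma_B n) ?R"])
      (auto simp: carrier_pi1 Tm Rm Tl Rl TR)
  then have std_twist_iso: "pi1_map (Sigma_B n) (std_twist i) \<in> iso ?P ?P"
    using pi1_map_hom[OF continuous_on_std_twist std_twist_Sigma_B[OF i] std_twist_zero[OF i1]] by (simp add: iso_def)
  \<comment> \<open>The unrestricted composite of isomorphisms. \<open>induced_on_free\<close>
    agrees with it on the carrier and thereby inherits the homomorphism property and
    bijectivity.\<close>
  define g where "g = inv_into (carrier ?F) (free_to_pi1 n) \<circ> (pi1_map (Sigma_B n) (std_twist i) \<circ> free_to_pi1 n)"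
  have eq: "induced_on_free n (std_twist i) f = g f" if "f \<in> carrier ?F" for f
    using that by (simp add: induced_on_free_def g_def)
  have g_iso: "g \<in> iso ?F ?F"
    unfolding g_def by (rule iso_set_trans[OF iso_set_trans[OF iso std_twist_iso] inv_iso])
  have "induced_on_free n (std_twist i) \<in> hom ?F ?F"
  proof (rule homI)
    have h: "g \<in> hom ?F ?F"
      using g_iso by (simp add: iso_def)
    fix f assume f: "f \<in> carrier ?F"
    show "induced_on_free n (std_twist i) f \<in> carrier ?F"
      unfolding eq[OF f] by (rule hom_in_carrier[OF h f])
    fix f' assume f': "f' \<in> carrier ?F"
    show "induced_on_free n (std_twist i) (f \<otimes>\<^bsub>?F\<^esub> f') = induced_on_free n (std_twist i) f \<otimes>\<^bsub>?F\<^esub> induced_on_free n (std_twist i) f'"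
      unfolding eq[OF f] eq[OF f'] eq[OF F.m_closed[OF f f']] by (rule hom_mult[OF h f f'])
  qed
  moreover have "bij_betw (induced_on_free n (std_twist i)) (carrier ?F) (carrier ?F)"
    using g_iso bij_betw_cong[of "carrier ?F" "induced_on_free n (std_twist i)" g, OF eq] by (simp add: iso_def)
  ultimately have "induced_on_free n (std_twist i) \<in> iso ?F ?F"
    by (simp add: iso_def)
  then show "induced_on_free n (std_twist i) \<in> auto (free_group n)"
    by (auto simp: auto_def iso_def Bij_def induced_on_free_def)
  show lift: "free_to_pi1 n (induced_on_free n (std_twist i) f) = pi1_map (Sigma_B n) (std_twist i) (free_to_pi1 n f)"
    if "f \<in> carrier ?F" for f
  proof -
    have "pi1_map (Sigma_B n) (std_twist i) (free_to_pi1 n f) \<in> carrier ?P"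
      using std_twist_iso iso that by (auto simp: iso_def hom_def)
    then show ?thesis
      using bij that by (simp add: induced_on_free_def bij_betw_def f_inv_into_f)
  qed
  assume j: "j \<in> {1..n}"
  note u = free_gen_closed[OF j]
  have "free_to_pi1 n (induced_on_free n (std_twist i) (free_gen n j)) = loop_class (Sigma_B n) (std_twist i \<circ> box_loop j)"
    using lift[OF u] by (simp add: free_to_pi1_gen_box[OF j] Tm box_in_loops[OF j])
  also have "\<dots> = free_to_pi1 n (monodromy n (std_twist i \<circ> box_loop j) \<one>\<^bsub>?F\<^esub>)"
    using loop_class_free_to_pi1(2)[OF Tl[OF box_in_loops[OF j]]] by simp
  finally have e: "free_to_pi1 n (induced_on_free n (std_twist i) (free_gen n j))
      = free_to_pi1 n (monodromy n (std_twist i \<circ> box_loop j) \<one>\<^bsub>?F\<^esub>)" .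
  have "induced_on_free n (std_twist i) \<in> hom ?F ?F"
    using \<open>induced_on_free n (std_twist i) \<in> auto (free_group n)\<close> by (simp add: auto_def)
  from hom_in_carrier[OF this u]
  show "induced_on_free n (std_twist i) (free_gen n j) = monodromy n (std_twist i \<circ> box_loop j) \<one>\<^bsub>?F\<^esub>"
    using loop_class_free_to_pi1(1)[OF Tl[OF box_in_loops[OF j]]]
    by (rule inj_onD[OF bij_betw_imp_inj_on[OF bij] e])
qed

lemma pi1_map_free_to_pi1_braid_twist:
  assumes "i \<in> {1..n - 1}" "\<sigma> \<in> braid_twist n i" "f \<in> carrier (free_group n)"
  shows "pi1_map (Sigma_B n) \<sigma> (free_to_pi1 n f) = pi1_map (Sigma_B n) (std_twist i) (free_to_pi1 n f)"
proof -
  obtain p where "p \<in> loops (Sigma_B n) 0" "free_to_pi1 n f = loop_class (Sigma_B n) p"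
    using free_to_pi1_monodromy[OF assms(3)] by blast
  then show ?thesis
    using pi1_map_braid_twist[OF assms(1,2)] pi1_map_braid_twist[OF assms(1) std_twist_in_braid_twist[OF assms(1)]]
    by simp
qed

text \<open>All representatives induce the same map on classes, and the restriction to the carrier
  makes the functions literally equal, so \<open>the_elem\<close> is applied to a singleton.\<close>

lemma the_elem_induced:
  assumes i: "i \<in> {1..n - 1}"
  shows "the_elem (induced_on_free n ` braid_twist n i) = induced_on_free n (std_twist i)"
proof -
  have "induced_on_free n \<sigma> = induced_on_free n (std_twist i)" if "\<sigma> \<in> braid_twist n i" for \<sigma>
    unfolding induced_on_free_def
    by (rule restrict_ext) (simp add: pi1_map_free_to_pi1_braid_twist[OF i that])
  then have "induced_on_free n ` braid_twist n i = {induced_on_free n (std_twist i)}"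
    using std_twist_in_braid_twist[OF i] by blast
  then show ?thesis by simp
qed

lemma pres_hom_artin_rep:
  "pres_hom (AutoGroup (free_group n)) {1..n - 1} (braid_relations n)
     (\<lambda>i. the_elem (induced_on_free n ` braid_twist n i))"
proof (rule pres_hom_artin_automorphisms)
  fix i assume "1 \<le> i" "i < n"
  then have i: "i \<in> {1..n - 1}" "i \<in> {1..n}" "Suc i \<in> {1..n}" by auto
  note ind = induced_on_free_std_twist[OF i(1)] and box = monodromy_std_twist_box[OF i(1)]
  show "the_elem (induced_on_free n ` braid_twist n i) \<in> auto (free_group n)"
    using ind(2) by (simp add: the_elem_induced[OF i(1)])
  show "the_elem (induced_on_free n ` braid_twist n i) (free_gen n i) = free_gen n (Suc i)"
    using ind(3)[OF i(2)] box[OF i(2)] by (simp add: the_elem_induced[OF i(1)])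
  show "the_elem (induced_on_free n ` braid_twist n i) (free_gen n (Suc i))
      = inv\<^bsub>free_group n\<^esub> free_gen n (Suc i) \<otimes>\<^bsub>free_group n\<^esub> free_gen n i \<otimes>\<^bsub>free_group n\<^esub> free_gen n (Suc i)"
    using ind(3)[OF i(3)] box[OF i(3)] by (simp add: the_elem_induced[OF i(1)])
  fix j assume "1 \<le> j" "j \<le> n" "j \<noteq> i" "j \<noteq> Suc i"
  then show "the_elem (induced_on_free n ` braid_twist n i) (free_gen n j) = free_gen n j"
    using ind(3)[of j] box[of j] by (simp add: the_elem_induced[OF i(1)])
qed

lemmas artin_rep_hom = pres_hom.pres_lift_hom[OF pres_hom_artin_rep, folded braid_group_def artin_rep_def]

lemma artin_rep_gen:
  assumes "i \<in> {1..n - 1}"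
  shows "artin_rep n (braid_gen n i) = induced_on_free n (std_twist i)"
  using pres_hom.pres_lift_gen[OF pres_hom_artin_rep assms] the_elem_induced[OF assms]
  by (simp add: artin_rep_def braid_gen_def)

lemma artin_rep_gen_free_gen:
  assumes i: "i \<in> {1..n - 1}"
  shows "artin_rep n (braid_gen n i) (free_gen n i) = free_gen n (Suc i)"
    and "artin_rep n (braid_gen n i) (free_gen n (Suc i))
      = inv\<^bsub>free_group n\<^esub> free_gen n (Suc i) \<otimes>\<^bsub>free_group n\<^esub> free_gen n i \<otimes>\<^bsub>free_group n\<^esub> free_gen n (Suc i)"
    and "j \<in> {1..n} \<Longrightarrow> j \<noteq> i \<Longrightarrow> j \<noteq> Suc i \<Longrightarrow> artin_rep n (braid_gen n i) (free_gen n j) = free_gen n j"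
proof -
  have "i \<in> {1..n}" "Suc i \<in> {1..n}" using i by auto
  then show "artin_rep n (braid_gen n i) (free_gen n i) = free_gen n (Suc i)"
    "artin_rep n (braid_gen n i) (free_gen n (Suc i))
      = inv\<^bsub>free_group n\<^esub> free_gen n (Suc i) \<otimes>\<^bsub>free_group n\<^esub> free_gen n i \<otimes>\<^bsub>free_group n\<^esub> free_gen n (Suc i)"
    "j \<in> {1..n} \<Longrightarrow> j \<noteq> i \<Longrightarrow> j \<noteq> Suc i \<Longrightarrow> artin_rep n (braid_gen n i) (free_gen n j) = free_gen n j"
    by (simp_all add: artin_rep_gen[OF i] induced_on_free_std_twist(3)[OF i] monodromy_std_twist_box[OF i])
qed

lemma artin_action_artin_rep: "n \<ge> 2 \<Longrightarrow> artin_action n (artin_rep n)"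
  by (intro artin_action.intro aut_action.intro aut_action_axioms.intro artin_action_axioms.intro
      group_free group_braid artin_rep_hom artin_rep_gen_free_gen)

theorem proposition2p1:
  fixes n :: nat
  assumes "n \<ge> 2"
  shows
    \<comment> \<open>(1): identification of the free group, well-definedness, the topological description
       (for every representative of the braid twist), the algebraic description\<close>
    "(free_to_pi1 n \<in> iso (free_group n) (pi1 (Sigma_B n) 0) \<and>
      (\<forall>i\<in>{1..n}. free_to_pi1 n (free_gen n i) = loop_class (Sigma_B n) (gamma i))) \<and>
     artin_rep n \<in> hom (braid_group n) (AutoGroup (free_group n)) \<and>
     (\<forall>i\<in>{1..n - 1}. braid_twist n i \<noteq> {} \<and>
        (\<forall>\<sigma>\<in>braid_twist n i. \<forall>f\<in>carrier (free_group n).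
           free_to_pi1 n (artin_rep n (braid_gen n i) f)
             = pi1_map (Sigma_B n) \<sigma> (free_to_pi1 n f))) \<and>
     (\<forall>i\<in>{1..n - 1}.
        artin_rep n (braid_gen n i) (free_gen n i) = free_gen n (i + 1) \<and>
        artin_rep n (braid_gen n i) (free_gen n (i + 1))
          = inv\<^bsub>free_group n\<^esub> (free_gen n (i + 1))
              \<otimes>\<^bsub>free_group n\<^esub> free_gen n i \<otimes>\<^bsub>free_group n\<^esub> free_gen n (i + 1) \<and>
        (\<forall>j\<in>{1..n} - {i, i + 1}.
           artin_rep n (braid_gen n i) (free_gen n j) = free_gen n j)) \<and>
     \<comment> \<open>(2)\<close>
     (\<exists>\<Phi>. \<Phi> \<in> iso (semidirect_product (free_group n) (braid_group n) (artin_rep n)) (artin_B n) \<and>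
        (\<forall>f\<in>carrier (free_group n). \<forall>g\<in>carrier (braid_group n). pi_B n (\<Phi> (f, g)) = g) \<and>
        (\<forall>g\<in>carrier (braid_group n). \<Phi> (\<one>\<^bsub>free_group n\<^esub>, g) = s_B n g)) \<and>
     (artin_B n)\<lparr>carrier := kernel (artin_B n) (braid_group n) (pi_B n)\<rparr> \<cong> free_group n"
proof -
  interpret artin_action n "artin_rep n"
    using assms by (rule artin_action_artin_rep)
  have "braid_twist n i \<noteq> {}" if "i \<in> {1..n - 1}" for i
    using std_twist_in_braid_twist[OF that] by blast
  moreover have "free_to_pi1 n (artin_rep n (braid_gen n i) f) = pi1_map (Sigma_B n) \<sigma> (free_to_pi1 n f)"
    if "i \<in> {1..n - 1}" "\<sigma> \<in> braid_twist n i" "f \<in> carrier (free_group n)" for i \<sigma> f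
    using that by (simp add: artin_rep_gen induced_on_free_std_twist(1) pi1_map_free_to_pi1_braid_twist)
  moreover have "\<exists>\<Phi>. \<Phi> \<in> iso (semidirect_product (free_group n) (braid_group n) (artin_rep n)) (artin_B n) \<and>
        (\<forall>f\<in>carrier (free_group n). \<forall>g\<in>carrier (braid_group n). pi_B n (\<Phi> (f, g)) = g) \<and>
        (\<forall>g\<in>carrier (braid_group n). \<Phi> (\<one>\<^bsub>free_group n\<^esub>, g) = s_B n g)"
    using Phi_iso pi_B_Phi Phi_section by blast
  ultimately show ?thesis
    using free_to_pi1_iso free_to_pi1_gen artin_rep_hom artin_rep_gen_free_gen kernel_pi_B_iso
    by (intro conjI ballI) simp_all
qed

end
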